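(* Let $G$ be a discrete group acting by homeomorphisms on a compact Hausdorff space $X$, and let $\mu$ be a $G$-invariant regular Borel probability measure on $X$. For every $k\ge2$, a nondiagonal tuple in $X^k$ is a $\mu$-IN-tuple if and only if it is a $\mu$-sequence entropy tuple.
   Context: $G$ is not assumed amenable. A tuple $(x_1,\dots,x_k)$ is nondiagonal if its entries are not all equal. $\mu$-IN-tuples. Let $\mathscr B'(\mu,\delta)$ be the set of maps $D$ from $G$ to the Borel subsets of $X$, $s\mapsto D_s$, with $\inf_{s\in G}\mu(D_s)\ge1-\delta$. For a tuple $\boldsymbol A=(A_1,\dots,A_k)$ of subsets of $X$, $J\subseteq G$ is an independence set for $\boldsymbol A$ relative to $D$ if $\bigcap_{s\in F}(D_s\cap s^{-1}A_{\sigma(s)})\ne\emptyset$ for every nonempty finite $F\subseteq J$ and every $\sigma:F\to\{1,\dots,k\}$. $\boldsymbol A$ has positive sequential $\mu$-independence density if there are $\delta>0$ and $c>0$ such that for every $M>0$ there is a finite $F\subseteq G$ with $|F|\ge M$ such that for every $D\in\mathscr B'(\mu,\delta)$ there is an independence set $I\subseteq F$ for $\boldsymbol A$ relative to $D$ with $|I|\ge c|F|$. $(x_1,\dots,x_k)\in X^k$ is a $\mu$-IN-tuple if for every product neighbourhood $U_1\times\cdots\times U_k$ of it, $(U_1,\dots,U_k)$ has positive sequential $\mu$-independence density. $\mu$-sequence entropy tuples. For a finite Borel partition $\mathcal P$ of $X$, $H(\mathcal P)=\sum_{P\in\mathcal P}-\mu(P)\ln\mu(P)$, and for a sequence $\mathfrak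 s=\{s_j\}_{j\in\mathbb N}$ in $G$, $h_\mu(\mathcal P;\mathfrak s)=\limsup_{n\to\infty}\frac1nH(\bigvee_{i=1}^ns_i^{-1}\mathcal P)$. A nondiagonal tuple $(x_1,\dots,x_k)\in X^k$, $k\ge2$, is a ($\mu$-)sequence entropy tuple if whenever $U_1,\dots,U_l$ are pairwise disjoint Borel neighbourhoods of the distinct points in the list $x_1,\dots,x_k$, every finite Borel partition $\mathcal P$ of $X$ refining the cover $\{X\setminus U_1,\dots,X\setminus U_l\}$ satisfies $h_\mu(\mathcal P;\mathfrak s)>0$ for some sequence $\mathfrak s$ in $G$. *)

theory Defs
  imports "HOL-Probability.Probability_Measure" "HOL-Algebra.Group_Action"
begin

text \<open>
  The acting group is a HOL-Algebra group \<open>G\<close>, and the action is a library \<open>group_action\<close>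
  \<open>\<phi>\<close> on the universe of a topological type, so that \<open>\<phi> s x\<close> is the point \<open>s x\<close>. A \<open>k\<close>-tuple is
  a function on \<open>nat\<close>, of which only the values at \<open>1, \<dots>, k\<close> are used.
\<close>

definition regular_borel_measure :: "'x::topological_space measure \<Rightarrow> bool" where
  "regular_borel_measure \<mu> \<longleftrightarrow>
     sets \<mu> = sets borel \<and>
     (\<forall>B\<in>sets \<mu>. emeasure \<mu> B = (INF U\<in>{U. B \<subseteq> U \<and> open U}. emeasure \<mu> U)) \<and>
     (\<forall>B\<in>sets \<mu>. emeasure \<mu> B = (SUP K\<in>{K. K \<subseteq> B \<and> compact K}. emeasure \<mu> K))"

definition invariant_measure ::
    "('g, 'm) monoid_scheme \<Rightarrow> ('g \<Rightarrow> 'x \<Rightarrow> 'x) \<Rightarrow> 'x measure \<Rightarrow> bool" where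
  "invariant_measure G \<phi> \<mu> \<longleftrightarrow>
     (\<forall>s\<in>carrier G. \<forall>B\<in>sets \<mu>. emeasure \<mu> (\<phi> s ` B) = emeasure \<mu> B)"

definition translate ::
    "('g, 'm) monoid_scheme \<Rightarrow> ('g \<Rightarrow> 'x \<Rightarrow> 'x) \<Rightarrow> 'g \<Rightarrow> 'x set \<Rightarrow> 'x set" where
  \<comment> \<open>the set \<open>s\<^sup>-\<^sup>1 A\<close>\<close>
  "translate G \<phi> s A = \<phi> (inv\<^bsub>G\<^esub> s) ` A"

definition nondiagonal :: "nat \<Rightarrow> (nat \<Rightarrow> 'x) \<Rightarrow> bool" where
  "nondiagonal k x \<longleftrightarrow> (\<exists>i\<in>{1..k}. \<exists>j\<in>{1..k}. x i \<noteq> x j)"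


subsection \<open>IN-tuples\<close>

text \<open>The maps in \<open>\<B>'(\<mu>, \<delta>)\<close>; their values outside \<open>carrier G\<close> are unconstrained and never used.\<close>

definition B_prime ::
    "('g, 'm) monoid_scheme \<Rightarrow> 'x measure \<Rightarrow> real \<Rightarrow> ('g \<Rightarrow> 'x set) set" where
  "B_prime G \<mu> \<delta> =
     {D \<in> carrier G \<rightarrow> sets \<mu>. (INF s\<in>carrier G. measure \<mu> (D s)) \<ge> 1 - \<delta>}"

definition independence_set ::
    "('g, 'm) monoid_scheme \<Rightarrow> ('g \<Rightarrow> 'x \<Rightarrow> 'x) \<Rightarrow> nat \<Rightarrow> (nat \<Rightarrow> 'x set) \<Rightarrow>
     ('g \<Rightarrow> 'x set) \<Rightarrow> 'g set \<Rightarrow> bool" where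
  "independence_set G \<phi> k A D J \<longleftrightarrow>
     J \<subseteq> carrier G \<and>
     (\<forall>F \<sigma>. F \<noteq> {} \<and> finite F \<and> F \<subseteq> J \<and> \<sigma> \<in> F \<rightarrow> {1..k} \<longrightarrow>
        (\<Inter>s\<in>F. D s \<inter> translate G \<phi> s (A (\<sigma> s))) \<noteq> {})"

definition pos_seq_independence_density ::
    "('g, 'm) monoid_scheme \<Rightarrow> ('g \<Rightarrow> 'x \<Rightarrow> 'x) \<Rightarrow> 'x measure \<Rightarrow> nat \<Rightarrow>
     (nat \<Rightarrow> 'x set) \<Rightarrow> bool" where
  "pos_seq_independence_density G \<phi> \<mu> k A \<longleftrightarrow>
     (\<exists>\<delta>>0. \<exists>c>(0::real). \<forall>M>(0::real). \<exists>F.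
        finite F \<and> F \<subseteq> carrier G \<and> real (card F) \<ge> M \<and>
        (\<forall>D\<in>B_prime G \<mu> \<delta>. \<exists>I\<subseteq>F.
           independence_set G \<phi> k A D I \<and> real (card I) \<ge> c * real (card F)))"

definition IN_tuple ::
    "('g, 'm) monoid_scheme \<Rightarrow> ('g \<Rightarrow> 'x \<Rightarrow> 'x) \<Rightarrow> 'x::topological_space measure \<Rightarrow>
     nat \<Rightarrow> (nat \<Rightarrow> 'x) \<Rightarrow> bool" where
  "IN_tuple G \<phi> \<mu> k x \<longleftrightarrow>
     (\<forall>U. (\<forall>i\<in>{1..k}. x i \<in> interior (U i)) \<longrightarrow> pos_seq_independence_density G \<phi> \<mu> k U)"


subsection \<open>Sequence entropy tuples\<close>

definition finite_borel_partition :: "'x measure \<Rightarrow> 'x set set \<Rightarrow> bool" where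
  "finite_borel_partition \<mu> P \<longleftrightarrow> finite P \<and> P \<subseteq> sets \<mu> \<and> partition_on UNIV P"

text \<open>Since \<open>ln 0 = 0\<close>, null members contribute \<open>0\<close> to the sum.\<close>

definition partition_entropy :: "'x measure \<Rightarrow> 'x set set \<Rightarrow> real" where
  "partition_entropy \<mu> P = (\<Sum>A\<in>P. - measure \<mu> A * ln (measure \<mu> A))"

definition partition_join :: "'i set \<Rightarrow> ('i \<Rightarrow> 'x set set) \<Rightarrow> 'x set set" where
  "partition_join I P = {(\<Inter>i\<in>I. A i) | A. A \<in> Pi I P} - {{}}"

text \<open>The term for \<open>n = 0\<close> is a division by zero, irrelevant to the limit superior.\<close>

definition seq_entropy ::
    "('g, 'm) monoid_scheme \<Rightarrow> ('g \<Rightarrow> 'x \<Rightarrow> 'x) \<Rightarrow> 'x measure \<Rightarrow> 'x set set \<Rightarrow>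
     (nat \<Rightarrow> 'g) \<Rightarrow> ereal" where
  "seq_entropy G \<phi> \<mu> P s =
     limsup (\<lambda>n. ereal (1 / real n *
       partition_entropy \<mu> (partition_join {1..n} (\<lambda>i. translate G \<phi> (s i) ` P))))"

definition refines_cover :: "'x set set \<Rightarrow> 'x set set \<Rightarrow> bool" where
  "refines_cover P C \<longleftrightarrow> (\<forall>A\<in>P. \<exists>B\<in>C. A \<subseteq> B)"

text \<open>
  The neighbourhoods \<open>U\<close> are indexed by the set \<open>x ` {1..k}\<close> of distinct points of the tuple.
\<close>

definition seq_entropy_tuple ::
    "('g, 'm) monoid_scheme \<Rightarrow> ('g \<Rightarrow> 'x \<Rightarrow> 'x) \<Rightarrow> 'x::topological_space measure \<Rightarrow>
     nat \<Rightarrow> (nat \<Rightarrow> 'x) \<Rightarrow> bool" where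
  "seq_entropy_tuple G \<phi> \<mu> k x \<longleftrightarrow>
     k \<ge> 2 \<and> nondiagonal k x \<and>
     (\<forall>U. (\<forall>y\<in>x ` {1..k}. U y \<in> sets \<mu> \<and> y \<in> interior (U y)) \<and>
          disjoint_family_on U (x ` {1..k}) \<longrightarrow>
        (\<forall>P. finite_borel_partition \<mu> P \<and> refines_cover P ((\<lambda>y. UNIV - U y) ` x ` {1..k}) \<longrightarrow>
           (\<exists>s. range s \<subseteq> carrier G \<and> seq_entropy G \<phi> \<mu> P s > 0)))"

end

theory Submission
  imports Defs "HOL-Probability.Conditional_Expectation" "HOL-Real_Asymp.Real_Asymp"
begin

text \<open>
  The proof goes through the Kronecker factor of the action: the \<open>\<sigma>\<close>-algebra of those sets whose
  orbit under \<open>G\<close> is totally bounded in \<open>L\<^sup>1(\<mu>)\<close>, called almost periodic below. Let \<open>V\<^sub>y\<close> be disjoint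
  neighbourhoods of the distinct points \<open>y\<close> of the tuple.

  From entropy to independence. All translates of a partition into almost periodic sets are
  approximated by finitely many of them, so the entropy of their joins grows sublinearly along every
  sequence (\<open>ap_partition_zero_entropy\<close>). Hence, for a sequence entropy tuple, no partition into
  almost periodic sets refines the cover by the complements of the \<open>V\<^sub>y\<close>. It follows that the
  conditional probabilities of the \<open>V\<^sub>y\<close> given the almost periodic \<open>\<sigma>\<close>-algebra do not have product
  zero: they are all at least some \<open>\<eta> > 0\<close> on an almost periodic set \<open>E\<close> of positive measure. The
  differences between the indicators of the \<open>V\<^sub>y\<close> and these conditional probabilities are weakly
  mixing (\<open>weak_mixing_over_ap_algebra\<close>). One can therefore choose group elements \<open>s\<close> one
  after another such that \<open>s\<close> almost returns \<open>E\<close> to itself and each \<open>s\<^sup>-\<^sup>1 V\<^sub>y\<close> covers almost a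
  proportion \<open>\<eta>\<close> of every piece of \<open>E\<close> that the earlier translates leave uncovered
  (\<open>finite_independent_translates\<close>). So the part of \<open>E\<close> missed by any choice of one translate
  \<open>s\<^sup>-\<^sup>1 V\<^bsub>\<tau> s\<^esub>\<close> for each \<open>s\<close> is exponentially small in the number of translates, and this survives
  intersecting with sets \<open>D\<^sub>s\<close> of measure close to one. A combinatorial lemma in the spirit of
  Sauer and Shelah turns this smallness into an independence set of proportional size
  (\<open>linear_size_shattered_set\<close>).

  From independence to entropy. Concatenate the finite sets provided by positive density, each
  longer than everything before it, to a sequence. If the join of the first \<open>n\<close> translates of a
  partition refining the cover had small entropy, then at most \<open>exp (\<beta> n)\<close> of its cells, with
  \<open>\<beta>\<close> small, would already have a union \<open>D\<close> of measure at least \<open>1 - \<delta>\<close>. An independence set \<open>I\<close> relative to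
  \<open>D\<close> calls for \<open>k\<^bsup>|I|\<^esup>\<close> intersections to be met, but each cell avoids one of the \<open>k\<close> sets at
  every place and so meets at most \<open>(k - 1)\<^bsup>|I|\<^esup>\<close> of them (\<open>independence_entropy_bound\<close>).
\<close>

section \<open>Shattered sets and covering by boxes\<close>

text \<open>
  Keeping \<open>Q\<close> as a parameter allows an induction that restricts \<open>Q\<close> one coordinate at a time.
\<close>

definition shatters :: "('i \<Rightarrow> 'y \<Rightarrow> 'x set) \<Rightarrow> 'y set \<Rightarrow> 'x set \<Rightarrow> 'i set \<Rightarrow> bool" where
  "shatters A Y Q I \<longleftrightarrow> (\<forall>\<sigma>\<in>I \<rightarrow> Y. Q \<inter> (\<Inter>i\<in>I. A i (\<sigma> i)) \<noteq> {})"

text \<open>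
  With the factor \<open>1 / (|Y| - 1)\<close> per element, the total weight for \<open>Q\<close> is at least the sum of the
  weights for its pieces at a further coordinate divided by \<open>|Y| - 1\<close>, whether or not the pieces have
  shattered sets in common; see \<open>shatter_weight_insert\<close>.
\<close>

definition shatter_weight :: "('i \<Rightarrow> 'y \<Rightarrow> 'x set) \<Rightarrow> 'y set \<Rightarrow> 'i set \<Rightarrow> 'x set \<Rightarrow> real" where
  "shatter_weight A Y Z Q =
     (\<Sum>I\<in>{I\<in>Pow Z. shatters A Y Q I}. (1 / (real (card Y) - 1)) ^ card I)"

lemma shatters_mono: "shatters A Y Q I \<Longrightarrow> Q \<subseteq> Q' \<Longrightarrow> shatters A Y Q' I"
  unfolding shatters_def by blast

text \<open>
  An element that lies in some but not all of the sets \<open>S y\<close> is counted at most \<open>|Y| - 1\<close> times.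
\<close>

lemma sum_over_members_le:
  fixes w :: "'a \<Rightarrow> real"
  assumes Y: "finite Y" "Y \<noteq> {}" and S: "\<And>y. y \<in> Y \<Longrightarrow> finite (S y)" and w: "\<And>a. w a \<ge> 0"
  shows "(\<Sum>y\<in>Y. \<Sum>a\<in>S y. w a) \<le>
     (real (card Y) - 1) * (\<Sum>a\<in>(\<Union>y\<in>Y. S y). w a) + (\<Sum>a\<in>(\<Inter>y\<in>Y. S y). w a)"
proof -
  let ?U = "\<Union>y\<in>Y. S y" and ?I = "\<Inter>y\<in>Y. S y"
  have fU: "finite ?U" using Y S by blast
  have IU: "?I \<subseteq> ?U" using Y by blast
  have "(\<Sum>y\<in>Y. \<Sum>a\<in>S y. w a) = (\<Sum>y\<in>Y. \<Sum>a\<in>?U. if a \<in> S y then w a else 0)"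
  proof (rule sum.cong[OF refl])
    fix y assume "y \<in> Y"
    then have "?U \<inter> S y = S y" by blast
    then show "(\<Sum>a\<in>S y. w a) = (\<Sum>a\<in>?U. if a \<in> S y then w a else 0)"
      using sum.inter_restrict[OF fU, of w "S y"] by simp
  qed
  also have "\<dots> = (\<Sum>a\<in>?U. \<Sum>y\<in>Y. if a \<in> S y then w a else 0)"
    by (rule sum.swap)
  also have "\<dots> \<le> (\<Sum>a\<in>?U. (real (card Y) - 1) * w a + (if a \<in> ?I then w a else 0))"
  proof (rule sum_mono)
    fix a
    have e: "(\<Sum>y\<in>Y. if a \<in> S y then w a else 0) = real (card {y\<in>Y. a \<in> S y}) * w a"
      using Y by (simp add: sum.inter_filter[symmetric])
    show "(\<Sum>y\<in>Y. if a \<in> S y then w a else 0) \<le> (real (card Y) - 1) * w a + (if a \<in> ?I then w a else 0)"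
    proof (cases "a \<in> ?I")
      case True
      then have "{y\<in>Y. a \<in> S y} = Y" by blast
      then show ?thesis using e True by (simp add: algebra_simps)
    next
      case False
      then have "{y\<in>Y. a \<in> S y} \<subset> Y" by blast
      then have "card {y\<in>Y. a \<in> S y} < card Y" using Y psubset_card_mono by blast
      then have "real (card {y\<in>Y. a \<in> S y}) \<le> real (card Y) - 1" by linarith
      then show ?thesis unfolding e using False w[of a] by (simp only: if_False add_0_right mult_right_mono)
    qed
  qed
  also have "\<dots> = (real (card Y) - 1) * (\<Sum>a\<in>?U. w a) + (\<Sum>a\<in>?U. if a \<in> ?I then w a else 0)"
    by (simp add: sum.distrib sum_distrib_left)
  also have "(\<Sum>a\<in>?U. if a \<in> ?I then w a else 0) = (\<Sum>a\<in>?I. w a)"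
    using IU fU by (subst sum.inter_restrict[symmetric]) (auto intro!: sum.cong)
  finally show ?thesis .
qed

lemma shatter_weight_mono:
  assumes "finite Z" "Q \<subseteq> Q'" "card Y \<ge> 2" "Z' \<subseteq> Z"
  shows "shatter_weight A Y Z' Q \<le> shatter_weight A Y Z Q'"
  unfolding shatter_weight_def
  using assms by (intro sum_mono2) (auto intro: shatters_mono)

text \<open>
  A set shattered by one of the pieces \<open>Q \<inter> A z y\<close> is shattered by \<open>Q\<close>, and one shattered by all of them
  can be enlarged by \<open>z\<close>. This is the counting step of Pajor's proof of the Sauer--Shelah lemma, with
  weights that make it work for alphabets of more than two letters.
\<close>

lemma shatter_weight_insert:
  assumes Z: "finite Z" "z \<notin> Z" and Y: "finite Y" "card Y \<ge> 2"
  shows "(1 / (real (card Y) - 1)) * (\<Sum>y\<in>Y. shatter_weight A Y Z (Q \<inter> A z y))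
    \<le> shatter_weight A Y (insert z Z) Q"
proof -
  define c where "c = 1 / (real (card Y) - 1)"
  define w where "w = (\<lambda>I::'a set. c ^ card I)"
  have c: "c > 0" "c * (real (card Y) - 1) = 1" using Y by (auto simp: c_def)
  define S where "S = (\<lambda>y. {I\<in>Pow Z. shatters A Y (Q \<inter> A z y) I})"
  have Yne: "Y \<noteq> {}" using Y by auto
  let ?U = "\<Union>y\<in>Y. S y" and ?I = "\<Inter>y\<in>Y. S y"
  have UZ: "?U \<subseteq> Pow Z" "?I \<subseteq> Pow Z" using Yne by (auto simp: S_def)
  then have fin: "finite ?U" "finite ?I" using Z by (meson finite_Pow_iff finite_subset)+
  have finI: "finite I" if "I \<in> ?I" for I
  proof -
    have "I \<subseteq> Z" using that UZ(2) by blast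
    then show ?thesis using Z(1) by (rule finite_subset)
  qed
  have zI: "z \<notin> I" if "I \<in> ?I" for I using that UZ(2) Z(2) by blast
  have inj: "inj_on (insert z) ?I"
    by (intro inj_onI) (metis Diff_insert_absorb zI)
  have wi: "w (insert z I) = c * w I" if "I \<in> ?I" for I
    unfolding w_def card_insert_disjoint[OF finI[OF that] zI[OF that]] by simp
  have sub: "?U \<union> insert z ` ?I \<subseteq> {I\<in>Pow (insert z Z). shatters A Y Q I}"
  proof
    fix J assume J: "J \<in> ?U \<union> insert z ` ?I"
    show "J \<in> {I\<in>Pow (insert z Z). shatters A Y Q I}"
    proof (cases "J \<in> ?U")
      case True
      then show ?thesis unfolding S_def by (auto intro: shatters_mono[where Q = "Q \<inter> A z y" for y])
    next
      case False
      then obtain I where I: "I \<in> ?I" "J = insert z I" using J by blast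
      have "Q \<inter> (\<Inter>i\<in>J. A i (\<sigma> i)) \<noteq> {}" if s: "\<sigma> \<in> J \<rightarrow> Y" for \<sigma>
      proof -
        have "I \<in> S (\<sigma> z)" "\<sigma> \<in> I \<rightarrow> Y" using I s by auto
        then have "(Q \<inter> A z (\<sigma> z)) \<inter> (\<Inter>i\<in>I. A i (\<sigma> i)) \<noteq> {}"
          unfolding S_def shatters_def by blast
        then show ?thesis using I(2) by auto
      qed
      then have "shatters A Y Q J" unfolding shatters_def by blast
      then show ?thesis using I UZ by auto
    qed
  qed
  have "c * (\<Sum>y\<in>Y. shatter_weight A Y Z (Q \<inter> A z y)) = c * (\<Sum>y\<in>Y. \<Sum>I\<in>S y. w I)"
    by (simp add: shatter_weight_def S_def w_def c_def)
  also have "\<dots> \<le> c * ((real (card Y) - 1) * (\<Sum>I\<in>?U. w I) + (\<Sum>I\<in>?I. w I))"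
    using c Y Yne Z by (intro mult_left_mono sum_over_members_le) (auto simp: w_def S_def)
  also have "\<dots> = (\<Sum>I\<in>?U. w I) + (\<Sum>I\<in>?I. c * w I)"
    using c(2) by (simp only: distrib_left mult.assoc[symmetric] sum_distrib_left[symmetric] mult_1_left)
  also have "(\<Sum>I\<in>?I. c * w I) = (\<Sum>J\<in>insert z ` ?I. w J)"
    using inj wi by (simp add: sum.reindex)
  also have "(\<Sum>I\<in>?U. w I) + \<dots> = (\<Sum>J\<in>?U \<union> insert z ` ?I. w J)"
  proof (rule sum.union_disjoint[symmetric])
    show "?U \<inter> insert z ` ?I = {}" using UZ(1) Z(2) by blast
  qed (use fin in auto)
  also have "\<dots> \<le> (\<Sum>J\<in>{I\<in>Pow (insert z Z). shatters A Y Q I}. w J)"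
    using sub Z c by (intro sum_mono2) (auto simp: w_def)
  finally show ?thesis by (simp add: shatter_weight_def w_def c_def)
qed

lemma UN_insert_fun_upd:
  "z \<notin> Z \<Longrightarrow> (\<Union>i\<in>insert z Z. A i ((\<tau>(z := y)) i)) = A z y \<union> (\<Union>i\<in>Z. A i (\<tau> i))"
  by (simp, rule arg_cong[where f = "(\<union>) (A z y)"], rule SUP_cong) auto

text \<open>
  Process the coordinates one by one. If every piece \<open>Q \<inter> A z y\<close> carries at least the fraction \<open>t\<close> of the
  measure, branch into all pieces: the weight gains the factor \<open>|Y| / (|Y| - 1)\<close>, which by \<open>gain\<close> pays for
  the loss \<open>t\<close> of measure. Otherwise some piece is small and is discarded, at the cost of a factor
  \<open>1 - t\<close>. In both cases what remains avoids some \<open>A z y'\<close> (in the first case because the pieces are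
  disjoint), so that the bound on boxes carries over to the remaining coordinates; when none is left it
  bounds the measure itself.
\<close>

lemma (in finite_measure) shatter_weight_lower_bound:
  fixes A :: "'i \<Rightarrow> 'y \<Rightarrow> 'a set"
  assumes Z: "finite Z" and Y: "finite Y" "card Y \<ge> 2" and t: "0 < t" "t < 1" and al: "\<alpha> > 0"
    and gain: "real (card Y) / (real (card Y) - 1) * t powr \<alpha> \<ge> 1"
    and B: "B > 0"
    and A: "\<And>i y. i \<in> Z \<Longrightarrow> y \<in> Y \<Longrightarrow> A i y \<in> sets M"
    and disj: "\<And>i y y'. i \<in> Z \<Longrightarrow> y \<in> Y \<Longrightarrow> y' \<in> Y \<Longrightarrow> y \<noteq> y' \<Longrightarrow> A i y \<inter> A i y' = {}"
    and Q: "Q \<in> sets M"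
    and box: "\<And>\<tau>. \<tau> \<in> Z \<rightarrow> Y \<Longrightarrow> measure M (Q - (\<Union>i\<in>Z. A i (\<tau> i))) \<le> B"
  shows "((1 - t) ^ card Z * measure M Q / B) powr \<alpha> \<le> shatter_weight A Y Z Q"
  using Z A disj Q box
proof (induction Z arbitrary: Q rule: finite_induct)
  case empty
  show ?case
  proof (cases "Q = {}")
    case True
    then show ?thesis using al Y by (auto simp: shatter_weight_def intro!: sum_nonneg)
  next
    case False
    then have e: "{I\<in>Pow {}. shatters A Y Q I} = {{}}" by (auto simp: shatters_def)
    have e1: "{I. I = {} \<and> shatters A Y Q I} = {{}}" using e by auto
    have "measure M Q \<le> B" using empty.prems(4)[of undefined] by simp
    then have "(measure M Q / B) powr \<alpha> \<le> 1 powr \<alpha>"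
      using B al by (intro powr_mono2) auto
    then show ?thesis by (simp add: shatter_weight_def e1)
  qed
next
  case (insert z Z)
  let ?c = "1 / (real (card Y) - 1)"
  define X where "X = ((1 - t) ^ card Z * measure M Q / B) powr \<alpha>"
  have target: "((1 - t) ^ card (insert z Z) * measure M Q / B) = (1-t) * ((1 - t) ^ card Z * measure M Q / B)"
    using insert by simp
  have XX: "((1 - t) ^ card (insert z Z) * measure M Q / B) powr \<alpha> = (1-t) powr \<alpha> * X"
    unfolding target X_def using t B by (subst powr_mult) auto
  show ?case
  proof (cases "\<forall>y\<in>Y. measure M (Q \<inter> A z y) \<ge> t * measure M Q")
    case True
    have each: "t powr \<alpha> * X \<le> shatter_weight A Y Z (Q \<inter> A z y)" if y: "y \<in> Y" for y
    proof -
      obtain y' where y': "y' \<in> Y" "y' \<noteq> y"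
        using Y y by (metis card_le_Suc0_iff_eq not_less_eq_eq numeral_2_eq_2)
      have box': "measure M (Q \<inter> A z y - (\<Union>i\<in>Z. A i (\<tau> i))) \<le> B" if tau: "\<tau> \<in> Z \<rightarrow> Y" for \<tau>
      proof -
        have m: "A i ((\<tau>(z := y')) i) \<in> sets M" if "i \<in> insert z Z" for i
          using that tau y' insert.prems(1) by (cases "i = z") (auto simp: Pi_iff)
        have "A z y \<inter> A z y' = {}" using insert.prems(2) y y' by blast
        then have "Q \<inter> A z y - (\<Union>i\<in>Z. A i (\<tau> i)) \<subseteq> Q - (\<Union>i\<in>insert z Z. A i ((\<tau>(z := y')) i))"
          unfolding UN_insert_fun_upd[OF insert.hyps(2)] by blast
        moreover have "Q - (\<Union>i\<in>insert z Z. A i ((\<tau>(z := y')) i)) \<in> sets M"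
          using m insert.prems(3) insert.hyps by (intro sets.Diff sets.finite_UN) auto
        ultimately have "measure M (Q \<inter> A z y - (\<Union>i\<in>Z. A i (\<tau> i)))
            \<le> measure M (Q - (\<Union>i\<in>insert z Z. A i ((\<tau>(z := y')) i)))"
          by (rule finite_measure_mono)
        also have "\<dots> \<le> B"
          using tau y' insert.hyps by (intro insert.prems(4)) auto
        finally show ?thesis .
      qed
      have "t powr \<alpha> * X = ((1 - t) ^ card Z * (t * measure M Q) / B) powr \<alpha>"
        unfolding X_def using t B by (subst powr_mult[symmetric]) (auto simp: algebra_simps)
      also have "\<dots> \<le> ((1 - t) ^ card Z * measure M (Q \<inter> A z y) / B) powr \<alpha>"
        using True y t B al by (intro powr_mono2 divide_right_mono mult_left_mono) auto
      also have "\<dots> \<le> shatter_weight A Y Z (Q \<inter> A z y)"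
        using insert.prems y box' by (intro insert.IH) auto
      finally show ?thesis .
    qed
    have "(1-t) powr \<alpha> * X \<le> 1 * X"
      using t al by (intro mult_right_mono powr_le1) (auto simp: X_def)
    also have "1 * X \<le> (real (card Y) / (real (card Y) - 1) * t powr \<alpha>) * X"
      by (intro mult_right_mono gain) (auto simp: X_def)
    also have "\<dots> = ?c * (\<Sum>y\<in>Y. t powr \<alpha> * X)" by simp
    also have "\<dots> \<le> ?c * (\<Sum>y\<in>Y. shatter_weight A Y Z (Q \<inter> A z y))"
      using each Y by (intro mult_left_mono sum_mono) auto
    also have "\<dots> \<le> shatter_weight A Y (insert z Z) Q"
      using insert Y by (intro shatter_weight_insert) auto
    finally show ?thesis unfolding XX .
  next
    case False
    then obtain y where y: "y \<in> Y" "measure M (Q \<inter> A z y) < t * measure M Q" by force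
    have yz: "A z y \<in> sets M" using insert.prems y by blast
    have "measure M Q = measure M (Q \<inter> A z y) + measure M (Q - A z y)"
      using finite_measure_Diff'[OF insert.prems(3) yz] by simp
    then have big: "measure M (Q - A z y) \<ge> (1 - t) * measure M Q"
      using y by (simp add: algebra_simps)
    have "((1 - t) ^ card (insert z Z) * measure M Q / B) powr \<alpha>
        \<le> ((1 - t) ^ card Z * measure M (Q - A z y) / B) powr \<alpha>"
    proof -
      have "(1 - t) ^ card Z * ((1 - t) * measure M Q) / B \<le> (1 - t) ^ card Z * measure M (Q - A z y) / B"
        using big t B by (intro divide_right_mono mult_left_mono) auto
      then have "(1 - t) * ((1 - t) ^ card Z * measure M Q / B) \<le> (1 - t) ^ card Z * measure M (Q - A z y) / B"
        by (simp add: mult.left_commute)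
      then show ?thesis unfolding target using t B al by (intro powr_mono2) auto
    qed
    also have "\<dots> \<le> shatter_weight A Y Z (Q - A z y)"
    proof (rule insert.IH)
      fix \<tau> assume tau: "\<tau> \<in> Z \<rightarrow> Y"
      have "Q - A z y - (\<Union>i\<in>Z. A i (\<tau> i)) = Q - (\<Union>i\<in>insert z Z. A i ((\<tau>(z := y)) i))"
        unfolding UN_insert_fun_upd[OF insert.hyps(2)] by blast
      moreover have "\<tau>(z := y) \<in> insert z Z \<rightarrow> Y" using tau y by auto
      ultimately show "measure M (Q - A z y - (\<Union>i\<in>Z. A i (\<tau> i))) \<le> B"
        using insert.prems(4)[of "\<tau>(z := y)"] by metis
    qed (use insert.prems yz in auto)
    also have "\<dots> \<le> shatter_weight A Y (insert z Z) Q"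
      using insert.hyps Y by (intro shatter_weight_mono) auto
    finally show ?thesis .
  qed
qed

lemma sum_Pow_weights:
  fixes a b :: real
  assumes "finite Z"
  shows "(\<Sum>T\<in>Pow Z. a ^ card T * b ^ card (Z - T)) = (a + b) ^ card Z"
  using prod_add[OF assms, of "\<lambda>_. a" "\<lambda>_. b"] by simp

text \<open>
  Each of the counted sets contributes \<open>\<theta>\<^bsup>|T| - r\<^esup> \<ge> 1\<close> to a sum that the binomial theorem evaluates.
\<close>

lemma card_small_subsets_le:
  assumes Z: "finite Z" and th: "0 < \<theta>" "\<theta> \<le> 1"
  shows "real (card {T\<in>Pow Z. real (card T) \<le> r}) \<le> (1 + \<theta>) ^ card Z * \<theta> powr (- r)"
proof -
  have "real (card {T\<in>Pow Z. real (card T) \<le> r}) = (\<Sum>T\<in>{T\<in>Pow Z. real (card T) \<le> r}. 1)" by simp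
  also have "\<dots> \<le> (\<Sum>T\<in>{T\<in>Pow Z. real (card T) \<le> r}. \<theta> ^ card T * \<theta> powr (- r))"
  proof (rule sum_mono)
    fix T assume "T \<in> {T\<in>Pow Z. real (card T) \<le> r}"
    then have "1 \<le> \<theta> powr (real (card T) - r)"
      using th by (metis mem_Collect_eq powr_zero_eq_one powr_mono' diff_le_0_iff_le less_eq_real_def less_irrefl)
    then show "1 \<le> \<theta> ^ card T * \<theta> powr (- r)"
      using th by (simp add: powr_diff powr_minus powr_realpow field_simps)
  qed
  also have "\<dots> \<le> (\<Sum>T\<in>Pow Z. \<theta> ^ card T * \<theta> powr (- r))"
    using Z th by (intro sum_mono2) auto
  also have "\<dots> = (1 + \<theta>) ^ card Z * \<theta> powr (- r)"
    using sum_Pow_weights[OF Z, of \<theta> 1] by (simp add: sum_distrib_right[symmetric] add.commute)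
  finally show ?thesis .
qed

lemma small_subset_growth_rate:
  fixes \<kappa> :: real
  assumes "\<kappa> > 1"
  obtains \<theta> c where "0 < \<theta>" "\<theta> \<le> 1" "c > 0" "(1 + \<theta>) * \<theta> powr (- c) < \<kappa>"
proof -
  define \<theta> where "\<theta> = min 1 ((\<kappa> - 1) / 2)"
  have th: "0 < \<theta>" "\<theta> \<le> 1" "1 + \<theta> < \<kappa>" using assms by (auto simp: \<theta>_def min_def field_simps)
  have "((\<lambda>c. (1 + \<theta>) * \<theta> powr (- c)) \<longlongrightarrow> (1 + \<theta>) * \<theta> powr (- 0)) (at_right 0)"
    using th by (intro tendsto_intros) auto
  then have "\<forall>\<^sub>F c in at_right 0. (1 + \<theta>) * \<theta> powr (- c) < \<kappa>"
    using th by (intro order_tendstoD(2)) auto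
  then obtain b where b: "b > 0" "\<And>c. 0 < c \<Longrightarrow> c < b \<Longrightarrow> (1 + \<theta>) * \<theta> powr (- c) < \<kappa>"
    by (auto simp: eventually_at_right_field)
  show ?thesis using that[of \<theta> "b/2"] th b by auto
qed

text \<open>
  If all boxes are exponentially small relative to \<open>Q\<close>, the previous bound makes the weight of the
  shattered sets exponentially large, which is more than all index sets of small linear size can
  contribute.
\<close>

lemma (in finite_measure) linear_size_shattered_set:
  fixes \<rho> m :: real and l :: nat
  assumes l: "l \<ge> 2" and rho: "0 < \<rho>" "\<rho> < 1" and m: "m > 0"
  shows "\<exists>c>0. \<exists>N. \<forall>(A :: 'i \<Rightarrow> 'y \<Rightarrow> 'a set) Y Z Q.
     finite Z \<and> card Z \<ge> N \<and> finite Y \<and> card Y = l \<and> (\<forall>i\<in>Z. \<forall>y\<in>Y. A i y \<in> sets M) \<and>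
     (\<forall>i\<in>Z. \<forall>y\<in>Y. \<forall>y'\<in>Y. y \<noteq> y' \<longrightarrow> A i y \<inter> A i y' = {}) \<and> Q \<in> sets M \<and> measure M Q \<ge> m \<and>
     (\<forall>\<tau>\<in>Z \<rightarrow> Y. measure M (Q - (\<Union>i\<in>Z. A i (\<tau> i))) \<le> \<rho> ^ card Z) \<longrightarrow>
     (\<exists>I\<subseteq>Z. shatters A Y Q I \<and> real (card I) \<ge> c * real (card Z))"
proof -
  \<comment> \<open>with this choice half of the exponential gap \<open>1 / \<rho>\<close> per coordinate is left: \<open>(1 - t) / \<rho> = 1 / sqrt \<rho>\<close>\<close>
  define t where "t = 1 - sqrt \<rho>"
  have t: "0 < t" "t < 1" using rho by (auto simp: t_def)
  obtain \<alpha> where al: "\<alpha> > 0" "real l / (real l - 1) * t powr \<alpha> \<ge> 1"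
  proof -
    have "((\<lambda>\<alpha>. real l / (real l - 1) * t powr \<alpha>) \<longlongrightarrow> real l / (real l - 1) * t powr 0) (at_right 0)"
      using t by (intro tendsto_intros) auto
    moreover have "real l / (real l - 1) * t powr 0 > 1" using t l by (simp add: field_simps)
    ultimately have "\<forall>\<^sub>F \<alpha> in at_right 0. real l / (real l - 1) * t powr \<alpha> > 1"
      by (rule order_tendstoD(1))
    then obtain b where b: "b > 0" "\<And>\<alpha>. 0 < \<alpha> \<Longrightarrow> \<alpha> < b \<Longrightarrow> real l / (real l - 1) * t powr \<alpha> > 1"
      by (auto simp: eventually_at_right_field)
    show ?thesis using that[of "b/2"] b by (simp add: less_imp_le)
  qed
  define \<kappa> where "\<kappa> = (1 / sqrt \<rho>) powr \<alpha>"
  have kap: "\<kappa> > 1" unfolding \<kappa>_def using rho al by (intro gr_one_powr) auto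
  obtain \<theta> c where th: "0 < \<theta>" "\<theta> \<le> 1" "c > 0" "(1 + \<theta>) * \<theta> powr (- c) < \<kappa>"
    using small_subset_growth_rate[OF kap] .
  define q where "q = (1 + \<theta>) * \<theta> powr (- c) / \<kappa>"
  have q: "0 < q" "q < 1" using th kap by (auto simp: q_def)
  have "(\<lambda>n. q ^ n) \<longlonglongrightarrow> 0" using q by (intro LIMSEQ_realpow_zero) auto
  then have "\<forall>\<^sub>F n in sequentially. q ^ n < m powr \<alpha>"
    using m by (intro order_tendstoD(2)) auto
  then obtain N where N: "\<And>n. n \<ge> N \<Longrightarrow> q ^ n < m powr \<alpha>" by (auto simp: eventually_sequentially)
  have main: "\<exists>I\<subseteq>Z. shatters A Y Q I \<and> real (card I) \<ge> c * real (card Z)"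
    if h: "finite Z" "card Z \<ge> N" "finite Y" "card Y = l" "\<And>i y. i \<in> Z \<Longrightarrow> y \<in> Y \<Longrightarrow> A i y \<in> sets M"
     "\<And>i y y'. i \<in> Z \<Longrightarrow> y \<in> Y \<Longrightarrow> y' \<in> Y \<Longrightarrow> y \<noteq> y' \<Longrightarrow> A i y \<inter> A i y' = {}" "Q \<in> sets M" "measure M Q \<ge> m"
     "\<And>\<tau>. \<tau> \<in> Z \<rightarrow> Y \<Longrightarrow> measure M (Q - (\<Union>i\<in>Z. A i (\<tau> i))) \<le> \<rho> ^ card Z"
    for A :: "'i \<Rightarrow> 'y \<Rightarrow> 'a set" and Y Z Q
  proof (rule ccontr)
    assume neg: "\<not> ?thesis"
    let ?n = "card Z"
    have base: "(1 - t) ^ ?n * measure M Q / \<rho> ^ ?n = (1 / sqrt \<rho>) ^ ?n * measure M Q"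
    proof -
      have r: "(1 - t) / \<rho> = 1 / sqrt \<rho>" using rho by (simp add: t_def field_simps)
      have "(1 - t) ^ ?n * measure M Q / \<rho> ^ ?n = ((1 - t) / \<rho>) ^ ?n * measure M Q"
        by (simp add: power_divide)
      then show ?thesis unfolding r .
    qed
    have "\<kappa> ^ ?n * m powr \<alpha> = ((1 / sqrt \<rho>) ^ ?n * m) powr \<alpha>"
    proof -
      have s: "1 / sqrt \<rho> > 0" using rho by simp
      have "\<kappa> ^ ?n = (1 / sqrt \<rho>) powr (\<alpha> * ?n)"
        unfolding \<kappa>_def using powr_power[of "1 / sqrt \<rho>" \<alpha> ?n] s by (simp only: mult.commute)
      also have "\<dots> = ((1 / sqrt \<rho>) powr ?n) powr \<alpha>"
        by (simp only: powr_powr mult.commute)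
      also have "\<dots> = ((1 / sqrt \<rho>) ^ ?n) powr \<alpha>"
        by (simp only: powr_realpow[OF s])
      finally show ?thesis using rho m powr_mult[of "(1 / sqrt \<rho>) ^ ?n" m \<alpha>] by simp
    qed
    also have "\<dots> \<le> ((1 - t) ^ ?n * measure M Q / \<rho> ^ ?n) powr \<alpha>"
      unfolding base using rho h m al by (intro powr_mono2 mult_left_mono) auto
    also have "\<dots> \<le> shatter_weight A Y Z Q"
      using h l t al rho by (intro shatter_weight_lower_bound) auto
    also have "\<dots> \<le> (\<Sum>I\<in>{I\<in>Pow Z. shatters A Y Q I}. 1)"
      unfolding shatter_weight_def using h l
      by (intro sum_mono power_le_one) (auto simp: field_simps)
    also have "\<dots> \<le> real (card {I\<in>Pow Z. real (card I) \<le> c * ?n})"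
      using h neg by (simp, intro card_mono) auto
    also have "\<dots> \<le> (1 + \<theta>) ^ ?n * \<theta> powr (- (c * ?n))"
      using h th by (intro card_small_subsets_le) auto
    also have "\<theta> powr (- (c * ?n)) = (\<theta> powr (- c)) ^ ?n"
      using th by (simp add: powr_power mult.commute)
    also have "(1 + \<theta>) ^ ?n * (\<theta> powr (- c)) ^ ?n = (q * \<kappa>) ^ ?n"
      using kap by (simp add: q_def power_mult_distrib)
    also have "\<dots> = \<kappa> ^ ?n * q ^ ?n" by (simp add: power_mult_distrib)
    also have "\<dots> < \<kappa> ^ ?n * m powr \<alpha>"
      using N[OF h(2)] kap by (intro mult_strict_left_mono) auto
    finally show False by simp
  qed
  show ?thesis
  proof (intro exI[of _ c] conjI exI[of _ N] allI impI)
    fix A :: "'i \<Rightarrow> 'y \<Rightarrow> 'a set" and Y Z Q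
    assume H: "finite Z \<and> card Z \<ge> N \<and> finite Y \<and> card Y = l \<and> (\<forall>i\<in>Z. \<forall>y\<in>Y. A i y \<in> sets M) \<and>
     (\<forall>i\<in>Z. \<forall>y\<in>Y. \<forall>y'\<in>Y. y \<noteq> y' \<longrightarrow> A i y \<inter> A i y' = {}) \<and> Q \<in> sets M \<and> measure M Q \<ge> m \<and>
     (\<forall>\<tau>\<in>Z \<rightarrow> Y. measure M (Q - (\<Union>i\<in>Z. A i (\<tau> i))) \<le> \<rho> ^ card Z)"
    then have
      1: "finite Z" and 2: "card Z \<ge> N" and 3: "finite Y" and 4: "card Y = l" and
      5: "\<forall>i\<in>Z. \<forall>y\<in>Y. A i y \<in> sets M" and
      6: "\<forall>i\<in>Z. \<forall>y\<in>Y. \<forall>y'\<in>Y. y \<noteq> y' \<longrightarrow> A i y \<inter> A i y' = {}" and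
      7: "Q \<in> sets M" and 8: "measure M Q \<ge> m" and
      9: "\<forall>\<tau>\<in>Z \<rightarrow> Y. measure M (Q - (\<Union>i\<in>Z. A i (\<tau> i))) \<le> \<rho> ^ card Z"
      by simp_all
    show "\<exists>I\<subseteq>Z. shatters A Y Q I \<and> real (card I) \<ge> c * real (card Z)"
      by (rule main[OF 1 2 3 4 5[rule_format] 6[rule_format] 7 8 9[rule_format]])
  qed (rule th(3))
qed

section \<open>Almost periodic functions and sets\<close>

text \<open>
  Total boundedness, stated through finite covers by sets of small diameter. In this form it makes sense
  for an arbitrary function \<open>d\<close>, without symmetry or a triangle inequality, and passes to sums by
  intersecting covers.
\<close>

definition totally_bdd :: "'g set \<Rightarrow> ('g \<Rightarrow> 'g \<Rightarrow> real) \<Rightarrow> bool" where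
  "totally_bdd S d \<longleftrightarrow>
     (\<forall>\<epsilon>>0. \<exists>C. finite C \<and> S \<subseteq> \<Union>C \<and> (\<forall>A\<in>C. \<forall>s\<in>A \<inter> S. \<forall>r\<in>A \<inter> S. d s r < \<epsilon>))"

lemma totally_bddD:
  assumes "totally_bdd S d" "\<epsilon> > 0"
  obtains C where "finite C" "S \<subseteq> \<Union>C" "\<And>A s r. A \<in> C \<Longrightarrow> s \<in> A \<Longrightarrow> r \<in> A \<Longrightarrow> s \<in> S \<Longrightarrow> r \<in> S \<Longrightarrow> d s r < \<epsilon>"
  using assms unfolding totally_bdd_def by (metis IntI)

lemma totally_bdd_dominated:
  assumes "totally_bdd S d1" "totally_bdd S d2" and a: "a > 0"
    and le: "\<And>s r. s \<in> S \<Longrightarrow> r \<in> S \<Longrightarrow> d s r \<le> a * (d1 s r + d2 s r)"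
  shows "totally_bdd S d"
  unfolding totally_bdd_def
proof (intro allI impI)
  fix \<epsilon> :: real assume "\<epsilon> > 0"
  then have e: "\<epsilon> / (2 * a) > 0" using a by simp
  obtain C1 where C1: "finite C1" "S \<subseteq> \<Union>C1"
    "\<And>A s r. A \<in> C1 \<Longrightarrow> s \<in> A \<Longrightarrow> r \<in> A \<Longrightarrow> s \<in> S \<Longrightarrow> r \<in> S \<Longrightarrow> d1 s r < \<epsilon> / (2 * a)"
    by (rule totally_bddD[OF assms(1) e]) blast
  obtain C2 where C2: "finite C2" "S \<subseteq> \<Union>C2"
    "\<And>A s r. A \<in> C2 \<Longrightarrow> s \<in> A \<Longrightarrow> r \<in> A \<Longrightarrow> s \<in> S \<Longrightarrow> r \<in> S \<Longrightarrow> d2 s r < \<epsilon> / (2 * a)"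
    by (rule totally_bddD[OF assms(2) e]) blast
  let ?C = "(\<lambda>(A, B). A \<inter> B) ` (C1 \<times> C2)"
  have "finite ?C" "S \<subseteq> \<Union>?C" using C1 C2 by fastforce+
  moreover have "d s r < \<epsilon>" if "A \<in> C1" "B \<in> C2" "s \<in> A \<inter> B \<inter> S" "r \<in> A \<inter> B \<inter> S" for A B s r
  proof -
    have "d1 s r + d2 s r < \<epsilon> / a" using C1(3)[of A s r] C2(3)[of B s r] that by (simp add: field_simps)
    then have "a * (d1 s r + d2 s r) < \<epsilon>" using a by (simp add: field_simps)
    then show ?thesis using le[of s r] that by auto
  qed
  ultimately show "\<exists>C. finite C \<and> S \<subseteq> \<Union>C \<and> (\<forall>A\<in>C. \<forall>s\<in>A \<inter> S. \<forall>r\<in>A \<inter> S. d s r < \<epsilon>)"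
    by (intro exI[of _ ?C]) auto
qed

lemma totally_bdd_approx:
  assumes "\<And>\<epsilon>. \<epsilon> > 0 \<Longrightarrow> \<exists>d'. totally_bdd S d' \<and> (\<forall>s\<in>S. \<forall>r\<in>S. d s r \<le> d' s r + \<epsilon>)"
  shows "totally_bdd S d"
  unfolding totally_bdd_def
proof (intro allI impI)
  fix \<epsilon> :: real assume e: "\<epsilon> > 0"
  then obtain d' where d': "totally_bdd S d'" "\<And>s r. s \<in> S \<Longrightarrow> r \<in> S \<Longrightarrow> d s r \<le> d' s r + \<epsilon> / 2"
    using assms[of "\<epsilon> / 2"] by auto
  obtain C where C: "finite C" "S \<subseteq> \<Union>C"
    "\<And>A s r. A \<in> C \<Longrightarrow> s \<in> A \<Longrightarrow> r \<in> A \<Longrightarrow> s \<in> S \<Longrightarrow> r \<in> S \<Longrightarrow> d' s r < \<epsilon> / 2"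
    using totally_bddD[OF d'(1), of "\<epsilon>/2"] e by auto
  show "\<exists>C. finite C \<and> S \<subseteq> \<Union>C \<and> (\<forall>A\<in>C. \<forall>s\<in>A \<inter> S. \<forall>r\<in>A \<inter> S. d s r < \<epsilon>)"
  proof (intro exI[of _ C] conjI ballI C(1,2))
    fix A s r assume "A \<in> C" "s \<in> A \<inter> S" "r \<in> A \<inter> S"
    then show "d s r < \<epsilon>" using C(3)[of A s r] d'(2)[of s r] by auto
  qed
qed

lemma totally_bdd_zero: "totally_bdd S (\<lambda>_ _. 0)"
  unfolding totally_bdd_def by (auto intro!: exI[of _ "{S}"])

lemma totally_bdd_sum:
  assumes "finite I" "\<And>i. i \<in> I \<Longrightarrow> totally_bdd S (d i)"
  shows "totally_bdd S (\<lambda>s r. \<Sum>i\<in>I. d i s r)"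
  using assms
proof (induction I rule: finite_induct)
  case empty
  show ?case using totally_bdd_zero by simp
next
  case (insert i I)
  show ?case
    by (rule totally_bdd_dominated[of S "d i" "\<lambda>s r. \<Sum>i\<in>I. d i s r" 1]) (use insert in auto)
qed

lemma totally_bdd_real:
  assumes "\<And>s. s \<in> S \<Longrightarrow> \<bar>c s\<bar> \<le> (B::real)"
  shows "totally_bdd S (\<lambda>s r. \<bar>c s - c r\<bar>)"
  unfolding totally_bdd_def
proof (intro allI impI)
  fix \<epsilon> :: real assume e: "\<epsilon> > 0"
  define k where "k = (\<lambda>s. \<lfloor>c s / \<epsilon>\<rfloor>)"
  have "k ` S \<subseteq> {\<lfloor>- B / \<epsilon>\<rfloor>..\<lfloor>B / \<epsilon>\<rfloor>}"
  proof
    fix z assume "z \<in> k ` S"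
    then obtain s where s: "s \<in> S" "z = \<lfloor>c s / \<epsilon>\<rfloor>" by (auto simp: k_def)
    have "- B \<le> c s" "c s \<le> B" using assms[OF s(1)] by auto
    then have "- B / \<epsilon> \<le> c s / \<epsilon>" "c s / \<epsilon> \<le> B / \<epsilon>"
      using e by (auto intro: divide_right_mono simp del: minus_divide_left divide_minus_left)
    then show "z \<in> {\<lfloor>- B / \<epsilon>\<rfloor>..\<lfloor>B / \<epsilon>\<rfloor>}"
      unfolding s(2) by (simp only: atLeastAtMost_iff floor_mono)
  qed
  then have fin: "finite (k ` S)" by (rule finite_subset) simp
  let ?C = "(\<lambda>z. {s. k s = z}) ` (k ` S)"
  show "\<exists>C. finite C \<and> S \<subseteq> \<Union>C \<and> (\<forall>A\<in>C. \<forall>s\<in>A \<inter> S. \<forall>r\<in>A \<inter> S. \<bar>c s - c r\<bar> < \<epsilon>)"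
  proof (intro exI[of _ ?C] conjI ballI)
    fix A s r assume "A \<in> ?C" "s \<in> A \<inter> S" "r \<in> A \<inter> S"
    then have "\<lfloor>c s / \<epsilon>\<rfloor> = \<lfloor>c r / \<epsilon>\<rfloor>" by (auto simp: k_def)
    then have "\<bar>c s / \<epsilon> - c r / \<epsilon>\<bar> < 1" by linarith
    then have "\<bar>(c s - c r) / \<epsilon>\<bar> < 1" by (simp add: diff_divide_distrib)
    then show "\<bar>c s - c r\<bar> < \<epsilon>" using e by (simp add: field_simps)
  qed (use fin in auto)
qed

text \<open>
  Rounding to a representative: a map \<open>\<rho>\<close> with finite range moves every element by less than \<open>\<epsilon>\<close>.
\<close>

lemma totally_bdd_net:
  assumes "totally_bdd S d" "\<epsilon> > 0"
  obtains \<rho> where "finite (\<rho> ` S)" "\<rho> ` S \<subseteq> S" "\<And>s. s \<in> S \<Longrightarrow> d s (\<rho> s) < \<epsilon>"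
proof -
  obtain C where C: "finite C" "S \<subseteq> \<Union>C"
    "\<And>A s r. A \<in> C \<Longrightarrow> s \<in> A \<Longrightarrow> r \<in> A \<Longrightarrow> s \<in> S \<Longrightarrow> r \<in> S \<Longrightarrow> d s r < \<epsilon>"
    by (rule totally_bddD[OF assms]) blast
  define cell where "cell = (\<lambda>s. SOME A. A \<in> C \<and> s \<in> A)"
  define pt where "pt = (\<lambda>A. SOME s. s \<in> A \<inter> S)"
  have cell: "cell s \<in> C" "s \<in> cell s" if "s \<in> S" for s
    using someI_ex[of "\<lambda>A. A \<in> C \<and> s \<in> A"] C(2) that by (auto simp: cell_def)
  have pt: "pt (cell s) \<in> cell s" "pt (cell s) \<in> S" if "s \<in> S" for s
    using someI[of "\<lambda>r. r \<in> cell s \<inter> S" s] cell[OF that] that by (auto simp: pt_def)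
  show ?thesis
  proof (rule that[of "\<lambda>s. pt (cell s)"])
    have "(\<lambda>s. pt (cell s)) ` S \<subseteq> pt ` C" using cell by auto
    then show "finite ((\<lambda>s. pt (cell s)) ` S)" using C(1) finite_subset by blast
  qed (use pt cell C(3) in blast)+
qed

locale pmp_action = group_action G UNIV \<phi> + prob_space M
  for G :: "('g, 'm) monoid_scheme" (structure) and \<phi> :: "'g \<Rightarrow> 'x \<Rightarrow> 'x" and M :: "'x measure" +
  assumes space_M: "space M = UNIV"
    and act_measurable: "\<And>s. s \<in> carrier G \<Longrightarrow> \<phi> s \<in> measurable M M"
    and act_distr: "\<And>s. s \<in> carrier G \<Longrightarrow> distr M M (\<phi> s) = M"
begin

lemma grp: "group G"
  using group_hom group_hom.axioms(1) by blast

lemma act_mult: "s \<in> carrier G \<Longrightarrow> t \<in> carrier G \<Longrightarrow> \<phi> (s \<otimes> t) x = \<phi> s (\<phi> t x)"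
  using composition_rule by simp

lemma act_one: "\<phi> \<one> x = x"
  using id_eq_one by (metis UNIV_I restrict_apply')

lemma act_inv: "s \<in> carrier G \<Longrightarrow> \<phi> (inv s) (\<phi> s x) = x" "s \<in> carrier G \<Longrightarrow> \<phi> s (\<phi> (inv s) x) = x"
  using act_mult[of "inv s" s x] act_mult[of s "inv s" x] act_one grp
  by (simp_all add: group.l_inv group.r_inv)

lemma integral_act:
  assumes "s \<in> carrier G" "(f :: 'x \<Rightarrow> real) \<in> borel_measurable M"
  shows "(\<integral>x. f (\<phi> s x) \<partial>M) = (\<integral>x. f x \<partial>M)"
  using integral_distr[OF act_measurable[OF assms(1)] assms(2)] act_distr[OF assms(1)] by simp

lemma sets_act: "s \<in> carrier G \<Longrightarrow> A \<in> sets M \<Longrightarrow> \<phi> s -` A \<in> sets M"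
  using measurable_sets[OF act_measurable, of s A] space_M by simp

lemma measurable_act [measurable]:
  "f \<in> borel_measurable M \<Longrightarrow> s \<in> carrier G \<Longrightarrow> (\<lambda>x. f (\<phi> s x)) \<in> borel_measurable M"
  using measurable_compose[OF act_measurable] by blast

lemma integrable_bdd:
  assumes "(f :: 'x \<Rightarrow> real) \<in> borel_measurable M" "\<And>x. \<bar>f x\<bar> \<le> c"
  shows "integrable M f"
  using assms by (intro integrable_const_bound[of _ c]) auto

definition orbit_dist :: "('x \<Rightarrow> real) \<Rightarrow> 'g \<Rightarrow> 'g \<Rightarrow> real" where
  "orbit_dist f s r = (\<integral>x. \<bar>f (\<phi> s x) - f (\<phi> r x)\<bar> \<partial>M)"

text \<open>
  The orbit of \<open>f\<close> is totally bounded in \<open>L\<^sup>1\<close>, equivalently (for bounded \<open>f\<close>) relatively compact in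
  \<open>L\<^sup>2\<close>.
\<close>

definition almost_periodic :: "('x \<Rightarrow> real) \<Rightarrow> bool" where
  "almost_periodic f \<longleftrightarrow> totally_bdd (carrier G) (orbit_dist f)"

definition ap_sets :: "'x set set" where
  "ap_sets = {A \<in> sets M. almost_periodic (indicator A)}"

lemma integrable_indicator_act:
  assumes "A \<in> sets M" "s \<in> carrier G"
  shows "integrable M (\<lambda>x. indicator A (\<phi> s x) :: real)"
  using assms measurable_act[of "indicator A" s] by (intro integrable_bdd[of _ 1]) (auto simp: indicator_def)

lemma integrable_indicator_diff:
  assumes "A \<in> sets M" "s \<in> carrier G" "r \<in> carrier G"
  shows "integrable M (\<lambda>x. \<bar>indicator A (\<phi> s x) - indicator A (\<phi> r x) :: real\<bar>)"
  using assms by (intro integrable_abs Bochner_Integration.integrable_diff integrable_indicator_act)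

lemma integral_indicator_act:
  assumes "A \<in> sets M" "s \<in> carrier G"
  shows "(\<integral>x. indicator A (\<phi> s x) \<partial>M) = measure M A"
  using integral_act[of s "indicator A"] assms by simp

lemma ap_sets_sub: "ap_sets \<subseteq> sets M" by (auto simp: ap_sets_def)

lemma ap_sets_empty: "{} \<in> ap_sets"
proof -
  have "orbit_dist (indicator {}) = (\<lambda>_ _. 0)" by (intro ext) (simp add: orbit_dist_def)
  then show ?thesis by (simp add: ap_sets_def almost_periodic_def totally_bdd_zero)
qed

lemma ap_sets_compl:
  assumes "A \<in> ap_sets"
  shows "UNIV - A \<in> ap_sets"
proof -
  have "UNIV - A \<in> sets M" using assms ap_sets_sub space_M by (metis sets.compl_sets subsetD)
  moreover have "orbit_dist (indicator (UNIV - A)) = orbit_dist (indicator A)"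
    unfolding orbit_dist_def by (intro ext Bochner_Integration.integral_cong) (auto simp: indicator_def)
  ultimately show ?thesis using assms by (simp add: ap_sets_def almost_periodic_def)
qed

lemma ap_sets_Un:
  assumes "A \<in> ap_sets" "B \<in> ap_sets"
  shows "A \<union> B \<in> ap_sets"
proof -
  have AB: "A \<in> sets M" "B \<in> sets M" using assms ap_sets_sub by auto
  have "totally_bdd (carrier G) (orbit_dist (indicator (A \<union> B)))"
  proof (rule totally_bdd_dominated[of _ "orbit_dist (indicator A)" "orbit_dist (indicator B)" 1])
    fix s r assume sr: "s \<in> carrier G" "r \<in> carrier G"
    have "orbit_dist (indicator (A \<union> B)) s r \<le> (\<integral>x. \<bar>indicator A (\<phi> s x) - indicator A (\<phi> r x)\<bar>
       + \<bar>indicator B (\<phi> s x) - indicator B (\<phi> r x)\<bar> \<partial>M)"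
      unfolding orbit_dist_def using AB sr
      by (intro integral_mono Bochner_Integration.integrable_add integrable_indicator_diff) (auto simp: indicator_def)
    also have "\<dots> = 1 * (orbit_dist (indicator A) s r + orbit_dist (indicator B) s r)"
      unfolding orbit_dist_def using AB sr by (simp add: integrable_indicator_diff)
    finally show "orbit_dist (indicator (A \<union> B)) s r \<le> 1 * (orbit_dist (indicator A) s r + orbit_dist (indicator B) s r)" .
  qed (use assms in \<open>auto simp: ap_sets_def almost_periodic_def\<close>)
  then show ?thesis using AB by (simp add: ap_sets_def almost_periodic_def)
qed

lemma orbit_dist_indicator_approx:
  assumes A: "A \<in> sets M" and B: "B \<in> sets M" and sr: "s \<in> carrier G" "r \<in> carrier G"
  shows "orbit_dist (indicator A) s r \<le> orbit_dist (indicator B) s r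
     + 2 * measure M ((A - B) \<union> (B - A))"
proof -
  let ?D = "(A - B) \<union> (B - A)"
  have D: "?D \<in> sets M" using A B by auto
  have "orbit_dist (indicator A) s r \<le> (\<integral>x. \<bar>indicator B (\<phi> s x) - indicator B (\<phi> r x)\<bar>
       + (indicator ?D (\<phi> s x) + indicator ?D (\<phi> r x)) \<partial>M)"
    unfolding orbit_dist_def using A B D sr
    by (intro integral_mono Bochner_Integration.integrable_add integrable_indicator_diff integrable_indicator_act)
      (auto simp: indicator_def)
  also have "\<dots> = orbit_dist (indicator B) s r + (measure M ?D + measure M ?D)"
    unfolding orbit_dist_def using B D sr
    by (simp add: integrable_indicator_diff integrable_indicator_act integral_indicator_act)
  finally show ?thesis by simp
qed

text \<open>
  Translates of \<open>A\<close> and \<open>B\<close> are as close as \<open>A\<close> and \<open>B\<close> themselves, by invariance. In particular the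
  almost periodic sets are stable under changes by null sets and under countable unions.
\<close>

lemma ap_sets_approx:
  assumes A: "A \<in> sets M"
    and ap: "\<And>\<epsilon>. \<epsilon> > 0 \<Longrightarrow> \<exists>B\<in>ap_sets. measure M ((A - B) \<union> (B - A)) \<le> \<epsilon>"
  shows "A \<in> ap_sets"
proof -
  have "totally_bdd (carrier G) (orbit_dist (indicator A))"
  proof (rule totally_bdd_approx)
    fix \<epsilon> :: real assume "\<epsilon> > 0"
    then obtain B where B: "B \<in> ap_sets" "measure M ((A - B) \<union> (B - A)) \<le> \<epsilon> / 2"
      using ap[of "\<epsilon>/2"] by auto
    then show "\<exists>d'. totally_bdd (carrier G) d' \<and>
        (\<forall>s\<in>carrier G. \<forall>r\<in>carrier G. orbit_dist (indicator A) s r \<le> d' s r + \<epsilon>)"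
      using orbit_dist_indicator_approx[OF A, of B] ap_sets_sub
      by (intro exI[of _ "orbit_dist (indicator B)"]) (force simp: ap_sets_def almost_periodic_def)
  qed
  then show ?thesis using A by (simp add: ap_sets_def almost_periodic_def)
qed

lemma sigma_algebra_ap_sets: "sigma_algebra UNIV ap_sets"
  unfolding sigma_algebra_iff2
proof (intro conjI allI impI ballI)
  fix A :: "nat \<Rightarrow> 'x set" assume A: "range A \<subseteq> ap_sets"
  define B where "B = (\<lambda>n. \<Union>i<n. A i)"
  have BK: "B n \<in> ap_sets" for n
  proof (induction n)
    case 0 then show ?case using ap_sets_empty by (simp add: B_def)
  next
    case (Suc n)
    have "B (Suc n) = A n \<union> B n" by (auto simp: B_def less_Suc_eq)
    moreover have "A n \<in> ap_sets" using A by blast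
    ultimately show ?case using Suc ap_sets_Un by metis
  qed
  have UB: "(\<Union>n. B n) = (\<Union>i. A i)" by (auto simp: B_def)
  have Us: "(\<Union>i. A i) \<in> sets M" using A ap_sets_sub by (intro sets.countable_UN) auto
  show "(\<Union>i. A i) \<in> ap_sets"
  proof (rule ap_sets_approx[OF Us])
    fix \<epsilon> :: real assume e: "\<epsilon> > 0"
    have "(\<lambda>n. measure M (B n)) \<longlonglongrightarrow> measure M (\<Union>n. B n)"
      using BK ap_sets_sub by (intro finite_Lim_measure_incseq incseq_SucI) (auto simp: B_def less_Suc_eq)
    then have "\<forall>\<^sub>F n in sequentially. measure M (\<Union>n. B n) - \<epsilon> < measure M (B n)"
      using e by (intro order_tendstoD(1)) auto
    then obtain n where n: "measure M (\<Union>n. B n) - \<epsilon> < measure M (B n)"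
      by (auto simp: eventually_sequentially)
    have Bn: "B n \<subseteq> (\<Union>i. A i)" "B n \<in> sets M" using BK[of n] ap_sets_sub by (auto simp: B_def)
    have "measure M ((\<Union>i. A i) - B n) = measure M (\<Union>i. A i) - measure M (B n)"
      using Bn Us by (intro finite_measure_Diff) auto
    moreover have "((\<Union>i. A i) - B n) \<union> (B n - (\<Union>i. A i)) = (\<Union>i. A i) - B n" using Bn by blast
    ultimately show "\<exists>B\<in>ap_sets. measure M (((\<Union>i. A i) - B) \<union> (B - (\<Union>i. A i))) \<le> \<epsilon>"
      using n BK[of n] UB by (intro bexI[of _ "B n"]) (simp only:, auto)
  qed
qed (use ap_sets_empty ap_sets_compl in auto)

definition ap_algebra :: "'x measure" where
  "ap_algebra = sigma UNIV ap_sets"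

lemma sets_ap_algebra: "sets ap_algebra = ap_sets"
  unfolding ap_algebra_def using sigma_algebra_ap_sets by (simp add: sigma_algebra.sigma_sets_eq)

lemma space_ap_algebra: "space ap_algebra = UNIV"
  unfolding ap_algebra_def by (simp add: space_measure_of_conv)

lemma subalgebra_ap: "subalgebra M ap_algebra"
  unfolding subalgebra_def using space_M ap_sets_sub by (simp add: sets_ap_algebra space_ap_algebra)

text \<open>
  Two translates of \<open>f\<close> that are close in \<open>L\<^sup>1\<close> can have different superlevel sets only where one of them
  is near \<open>c\<close> or where they differ by a definite amount. The first event is rare because \<open>f\<close> almost
  surely avoids the value \<open>c\<close>, the second by Markov's inequality.
\<close>

lemma ap_superlevel_set:
  assumes f: "f \<in> borel_measurable M" "integrable M f" and ap: "almost_periodic f"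
    and c: "measure M {x. f x = c} = 0"
  shows "{x. f x > c} \<in> ap_sets"
proof -
  have meas: "{x. f x > c} \<in> sets M"
    using measurable_sets[OF f(1), of "{c<..}"] space_M by (simp add: vimage_def)
  let ?E = "\<lambda>\<delta>. {x. \<bar>f x - c\<bar> < \<delta>}"
  have E: "?E \<delta> \<in> sets M" for \<delta>
    using measurable_sets[OF f(1), of "{c - \<delta><..<c + \<delta>}"] space_M
    by (simp add: vimage_def abs_diff_less_iff conj_commute)
  have "(\<lambda>n. measure M (?E (1 / Suc n))) \<longlonglongrightarrow> measure M (\<Inter>n. ?E (1 / Suc n))"
  proof (rule finite_Lim_measure_decseq)
    show "range (\<lambda>n. ?E (1 / Suc n)) \<subseteq> events" using E by auto
    show "decseq (\<lambda>n. ?E (1 / Suc n))"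
    proof (rule decseq_SucI)
      fix n
      have "1 / real (Suc (Suc n)) \<le> 1 / real (Suc n)" by (simp add: field_simps)
      then show "?E (1 / Suc (Suc n)) \<le> ?E (1 / Suc n)" by auto
    qed
  qed
  moreover have "(\<Inter>n. ?E (1 / Suc n)) = {x. f x = c}"
  proof -
    have "f x = c" if "\<And>n. \<bar>f x - c\<bar> < 1 / Suc n" for x
    proof (rule ccontr)
      assume "f x \<noteq> c"
      then obtain n where "inverse (real (Suc n)) < \<bar>f x - c\<bar>" using reals_Archimedean[of "\<bar>f x - c\<bar>"] by auto
      then show False using that[of n] by (simp add: field_simps)
    qed
    then show ?thesis by auto
  qed
  ultimately have lim: "(\<lambda>n. measure M (?E (1 / Suc n))) \<longlonglongrightarrow> 0" using c by simp
  have "totally_bdd (carrier G) (orbit_dist (indicator {x. f x > c}))"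
  proof (rule totally_bdd_approx)
    fix \<epsilon> :: real assume "\<epsilon> > 0"
    then have "\<forall>\<^sub>F n in sequentially. measure M (?E (1 / Suc n)) < \<epsilon>"
      using lim by (intro order_tendstoD(2)) auto
    then obtain n where n: "measure M (?E (1 / Suc n)) < \<epsilon>" by (auto simp: eventually_sequentially)
    define k where "k = real (Suc n)"
    have k: "k > 0" by (simp add: k_def)
    have "totally_bdd (carrier G) (\<lambda>s r. k * orbit_dist f s r)"
      by (rule totally_bdd_dominated[OF _ totally_bdd_zero, of _ "orbit_dist f" k])
        (use ap k in \<open>auto simp: almost_periodic_def\<close>)
    moreover have "orbit_dist (indicator {x. f x > c}) s r \<le> k * orbit_dist f s r + \<epsilon>"
      if sr: "s \<in> carrier G" "r \<in> carrier G" for s r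
    proof -
      have intf: "integrable M (\<lambda>x. f (\<phi> t x))" if "t \<in> carrier G" for t
        using integrable_distr[OF act_measurable[OF that], of f] act_distr[OF that] f by simp
      have "orbit_dist (indicator {x. f x > c}) s r
         \<le> (\<integral>x. indicator (?E (1/k)) (\<phi> s x) + k * \<bar>f (\<phi> s x) - f (\<phi> r x)\<bar> \<partial>M)"
        unfolding orbit_dist_def
      proof (intro integral_mono Bochner_Integration.integrable_add integrable_indicator_diff
          integrable_indicator_act integrable_mult_right integrable_abs Bochner_Integration.integrable_diff
          intf meas E sr)
        fix x
        have *: "1 \<le> k * \<bar>f (\<phi> s x) - f (\<phi> r x)\<bar>" if "1 / k \<le> \<bar>f (\<phi> s x) - f (\<phi> r x)\<bar>"
          using that k by (simp add: field_simps)
        have pos: "0 \<le> k * \<bar>f (\<phi> s x) - f (\<phi> r x)\<bar>" using k by simp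
        show "\<bar>indicator {x. f x > c} (\<phi> s x) - indicator {x. f x > c} (\<phi> r x)\<bar>
          \<le> indicator (?E (1/k)) (\<phi> s x) + k * \<bar>f (\<phi> s x) - f (\<phi> r x)\<bar>"
          using * pos by (auto simp: indicator_def)
      qed
      also have "\<dots> = measure M (?E (1/k)) + k * orbit_dist f s r"
        unfolding orbit_dist_def using sr E intf
        by (simp add: integrable_indicator_act integral_indicator_act)
      finally show ?thesis using n by (simp add: k_def)
    qed
    ultimately show "\<exists>d'. totally_bdd (carrier G) d' \<and>
        (\<forall>s\<in>carrier G. \<forall>r\<in>carrier G. orbit_dist (indicator {x. f x > c}) s r \<le> d' s r + \<epsilon>)"
      by (intro exI[of _ "\<lambda>s r. k * orbit_dist f s r"] conjI ballI)
  qed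
  then show ?thesis using meas by (simp add: ap_sets_def almost_periodic_def)
qed

text \<open>
  All but countably many levels have null level sets, and the superlevel sets at a dense set of levels
  decide measurability.
\<close>

lemma ap_measurable:
  assumes f: "f \<in> borel_measurable M" "integrable M f" and ap: "almost_periodic f"
  shows "f \<in> borel_measurable ap_algebra"
proof -
  have ctble: "countable {c. measure M {x. f x = c} \<noteq> 0}"
  proof -
    interpret D: prob_space "distr M borel f" by (rule prob_space_distr) (rule f)
    have "measure (distr M borel f) {c} = measure M {x. f x = c}" for c
      using f(1) space_M by (subst measure_distr) (auto simp: vimage_def)
    then show ?thesis using D.countable_support by simp
  qed
  show ?thesis
  proof (rule borel_measurableI_greater)
    fix y :: real
    define D where "D = (\<lambda>n::nat. SOME c. y < c \<and> c < y + 1 / Suc n \<and> measure M {x. f x = c} = 0)"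
    have D: "y < D n \<and> D n < y + 1 / Suc n \<and> measure M {x. f x = D n} = 0" for n
    proof -
      have "\<not> countable {y<..<y + 1 / Suc n}" by (simp add: uncountable_open_interval)
      then have "\<not> {y<..<y + 1 / Suc n} \<subseteq> {c. measure M {x. f x = c} \<noteq> 0}"
        using ctble countable_subset by blast
      then have "\<exists>c. y < c \<and> c < y + 1 / Suc n \<and> measure M {x. f x = c} = 0" by auto
      then show ?thesis unfolding D_def by (rule someI_ex)
    qed
    have "{x. f x > y} = (\<Union>n. {x. f x > D n})"
    proof (intro equalityI subsetI)
      fix x assume "x \<in> {x. f x > y}"
      then have "f x - y > 0" by simp
      then obtain n where "inverse (real (Suc n)) < f x - y" using reals_Archimedean by blast
      then have "f x > D n" using D[of n] by (simp add: inverse_eq_divide)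
      then show "x \<in> (\<Union>n. {x. f x > D n})" by blast
    next
      fix x assume "x \<in> (\<Union>n. {x. f x > D n})"
      then obtain n where "f x > D n" by blast
      then show "x \<in> {x. f x > y}" using D[of n] by simp
    qed
    moreover have "{x. f x > D n} \<in> sets ap_algebra" for n
      using ap_superlevel_set[OF f ap] D by (simp add: sets_ap_algebra)
    ultimately show "{x \<in> space ap_algebra. y < f x} \<in> sets ap_algebra"
      by (auto simp: space_ap_algebra)
  qed
qed

end

section \<open>Weak mixing over the almost periodic sets\<close>

lemma (in prob_space) L1_norm_le_L2_norm:
  assumes "(f :: 'a \<Rightarrow> real) \<in> borel_measurable M" "\<And>x. \<bar>f x\<bar> \<le> c"
  shows "(\<integral>x. \<bar>f x\<bar> \<partial>M) ^ 2 \<le> (\<integral>x. (f x) ^ 2 \<partial>M)"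
proof -
  have i1: "integrable M (\<lambda>x. \<bar>f x\<bar>)"
    using assms by (intro integrable_const_bound[of _ c]) auto
  have i2: "integrable M (\<lambda>x. \<bar>f x\<bar> ^ 2)"
  proof (rule integrable_const_bound[of _ "c^2"])
    show "AE x in M. norm (\<bar>f x\<bar> ^ 2) \<le> c ^ 2" 
    proof (rule AE_I2)
      fix x show "norm (\<bar>f x\<bar> ^ 2) \<le> c ^ 2" using power_mono[OF assms(2)[of x], of 2] by simp
    qed
  qed (use assms in auto)
  have "0 \<le> variance (\<lambda>x. \<bar>f x\<bar>)" by (rule variance_positive)
  then show ?thesis using variance_eq[OF i1 i2] by simp
qed

text \<open>
  Completeness of \<open>L\<^sup>1\<close> for uniformly bounded functions: an almost surely convergent subsequence provides
  the limit, which is clipped so that the bound holds everywhere.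
\<close>

lemma (in prob_space) bounded_L1_limit:
  fixes f :: "nat \<Rightarrow> 'a \<Rightarrow> real"
  assumes f: "\<And>n. f n \<in> borel_measurable M" "\<And>n x. \<bar>f n x\<bar> \<le> c"
    and cau: "\<And>e. e > 0 \<Longrightarrow> \<exists>N. \<forall>i\<ge>N. \<forall>j\<ge>N. (\<integral>x. \<bar>f i x - f j x\<bar> \<partial>M) < e"
  obtains g where "g \<in> borel_measurable M" "\<And>x. \<bar>g x\<bar> \<le> c" "(\<lambda>n. \<integral>x. \<bar>f n x - g x\<bar> \<partial>M) \<longlonglongrightarrow> 0"
proof -
  have c0: "0 \<le> c" using f(2)[of 0 undefined] abs_ge_zero order_trans by blast
  have int: "integrable M (f n)" for n using f by (intro integrable_const_bound[of _ c]) auto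
  obtain r where r: "strict_mono r" "AE x in M. Cauchy (\<lambda>i. f (r i) x)"
    by (rule cauchy_L1_AE_cauchy_subseq[of M f]) (use int cau in auto)
  define g where "g = (\<lambda>x. max (- c) (min c (lim (\<lambda>i. f (r i) x))))"
  have gm: "g \<in> borel_measurable M" unfolding g_def using f(1) by measurable
  have gb: "\<bar>g x\<bar> \<le> c" for x unfolding g_def using c0 by auto
  have intd: "integrable M (\<lambda>x. \<bar>f n x - g x\<bar>)" for n
    using int gm gb by (intro integrable_abs Bochner_Integration.integrable_diff integrable_const_bound[of g c]) auto
  have "AE x in M. (\<lambda>i. f (r i) x) \<longlonglongrightarrow> g x"
    using r(2)
  proof eventually_elim
    case (elim x)
    then have l: "(\<lambda>i. f (r i) x) \<longlonglongrightarrow> lim (\<lambda>i. f (r i) x)"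
      using Cauchy_convergent convergent_LIMSEQ_iff by blast
    have "- c \<le> f (r i) x" "f (r i) x \<le> c" for i using f(2)[of "r i" x] by auto
    then have "- c \<le> lim (\<lambda>i. f (r i) x)" "lim (\<lambda>i. f (r i) x) \<le> c"
      using LIMSEQ_le_const[OF l, of "-c"] LIMSEQ_le_const2[OF l, of c] by auto
    then have "g x = lim (\<lambda>i. f (r i) x)" by (simp add: g_def)
    then show ?case using l by simp
  qed
  then have ae: "AE x in M. (\<lambda>i. \<bar>f (r i) x - g x\<bar>) \<longlonglongrightarrow> 0"
    by eventually_elim (metis LIM_zero tendsto_rabs_zero)
  have "(\<lambda>i. \<integral>x. \<bar>f (r i) x - g x\<bar> \<partial>M) \<longlonglongrightarrow> (\<integral>x. 0 \<partial>M)"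
  proof (rule integral_dominated_convergence[where w = "\<lambda>_. 2 * c"])
    show "AE x in M. norm \<bar>f (r i) x - g x\<bar> \<le> 2 * c" for i
    proof (rule AE_I2)
      fix x show "norm \<bar>f (r i) x - g x\<bar> \<le> 2 * c" using f(2)[of "r i" x] gb[of x] by auto
    qed
  qed (use ae f gm in auto)
  then have sub: "(\<lambda>i. \<integral>x. \<bar>f (r i) x - g x\<bar> \<partial>M) \<longlonglongrightarrow> 0" by simp
  have "(\<lambda>n. \<integral>x. \<bar>f n x - g x\<bar> \<partial>M) \<longlonglongrightarrow> 0"
  proof (rule LIMSEQ_I)
    fix e :: real assume e: "e > 0"
    obtain N where N: "\<And>i j. i \<ge> N \<Longrightarrow> j \<ge> N \<Longrightarrow> (\<integral>x. \<bar>f i x - f j x\<bar> \<partial>M) < e / 2"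
      using cau[of "e/2"] e by auto
    obtain K where K: "\<And>i. i \<ge> K \<Longrightarrow> (\<integral>x. \<bar>f (r i) x - g x\<bar> \<partial>M) < e / 2"
      using order_tendstoD(2)[OF sub, of "e/2"] e by (auto simp: eventually_sequentially)
    show "\<exists>no. \<forall>n\<ge>no. norm ((\<integral>x. \<bar>f n x - g x\<bar> \<partial>M) - 0) < e"
    proof (intro exI[of _ N] allI impI)
      fix n assume n: "n \<ge> N"
      define j where "j = max N K"
      have rj: "r j \<ge> N" using seq_suble[OF r(1), of j] by (simp add: j_def)
      have "(\<integral>x. \<bar>f n x - g x\<bar> \<partial>M) \<le> (\<integral>x. \<bar>f n x - f (r j) x\<bar> + \<bar>f (r j) x - g x\<bar> \<partial>M)"
        using int intd by (intro integral_mono) auto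
      also have "\<dots> = (\<integral>x. \<bar>f n x - f (r j) x\<bar> \<partial>M) + (\<integral>x. \<bar>f (r j) x - g x\<bar> \<partial>M)"
        using int intd by (intro Bochner_Integration.integral_add) auto
      also have "\<dots> < e" using N[OF n rj] K[of j] by (simp add: j_def)
      finally show "norm ((\<integral>x. \<bar>f n x - g x\<bar> \<partial>M) - 0) < e" by simp
    qed
  qed
  then show ?thesis using that gm gb by blast
qed

context pmp_action
begin

definition kernel :: "real \<Rightarrow> ('x \<times> 'x \<Rightarrow> real) \<Rightarrow> bool" where
  "kernel c H \<longleftrightarrow> H \<in> borel_measurable (M \<Otimes>\<^sub>M M) \<and> (\<forall>p. \<bar>H p\<bar> \<le> c)"

definition kernel_op :: "('x \<times> 'x \<Rightarrow> real) \<Rightarrow> ('x \<Rightarrow> real) \<Rightarrow> 'x \<Rightarrow> real" where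
  "kernel_op H w x = (\<integral>z. H (x, z) * w z \<partial>M)"

lemma prob_space_square: "prob_space (M \<Otimes>\<^sub>M M)"
proof -
  interpret pair_prob_space M M ..
  show ?thesis by (rule prob_space_axioms)
qed

lemma kernelD: "kernel c H \<Longrightarrow> H \<in> borel_measurable (M \<Otimes>\<^sub>M M)" "kernel c H \<Longrightarrow> \<bar>H p\<bar> \<le> c"
  unfolding kernel_def by blast+

lemma kernel_integrable: "kernel c H \<Longrightarrow> integrable (M \<Otimes>\<^sub>M M) H"
  using prob_space_square
  by (intro finite_measure.integrable_const_bound[of _ _ c])
    (auto simp: kernel_def prob_space.finite_measure)

lemma kernel_section: "kernel c H \<Longrightarrow> (\<lambda>z. H (x, z)) \<in> borel_measurable M"
  using measurable_compose[OF measurable_Pair1' kernelD(1)] space_M by simp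

lemma kernel_diff: "kernel c H \<Longrightarrow> kernel c H' \<Longrightarrow> kernel (2 * c) (\<lambda>p. H p - H' p)"
proof -
  assume K: "kernel c H" "kernel c H'"
  have "\<bar>H p - H' p\<bar> \<le> 2 * c" for p
    using kernelD(2)[OF K(1), of p] kernelD(2)[OF K(2), of p] by linarith
  then show ?thesis using K by (auto simp: kernel_def)
qed

lemma kernel_integrand:
  assumes "kernel c H" "w \<in> borel_measurable M" "\<And>x. \<bar>w x\<bar> \<le> 1"
  shows "integrable M (\<lambda>z. H (x, z) * w z)" "\<bar>H (x, z) * w z\<bar> \<le> c"
proof -
  show b: "\<bar>H (x, z) * w z\<bar> \<le> c" for z
    using mult_mono[OF kernelD(2)[OF assms(1), of "(x, z)"] assms(3)[of z]] kernelD(2)[OF assms(1), of "(x, z)"]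
    by (simp add: abs_mult)
  show "integrable M (\<lambda>z. H (x, z) * w z)"
    using kernel_section[OF assms(1)] assms(2) b by (intro integrable_bdd[of _ c]) auto
qed

lemma kernel_op_measurable:
  assumes "kernel c H" "w \<in> borel_measurable M"
  shows "kernel_op H w \<in> borel_measurable M"
proof -
  have [measurable]: "H \<in> borel_measurable (M \<Otimes>\<^sub>M M)" "w \<in> borel_measurable M"
    using assms kernelD by auto
  show ?thesis unfolding kernel_op_def by measurable
qed

lemma kernel_op_bound:
  assumes "kernel c H" "w \<in> borel_measurable M" "\<And>x. \<bar>w x\<bar> \<le> 1"
  shows "\<bar>kernel_op H w x\<bar> \<le> c"
proof -
  have "\<bar>kernel_op H w x\<bar> \<le> (\<integral>z. \<bar>H (x, z) * w z\<bar> \<partial>M)" unfolding kernel_op_def by (rule integral_abs_bound)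
  also have "\<dots> \<le> (\<integral>z. c \<partial>M)"
    using kernel_integrand[OF assms] by (intro integral_mono integrable_abs) auto
  finally show ?thesis by (simp add: prob_space)
qed

lemma kernel_op_L1_bound:
  assumes "kernel c H" "w \<in> borel_measurable M" "\<And>x. \<bar>w x\<bar> \<le> 1"
  shows "(\<integral>x. \<bar>kernel_op H w x\<bar> \<partial>M) \<le> (\<integral>p. \<bar>H p\<bar> \<partial>(M \<Otimes>\<^sub>M M))"
proof -
  interpret P: pair_prob_space M M ..
  have iH: "integrable (M \<Otimes>\<^sub>M M) (\<lambda>p. \<bar>H p\<bar>)" using kernel_integrable[OF assms(1)] by simp
  have "(\<integral>x. \<bar>kernel_op H w x\<bar> \<partial>M) \<le> (\<integral>x. (\<integral>z. \<bar>H (x, z)\<bar> \<partial>M) \<partial>M)"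
  proof (rule integral_mono)
    show "integrable M (\<lambda>x. \<bar>kernel_op H w x\<bar>)"
      using kernel_op_measurable[OF assms(1,2)] kernel_op_bound[OF assms] by (intro integrable_abs integrable_bdd) auto
    show "integrable M (\<lambda>x. \<integral>z. \<bar>H (x, z)\<bar> \<partial>M)" using P.integrable_fst'[OF iH] .
    fix x
    have iS: "integrable M (\<lambda>z. \<bar>H (x, z)\<bar>)"
      using kernel_section[OF assms(1), of x] kernelD(2)[OF assms(1)] by (intro integrable_abs integrable_bdd[of _ c]) auto
    have "\<bar>kernel_op H w x\<bar> \<le> (\<integral>z. \<bar>H (x, z) * w z\<bar> \<partial>M)" unfolding kernel_op_def by (rule integral_abs_bound)
    also have "\<dots> \<le> (\<integral>z. \<bar>H (x, z)\<bar> \<partial>M)"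
    proof (rule integral_mono)
      fix z show "\<bar>H (x, z) * w z\<bar> \<le> \<bar>H (x, z)\<bar>"
        using mult_left_mono[OF assms(3)[of z], of "\<bar>H (x, z)\<bar>"] by (simp add: abs_mult)
    qed (use kernel_integrand[OF assms] iS in auto)
    finally show "\<bar>kernel_op H w x\<bar> \<le> (\<integral>z. \<bar>H (x, z)\<bar> \<partial>M)" .
  qed
  also have "\<dots> = (\<integral>p. \<bar>H p\<bar> \<partial>(M \<Otimes>\<^sub>M M))" using P.integral_fst'[OF iH] .
  finally show ?thesis .
qed

lemma kernel_op_diff:
  assumes "kernel c H" "kernel c H'" "w \<in> borel_measurable M" "\<And>x. \<bar>w x\<bar> \<le> 1"
  shows "kernel_op (\<lambda>p. H p - H' p) w x = kernel_op H w x - kernel_op H' w x"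
  unfolding kernel_op_def
  using kernel_integrand(1)[OF assms(1,3,4)] kernel_integrand(1)[OF assms(2,3,4)]
  by (simp add: left_diff_distrib)

definition kernel_act :: "'g \<Rightarrow> ('x \<times> 'x \<Rightarrow> real) \<Rightarrow> 'x \<times> 'x \<Rightarrow> real" where
  "kernel_act s H = (\<lambda>(x, z). H (\<phi> s x, \<phi> s z))"

lemma act2_measurable:
  assumes "s \<in> carrier G"
  shows "(\<lambda>(x, z). (\<phi> s x, \<phi> s z)) \<in> measurable (M \<Otimes>\<^sub>M M) (M \<Otimes>\<^sub>M M)"
proof -
  have [measurable]: "\<phi> s \<in> measurable M M" using act_measurable[OF assms] .
  show ?thesis by measurable
qed

lemma distr_act2:
  assumes "s \<in> carrier G"
  shows "distr (M \<Otimes>\<^sub>M M) (M \<Otimes>\<^sub>M M) (\<lambda>(x, z). (\<phi> s x, \<phi> s z)) = M \<Otimes>\<^sub>M M"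
proof -
  have "sigma_finite_measure (distr M M (\<phi> s))"
    unfolding act_distr[OF assms] by (rule sigma_finite_measure_axioms)
  then show ?thesis
    using pair_measure_distr[OF act_measurable[OF assms] act_measurable[OF assms]] act_distr[OF assms] by simp
qed

lemma kernel_act_eq: "kernel_act s H = H \<circ> (\<lambda>(x, z). (\<phi> s x, \<phi> s z))"
  by (auto simp: kernel_act_def)

lemma kernel_kernel_act:
  assumes "s \<in> carrier G" "kernel c H"
  shows "kernel c (kernel_act s H)"
  using measurable_comp[OF act2_measurable[OF assms(1)] kernelD(1)[OF assms(2)]] kernelD(2)[OF assms(2)]
  unfolding kernel_def kernel_act_eq by auto

lemma integral_kernel_act:
  assumes "s \<in> carrier G" "H \<in> borel_measurable (M \<Otimes>\<^sub>M M)"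
  shows "(\<integral>p. kernel_act s H p \<partial>(M \<Otimes>\<^sub>M M)) = (\<integral>p. (H p :: real) \<partial>(M \<Otimes>\<^sub>M M))"
  using integral_distr[OF act2_measurable[OF assms(1)] assms(2)]
  unfolding distr_act2[OF assms(1)] kernel_act_eq by simp

lemma kernel_op_act:
  assumes "s \<in> carrier G" "kernel c H" "w \<in> borel_measurable M"
  shows "kernel_op H w (\<phi> s x) = kernel_op (kernel_act s H) (\<lambda>z. w (\<phi> s z)) x"
  unfolding kernel_op_def kernel_act_def
  using integral_act[OF assms(1), of "\<lambda>z. H (\<phi> s x, z) * w z"] kernel_section[OF assms(2)] assms(3)
  by simp

text \<open>
  The kernel of the finite rank operator \<open>w \<mapsto> \<Sum>\<^sub>g \<langle>w, g \<circ> \<phi> s\<rangle> (g \<circ> \<phi> s)\<close>, where \<open>g\<close> runs over the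
  indicators of the sets in \<open>\<G>\<close>. Pairing it with \<open>w \<otimes> w\<close> gives the sum of the squared correlations of
  \<open>w\<close> with these translates.
\<close>

definition orbit_kernel :: "'x set set \<Rightarrow> 'g \<Rightarrow> 'x \<times> 'x \<Rightarrow> real" where
  "orbit_kernel \<G> s = (\<lambda>(x, z). \<Sum>g\<in>\<G>. indicator g (\<phi> s x) * indicator g (\<phi> s z))"

lemma integrable_indicator_act_mult:
  fixes w :: "'x \<Rightarrow> real"
  assumes "A \<in> sets M" "s \<in> carrier G" "w \<in> borel_measurable M" "\<And>x. \<bar>w x\<bar> \<le> 1"
  shows "integrable M (\<lambda>z. indicator A (\<phi> s z) * w z)"
proof (rule integrable_bdd)
  have "(indicator A :: 'x \<Rightarrow> real) \<in> borel_measurable M" using assms(1) by simp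
  from measurable_act[OF this assms(2)]
  show "(\<lambda>z. indicator A (\<phi> s z) * w z) \<in> borel_measurable M" using assms(3) by simp
  show "\<bar>indicator A (\<phi> s z) * w z\<bar> \<le> 1" for z using assms(4)[of z] by (simp add: indicator_def)
qed

lemma kernel_op_orbit_kernel:
  assumes "\<G> \<subseteq> sets M" "s \<in> carrier G" "w \<in> borel_measurable M" "\<And>x. \<bar>w x\<bar> \<le> 1"
  shows "kernel_op (orbit_kernel \<G> s) w x
    = (\<Sum>g\<in>\<G>. indicator g (\<phi> s x) * (\<integral>z. indicator g (\<phi> s z) * w z \<partial>M))"
proof -
  have i: "integrable M (\<lambda>z. indicator g (\<phi> s z) * w z)" if "g \<in> \<G>" for g
    using that assms(1) by (intro integrable_indicator_act_mult assms(2-4)) auto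
  have "kernel_op (orbit_kernel \<G> s) w x
     = (\<integral>z. (\<Sum>g\<in>\<G>. indicator g (\<phi> s x) * (indicator g (\<phi> s z) * w z)) \<partial>M)"
    unfolding kernel_op_def orbit_kernel_def by (simp add: sum_distrib_right mult.assoc)
  also have "\<dots> = (\<Sum>g\<in>\<G>. \<integral>z. indicator g (\<phi> s x) * (indicator g (\<phi> s z) * w z) \<partial>M)"
    using i by (intro Bochner_Integration.integral_sum integrable_mult_right) auto
  finally show ?thesis by simp
qed

lemma kernel_op_midpoint:
  assumes "kernel c H" "kernel c H'" "w \<in> borel_measurable M" "\<And>x. \<bar>w x\<bar> \<le> 1"
  shows "kernel_op (\<lambda>p. (H p + H' p) / 2) w x = (kernel_op H w x + kernel_op H' w x) / 2"
  using kernel_integrand(1)[OF assms(1,3,4)] kernel_integrand(1)[OF assms(2,3,4)]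
  unfolding kernel_op_def by (simp add: distrib_right add_divide_distrib)

text \<open>
  The orbit of the kernel under \<open>G\<close>, closed under midpoints. The parallelogram argument for
  minimal norms only forms midpoints, so this replaces the convex hull.
\<close>

inductive_set kernel_hull :: "'x set set \<Rightarrow> ('x \<times> 'x \<Rightarrow> real) set" for \<G> where
  base: "s \<in> carrier G \<Longrightarrow> orbit_kernel \<G> s \<in> kernel_hull \<G>"
| midpoint: "H \<in> kernel_hull \<G> \<Longrightarrow> H' \<in> kernel_hull \<G> \<Longrightarrow> (\<lambda>p. (H p + H' p) / 2) \<in> kernel_hull \<G>"

lemma kernel_hull_kernel:
  assumes "H \<in> kernel_hull \<G>" "\<G> \<subseteq> sets M"
  shows "kernel (card \<G>) H"
  using assms(1)
proof induction
  case (base s)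
  have [measurable]: "\<phi> s \<in> measurable M M" using act_measurable[OF base] .
  have "(\<lambda>(x, z). indicator g (\<phi> s x) * indicator g (\<phi> s z) :: real) \<in> borel_measurable (M \<Otimes>\<^sub>M M)"
    if "g \<in> \<G>" for g
  proof -
    have [measurable]: "g \<in> sets M" using that assms(2) by blast
    show ?thesis by measurable
  qed
  then have m: "(\<lambda>p. \<Sum>g\<in>\<G>. (case p of (x, z) \<Rightarrow> indicator g (\<phi> s x) * indicator g (\<phi> s z)) :: real)
      \<in> borel_measurable (M \<Otimes>\<^sub>M M)"
    by (intro borel_measurable_sum) auto
  have "\<bar>\<Sum>g\<in>\<G>. indicator g (\<phi> s x) * indicator g (\<phi> s z) :: real\<bar> \<le> card \<G>" for x z
  proof -
    have "\<bar>\<Sum>g\<in>\<G>. indicator g (\<phi> s x) * indicator g (\<phi> s z) :: real\<bar>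
        \<le> (\<Sum>g\<in>\<G>. \<bar>indicator g (\<phi> s x) * indicator g (\<phi> s z) :: real\<bar>)" by (rule sum_abs)
    also have "\<dots> \<le> (\<Sum>g\<in>\<G>. 1)" by (intro sum_mono) (auto simp: indicator_def)
    finally show ?thesis by simp
  qed
  then show ?case using m unfolding kernel_def orbit_kernel_def by (auto simp: case_prod_unfold)
next
  case (midpoint H H')
  have "\<bar>(H p + H' p) / 2\<bar> \<le> card \<G>" for p
    using kernelD(2)[OF midpoint.IH(1), of p] kernelD(2)[OF midpoint.IH(2), of p] by auto
  then show ?case using midpoint.IH by (auto simp: kernel_def)
qed

lemma kernel_hull_act:
  assumes "H \<in> kernel_hull \<G>" "t \<in> carrier G"
  shows "kernel_act t H \<in> kernel_hull \<G>"
  using assms(1)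
proof induction
  case (base s)
  have "s \<otimes> t \<in> carrier G" using grp base assms(2) by (simp add: group.is_monoid monoid.m_closed)
  from kernel_hull.base[OF this] show ?case
    using base assms(2) by (simp add: kernel_act_def orbit_kernel_def act_mult)
next
  case (midpoint H H')
  have "kernel_act t (\<lambda>p. (H p + H' p) / 2) = (\<lambda>p. (kernel_act t H p + kernel_act t H' p) / 2)"
    by (auto simp: kernel_act_def)
  then show ?case using kernel_hull.midpoint[OF midpoint.IH] by simp
qed

text \<open>
  The operators in the hull have finite rank, so on the bounded set of translates of \<open>w\<close> they are
  controlled by finitely many bounded coefficients.
\<close>

lemma kernel_hull_totally_bdd:
  assumes H: "H \<in> kernel_hull \<G>" and Gs: "\<G> \<subseteq> sets M" "finite \<G>"
    and w: "w \<in> borel_measurable M" "\<And>x. \<bar>w x\<bar> \<le> 1"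
  shows "totally_bdd (carrier G)
    (\<lambda>s r. \<integral>x. \<bar>kernel_op H (\<lambda>z. w (\<phi> s z)) x - kernel_op H (\<lambda>z. w (\<phi> r z)) x\<bar> \<partial>M)"
  using H
proof induction
  case (base t)
  define c where "c = (\<lambda>g s. \<integral>z. indicator g (\<phi> t z) * w (\<phi> s z) \<partial>M)"
  have ig: "integrable M (\<lambda>z. indicator g (\<phi> t z) * w (\<phi> s z))" if "g \<in> \<G>" "s \<in> carrier G" for g s
    using that Gs by (intro integrable_indicator_act_mult base measurable_act w) auto
  have cb: "\<bar>c g s\<bar> \<le> 1" if "g \<in> \<G>" "s \<in> carrier G" for g s
  proof -
    have "\<bar>c g s\<bar> \<le> (\<integral>z. \<bar>indicator g (\<phi> t z) * w (\<phi> s z)\<bar> \<partial>M)" unfolding c_def by (rule integral_abs_bound)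
    also have "\<dots> \<le> (\<integral>z. 1 \<partial>M)"
      using w(2) ig[OF that] by (intro integral_mono integrable_abs) (auto simp: indicator_def)
    finally show ?thesis by (simp add: prob_space)
  qed
  have op: "kernel_op (orbit_kernel \<G> t) (\<lambda>z. w (\<phi> s z)) x = (\<Sum>g\<in>\<G>. indicator g (\<phi> t x) * c g s)"
    if "s \<in> carrier G" for s x
    unfolding c_def by (rule kernel_op_orbit_kernel[OF Gs(1) base measurable_act[OF w(1) that] w(2)])
  show ?case
  proof (rule totally_bdd_dominated[OF _ totally_bdd_zero, of _ "\<lambda>s r. \<Sum>g\<in>\<G>. \<bar>c g s - c g r\<bar>" 1])
    show "totally_bdd (carrier G) (\<lambda>s r. \<Sum>g\<in>\<G>. \<bar>c g s - c g r\<bar>)"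
    proof (rule totally_bdd_sum[OF Gs(2)])
      fix g assume "g \<in> \<G>"
      then show "totally_bdd (carrier G) (\<lambda>s r. \<bar>c g s - c g r\<bar>)"
        using cb by (intro totally_bdd_real[where B = 1])
    qed
    fix s r assume sr: "s \<in> carrier G" "r \<in> carrier G"
    let ?H = "orbit_kernel \<G> t"
    have "(\<integral>x. \<bar>kernel_op ?H (\<lambda>z. w (\<phi> s z)) x - kernel_op ?H (\<lambda>z. w (\<phi> r z)) x\<bar> \<partial>M)
      \<le> (\<integral>x. (\<Sum>g\<in>\<G>. \<bar>c g s - c g r\<bar>) \<partial>M)"
    proof (rule integral_mono_AE')
      show "AE x in M. \<bar>kernel_op ?H (\<lambda>z. w (\<phi> s z)) x - kernel_op ?H (\<lambda>z. w (\<phi> r z)) x\<bar>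
           \<le> (\<Sum>g\<in>\<G>. \<bar>c g s - c g r\<bar>)"
      proof (rule AE_I2)
        fix x
        have "\<bar>kernel_op ?H (\<lambda>z. w (\<phi> s z)) x - kernel_op ?H (\<lambda>z. w (\<phi> r z)) x\<bar>
           = \<bar>\<Sum>g\<in>\<G>. indicator g (\<phi> t x) * (c g s - c g r)\<bar>"
          unfolding op[OF sr(1)] op[OF sr(2)] by (simp add: sum_subtractf right_diff_distrib)
        also have "\<dots> \<le> (\<Sum>g\<in>\<G>. \<bar>indicator g (\<phi> t x) * (c g s - c g r)\<bar>)" by (rule sum_abs)
        also have "\<dots> \<le> (\<Sum>g\<in>\<G>. \<bar>c g s - c g r\<bar>)" by (intro sum_mono) (auto simp: indicator_def)
        finally show "\<bar>kernel_op ?H (\<lambda>z. w (\<phi> s z)) x - kernel_op ?H (\<lambda>z. w (\<phi> r z)) x\<bar>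
           \<le> (\<Sum>g\<in>\<G>. \<bar>c g s - c g r\<bar>)" .
      qed
    qed (auto intro: sum_nonneg)
    then show "(\<integral>x. \<bar>kernel_op ?H (\<lambda>z. w (\<phi> s z)) x - kernel_op ?H (\<lambda>z. w (\<phi> r z)) x\<bar> \<partial>M)
      \<le> 1 * ((\<Sum>g\<in>\<G>. \<bar>c g s - c g r\<bar>) + 0)" by (simp add: prob_space)
  qed simp
next
  case (midpoint H H')
  let ?d = "\<lambda>H s r. \<integral>x. \<bar>kernel_op H (\<lambda>z. w (\<phi> s z)) x - kernel_op H (\<lambda>z. w (\<phi> r z)) x\<bar> \<partial>M"
  note kH = kernel_hull_kernel[OF midpoint.hyps(1) Gs(1)] kernel_hull_kernel[OF midpoint.hyps(2) Gs(1)]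
  show ?case
  proof (rule totally_bdd_dominated[OF midpoint.IH, of 1])
    fix s r assume sr: "s \<in> carrier G" "r \<in> carrier G"
    have ws: "(\<lambda>z. w (\<phi> t z)) \<in> borel_measurable M" if "t \<in> carrier G" for t using measurable_act[OF w(1) that] .
    have op: "kernel_op (\<lambda>p. (H p + H' p) / 2) (\<lambda>z. w (\<phi> t z)) x
       = (kernel_op H (\<lambda>z. w (\<phi> t z)) x + kernel_op H' (\<lambda>z. w (\<phi> t z)) x) / 2" if "t \<in> carrier G" for t x
      by (rule kernel_op_midpoint[OF kH ws[OF that] w(2)])
    have iH: "integrable M (\<lambda>x. \<bar>kernel_op H (\<lambda>z. w (\<phi> s z)) x - kernel_op H (\<lambda>z. w (\<phi> r z)) x\<bar>)"
      if "kernel (card \<G>) H" for H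
      using kernel_op_measurable[OF that ws] kernel_op_bound[OF that ws w(2)] sr
      by (intro integrable_abs Bochner_Integration.integrable_diff integrable_bdd) auto
    have "?d (\<lambda>p. (H p + H' p) / 2) s r \<le> (\<integral>x. \<bar>kernel_op H (\<lambda>z. w (\<phi> s z)) x - kernel_op H (\<lambda>z. w (\<phi> r z)) x\<bar>
      + \<bar>kernel_op H' (\<lambda>z. w (\<phi> s z)) x - kernel_op H' (\<lambda>z. w (\<phi> r z)) x\<bar> \<partial>M)"
      unfolding op[OF sr(1)] op[OF sr(2)]
    proof (rule integral_mono_AE')
      have ineq: "\<bar>(a + b) / 2 - (a' + b') / 2\<bar> \<le> \<bar>a - a'\<bar> + \<bar>b - b'\<bar>" for a b a' b' :: real
        by (auto simp: abs_if field_simps)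
      show "AE x in M. \<bar>(kernel_op H (\<lambda>z. w (\<phi> s z)) x + kernel_op H' (\<lambda>z. w (\<phi> s z)) x) / 2 -
          (kernel_op H (\<lambda>z. w (\<phi> r z)) x + kernel_op H' (\<lambda>z. w (\<phi> r z)) x) / 2\<bar>
        \<le> \<bar>kernel_op H (\<lambda>z. w (\<phi> s z)) x - kernel_op H (\<lambda>z. w (\<phi> r z)) x\<bar>
          + \<bar>kernel_op H' (\<lambda>z. w (\<phi> s z)) x - kernel_op H' (\<lambda>z. w (\<phi> r z)) x\<bar>"
        by (intro AE_I2 ineq)
    qed (use iH[OF kH(1)] iH[OF kH(2)] in auto)
    also have "\<dots> = ?d H s r + ?d H' s r" using iH[OF kH(1)] iH[OF kH(2)] by simp
    finally show "?d (\<lambda>p. (H p + H' p) / 2) s r \<le> 1 * (?d H s r + ?d H' s r)" by simp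
  qed simp
qed

text \<open>
  By the parallelogram law, two elements of the hull whose \<open>L\<^sup>2\<close> norms are close to the infimum are close
  to each other. Since \<open>G\<close> acts isometrically on the hull, a minimizing sequence is not only Cauchy but
  also asymptotically invariant.
\<close>

lemma kernel_hull_minimizing:
  assumes Gs: "\<G> \<subseteq> sets M"
  obtains \<H> :: "nat \<Rightarrow> 'x \<times> 'x \<Rightarrow> real" where "\<And>n. \<H> n \<in> kernel_hull \<G>"
    "\<And>e. e > 0 \<Longrightarrow> \<exists>N. \<forall>n\<ge>N. \<forall>m\<ge>N. (\<integral>p. \<bar>\<H> n p - \<H> m p\<bar> \<partial>(M \<Otimes>\<^sub>M M)) < e"
    "\<And>e. e > 0 \<Longrightarrow> \<exists>N. \<forall>n\<ge>N. \<forall>s\<in>carrier G. (\<integral>p. \<bar>kernel_act s (\<H> n) p - \<H> n p\<bar> \<partial>(M \<Otimes>\<^sub>M M)) < e"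
proof -
  interpret P: prob_space "M \<Otimes>\<^sub>M M" by (rule prob_space_square)
  let ?C = "kernel_hull \<G>"
  define nrm where "nrm = (\<lambda>H :: 'x \<times> 'x \<Rightarrow> real. \<integral>p. (H p)^2 \<partial>(M \<Otimes>\<^sub>M M))"
  have ker: "kernel (card \<G>) H" if "H \<in> ?C" for H using kernel_hull_kernel[OF that Gs] .
  have isq: "integrable (M \<Otimes>\<^sub>M M) (\<lambda>p. H p * H' p)" if "H \<in> ?C" "H' \<in> ?C" for H H'
  proof (rule P.integrable_const_bound[of _ "real (card \<G>) * real (card \<G>)"])
    show "AE p in M \<Otimes>\<^sub>M M. norm (H p * H' p) \<le> real (card \<G>) * real (card \<G>)"
      using kernelD(2)[OF ker[OF that(1)]] kernelD(2)[OF ker[OF that(2)]]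
      by (auto simp: abs_mult intro!: AE_I2 mult_mono)
  qed (use kernelD(1)[OF ker] that in auto)
  define d where "d = Inf (nrm ` ?C)"
  have ne: "?C \<noteq> {}" using kernel_hull.base[of "\<one>" \<G>] grp by (metis empty_iff group.is_monoid monoid.one_closed)
  have bdd: "bdd_below (nrm ` ?C)" unfolding nrm_def by (rule bdd_belowI[of _ 0]) auto
  have d_le: "d \<le> nrm H" if "H \<in> ?C" for H unfolding d_def using bdd that by (intro cInf_lower) auto
  have "\<exists>H\<in>?C. nrm H < d + 1 / Suc n" for n
  proof -
    have "Inf (nrm ` ?C) < d + 1 / Suc n" by (simp add: d_def)
    then show ?thesis using cInf_lessD[of "nrm ` ?C"] ne by auto
  qed
  then obtain \<H> where \<H>: "\<And>n. \<H> n \<in> ?C" "\<And>n. nrm (\<H> n) < d + 1 / Suc n" by metis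
  have close: "(\<integral>p. \<bar>H p - H' p\<bar> \<partial>(M \<Otimes>\<^sub>M M))^2 \<le> 4 * \<delta>"
    if h: "H \<in> ?C" "H' \<in> ?C" "nrm H \<le> d + \<delta>" "nrm H' \<le> d + \<delta>" for H H' \<delta>
  proof -
    let ?K = "\<lambda>p. (H p + H' p) / 2"
    have K: "?K \<in> ?C" using kernel_hull.midpoint[OF h(1,2)] .
    note i = isq[OF h(1) h(1)] isq[OF h(2) h(2)] isq[OF K K]
    have "(\<integral>p. \<bar>H p - H' p\<bar> \<partial>(M \<Otimes>\<^sub>M M))^2 \<le> (\<integral>p. (H p - H' p)^2 \<partial>(M \<Otimes>\<^sub>M M))"
      using kernel_diff[OF ker[OF h(1)] ker[OF h(2)]] by (intro P.L1_norm_le_L2_norm) (auto simp: kernel_def)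
    also have "\<dots> = (\<integral>p. 2 * (H p * H p) + 2 * (H' p * H' p) - 4 * (?K p * ?K p) \<partial>(M \<Otimes>\<^sub>M M))"
      by (intro Bochner_Integration.integral_cong) (auto simp: field_simps power2_eq_square)
    also have "\<dots> = 2 * nrm H + 2 * nrm H' - 4 * nrm ?K"
      unfolding nrm_def power2_eq_square
      using i by (simp del: times_divide_eq_left times_divide_eq_right)
    also have "\<dots> \<le> 4 * \<delta>" using h(3,4) d_le[OF K] by simp
    finally show ?thesis .
  qed
  have conv: "(\<integral>p. \<bar>H p - H' p\<bar> \<partial>(M \<Otimes>\<^sub>M M)) < e"
    if h: "H \<in> ?C" "H' \<in> ?C" "nrm H \<le> d + 1 / Suc N" "nrm H' \<le> d + 1 / Suc N" and
      e: "e > 0" "4 / Suc N < e^2" for H H' N e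
  proof -
    have "(\<integral>p. \<bar>H p - H' p\<bar> \<partial>(M \<Otimes>\<^sub>M M))^2 < e^2" using close[OF h] e by simp
    then show ?thesis using e(1) by (simp add: power_less_imp_less_base)
  qed
  have N: "\<exists>N. 4 / Suc N < e^2" if "e > 0" for e :: real
  proof -
    have "e^2 / 4 > 0" using that by simp
    then obtain N where "inverse (real (Suc N)) < e^2 / 4" using reals_Archimedean by blast
    then show ?thesis by (intro exI[of _ N]) (simp add: field_simps)
  qed
  have mono: "nrm (\<H> n) \<le> d + 1 / Suc N" if "n \<ge> N" for n N
  proof -
    have "1 / real (Suc n) \<le> 1 / Suc N" using that by (simp add: field_simps)
    then show ?thesis using \<H>(2)[of n] by linarith
  qed
  have nrm_act: "nrm (kernel_act s H) = nrm H" if "H \<in> ?C" "s \<in> carrier G" for H s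
  proof -
    have "(\<lambda>p. (kernel_act s H p)^2) = kernel_act s (\<lambda>p. (H p)^2)" by (auto simp: kernel_act_def)
    then show ?thesis
      unfolding nrm_def using integral_kernel_act[OF that(2), of "\<lambda>p. (H p)^2"] kernelD(1)[OF ker[OF that(1)]] by simp
  qed
  show ?thesis
  proof (rule that[of \<H>])
    show "\<H> n \<in> ?C" for n by (rule \<H>)
    fix e :: real assume e: "e > 0"
    obtain N0 where N0: "4 / Suc N0 < e^2" using N[OF e] by blast
    show "\<exists>N. \<forall>n\<ge>N. \<forall>m\<ge>N. (\<integral>p. \<bar>\<H> n p - \<H> m p\<bar> \<partial>(M \<Otimes>\<^sub>M M)) < e"
      using conv[OF \<H>(1) \<H>(1) mono mono e N0] by blast
    show "\<exists>N. \<forall>n\<ge>N. \<forall>s\<in>carrier G. (\<integral>p. \<bar>kernel_act s (\<H> n) p - \<H> n p\<bar> \<partial>(M \<Otimes>\<^sub>M M)) < e"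
    proof (intro exI[of _ N0] allI impI ballI)
      fix n s assume n: "n \<ge> N0" and s: "s \<in> carrier G"
      show "(\<integral>p. \<bar>kernel_act s (\<H> n) p - \<H> n p\<bar> \<partial>(M \<Otimes>\<^sub>M M)) < e"
        using conv[OF kernel_hull_act[OF \<H>(1) s] \<H>(1) _ mono[OF n] e N0] nrm_act[OF \<H>(1) s] mono[OF n] by simp
    qed
  qed
qed

text \<open>
  For an almost invariant kernel \<open>H\<close>, translating \<open>H w\<close> by \<open>s\<close> is almost the same as applying \<open>H\<close> to the
  translate of \<open>w\<close>, uniformly in \<open>s\<close>; and the functions obtained in the latter way form a totally bounded
  set. So the limit is almost periodic.
\<close>

lemma minimizing_kernels_almost_periodic_limit:
  assumes ker: "\<And>n. kernel c (\<H> n)"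
    and tb: "\<And>n. totally_bdd (carrier G)
      (\<lambda>s r. \<integral>x. \<bar>kernel_op (\<H> n) (\<lambda>z. w (\<phi> s z)) x - kernel_op (\<H> n) (\<lambda>z. w (\<phi> r z)) x\<bar> \<partial>M)"
    and cau: "\<And>e. e > 0 \<Longrightarrow> \<exists>N. \<forall>n\<ge>N. \<forall>m\<ge>N. (\<integral>p. \<bar>\<H> n p - \<H> m p\<bar> \<partial>(M \<Otimes>\<^sub>M M)) < e"
    and inv: "\<And>e. e > 0 \<Longrightarrow> \<exists>N. \<forall>n\<ge>N. \<forall>s\<in>carrier G. (\<integral>p. \<bar>kernel_act s (\<H> n) p - \<H> n p\<bar> \<partial>(M \<Otimes>\<^sub>M M)) < e"
    and w: "w \<in> borel_measurable M" "\<And>x. \<bar>w x\<bar> \<le> 1"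
  obtains f where "f \<in> borel_measurable M" "\<And>x. \<bar>f x\<bar> \<le> c" "almost_periodic f"
    "(\<lambda>n. \<integral>x. \<bar>kernel_op (\<H> n) w x - f x\<bar> \<partial>M) \<longlonglongrightarrow> 0"
proof -
  let ?f = "\<lambda>n. kernel_op (\<H> n) w"
  have fm: "?f n \<in> borel_measurable M" and fb: "\<bar>?f n x\<bar> \<le> c" for n x
    using kernel_op_measurable[OF ker w(1)] kernel_op_bound[OF ker w] by auto
  have "\<exists>N. \<forall>i\<ge>N. \<forall>j\<ge>N. (\<integral>x. \<bar>?f i x - ?f j x\<bar> \<partial>M) < e" if "e > 0" for e
  proof -
    have "(\<integral>x. \<bar>?f i x - ?f j x\<bar> \<partial>M) \<le> (\<integral>p. \<bar>\<H> i p - \<H> j p\<bar> \<partial>(M \<Otimes>\<^sub>M M))" for i j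
      using kernel_op_L1_bound[OF kernel_diff[OF ker ker] w, of i j]
      unfolding kernel_op_diff[OF ker ker w] .
    then show ?thesis using cau[OF that] order_le_less_trans by blast
  qed
  then obtain f where f: "f \<in> borel_measurable M" "\<And>x. \<bar>f x\<bar> \<le> c"
    "(\<lambda>n. \<integral>x. \<bar>?f n x - f x\<bar> \<partial>M) \<longlonglongrightarrow> 0"
    by (rule bounded_L1_limit[of ?f c, OF fm fb]) blast+
  have "totally_bdd (carrier G) (orbit_dist f)"
  proof (rule totally_bdd_approx)
    fix e :: real assume e: "e > 0"
    have "\<forall>\<^sub>F n in sequentially. (\<integral>x. \<bar>?f n x - f x\<bar> \<partial>M) < e / 4"
      using f(3) e by (intro order_tendstoD(2)) auto
    then obtain N1 where N1: "\<And>n. n \<ge> N1 \<Longrightarrow> (\<integral>x. \<bar>?f n x - f x\<bar> \<partial>M) < e / 4"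
      by (auto simp: eventually_sequentially)
    obtain N2 where N2: "\<And>n s. n \<ge> N2 \<Longrightarrow> s \<in> carrier G \<Longrightarrow>
        (\<integral>p. \<bar>kernel_act s (\<H> n) p - \<H> n p\<bar> \<partial>(M \<Otimes>\<^sub>M M)) < e / 4"
      using inv[of "e/4"] e by auto
    define n where "n = max N1 N2"
    let ?H = "\<H> n"
    define a where "a = (\<lambda>s. kernel_op ?H (\<lambda>z. w (\<phi> s z)))"
    have ws: "(\<lambda>z. w (\<phi> s z)) \<in> borel_measurable M" if "s \<in> carrier G" for s using measurable_act[OF w(1) that] .
    have am: "a s \<in> borel_measurable M" "\<bar>a s x\<bar> \<le> c" if "s \<in> carrier G" for s x
      using kernel_op_measurable[OF ker ws[OF that]] kernel_op_bound[OF ker ws[OF that] w(2)] by (auto simp: a_def)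
    have fs: "(\<lambda>x. f (\<phi> s x)) \<in> borel_measurable M" if "s \<in> carrier G" for s using measurable_act[OF f(1) that] .
    have ints: "integrable M (a s)" "integrable M (\<lambda>x. f (\<phi> s x))" "integrable M (\<lambda>x. ?f n (\<phi> s x))"
      if "s \<in> carrier G" for s
      using am[OF that] fs[OF that] f(2) measurable_act[OF fm that] fb by (auto intro: integrable_bdd[of _ c])
    have close: "(\<integral>x. \<bar>f (\<phi> s x) - a s x\<bar> \<partial>M) \<le> e / 2" if s: "s \<in> carrier G" for s
    proof -
      have "(\<integral>x. \<bar>f (\<phi> s x) - a s x\<bar> \<partial>M)
         \<le> (\<integral>x. \<bar>?f n (\<phi> s x) - f (\<phi> s x)\<bar> + \<bar>?f n (\<phi> s x) - a s x\<bar> \<partial>M)"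
        using ints[OF s] by (intro integral_mono) auto
      also have "\<dots> = (\<integral>x. \<bar>?f n (\<phi> s x) - f (\<phi> s x)\<bar> \<partial>M) + (\<integral>x. \<bar>?f n (\<phi> s x) - a s x\<bar> \<partial>M)"
        using ints[OF s] by simp
      also have "(\<integral>x. \<bar>?f n (\<phi> s x) - f (\<phi> s x)\<bar> \<partial>M) = (\<integral>x. \<bar>?f n x - f x\<bar> \<partial>M)"
        using integral_act[OF s, of "\<lambda>x. \<bar>?f n x - f x\<bar>"] fm f(1) by simp
      also have "(\<integral>x. \<bar>?f n (\<phi> s x) - a s x\<bar> \<partial>M)
         = (\<integral>x. \<bar>kernel_op (\<lambda>p. kernel_act s ?H p - ?H p) (\<lambda>z. w (\<phi> s z)) x\<bar> \<partial>M)"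
        unfolding kernel_op_diff[OF kernel_kernel_act[OF s ker] ker ws[OF s] w(2)] kernel_op_act[OF s ker w(1)] a_def ..
      also have "\<dots> \<le> (\<integral>p. \<bar>kernel_act s ?H p - ?H p\<bar> \<partial>(M \<Otimes>\<^sub>M M))"
        by (rule kernel_op_L1_bound[OF kernel_diff[OF kernel_kernel_act[OF s ker] ker] ws[OF s] w(2)])
      finally show ?thesis using N1[of n] N2[of n s] s by (simp add: n_def)
    qed
    have "orbit_dist f s r \<le> (\<integral>x. \<bar>a s x - a r x\<bar> \<partial>M) + e" if sr: "s \<in> carrier G" "r \<in> carrier G" for s r
    proof -
      have "orbit_dist f s r \<le> (\<integral>x. \<bar>f (\<phi> s x) - a s x\<bar> + \<bar>f (\<phi> r x) - a r x\<bar> + \<bar>a s x - a r x\<bar> \<partial>M)"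
        unfolding orbit_dist_def using ints[OF sr(1)] ints[OF sr(2)] by (intro integral_mono) auto
      also have "\<dots> = (\<integral>x. \<bar>f (\<phi> s x) - a s x\<bar> \<partial>M) + (\<integral>x. \<bar>f (\<phi> r x) - a r x\<bar> \<partial>M)
          + (\<integral>x. \<bar>a s x - a r x\<bar> \<partial>M)"
        using ints[OF sr(1)] ints[OF sr(2)] by simp
      finally show ?thesis using close[OF sr(1)] close[OF sr(2)] by simp
    qed
    then show "\<exists>d'. totally_bdd (carrier G) d' \<and> (\<forall>s\<in>carrier G. \<forall>r\<in>carrier G. orbit_dist f s r \<le> d' s r + e)"
      using tb[of n] unfolding a_def by blast
  qed
  then show ?thesis using that[of f] f by (simp add: almost_periodic_def)
qed

text \<open>
  Functions orthogonal to the almost periodic \<open>\<sigma>\<close>-algebra are weakly mixing. Otherwise, for every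
  \<open>s\<close>, the translate by \<open>s\<close> of some \<open>w j\<close> has correlation at least \<open>e\<close> with some set in \<open>\<G>\<close>, so that the pairing \<open>\<Sum>\<^sub>j \<langle>H w\<^sub>j, w\<^sub>j\<rangle>\<close> is at least \<open>e\<^sup>2\<close>
  on the orbit of the kernel and hence on its hull. Along a minimizing sequence \<open>H w\<^sub>j\<close> converges to an
  almost periodic function, which is orthogonal to \<open>w\<^sub>j\<close>; so the pairing tends to zero.
\<close>

theorem weak_mixing_over_ap_algebra:
  fixes w :: "'j \<Rightarrow> 'x \<Rightarrow> real"
  assumes Gs: "finite \<G>" "\<G> \<subseteq> sets M" and J: "finite J"
    and w: "\<And>j. j \<in> J \<Longrightarrow> w j \<in> borel_measurable M" "\<And>j x. j \<in> J \<Longrightarrow> \<bar>w j x\<bar> \<le> 1"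
    and orth: "\<And>j f c. j \<in> J \<Longrightarrow> f \<in> borel_measurable ap_algebra \<Longrightarrow> (\<And>x. \<bar>f x\<bar> \<le> c) \<Longrightarrow> (\<integral>x. f x * w j x \<partial>M) = 0"
    and e: "e > 0"
  shows "\<exists>s\<in>carrier G. \<forall>g\<in>\<G>. \<forall>j\<in>J. \<bar>\<integral>x. indicator g x * w j (\<phi> s x) \<partial>M\<bar> < e"
proof (rule ccontr)
  assume "\<not> ?thesis"
  then have neg: "\<exists>g\<in>\<G>. \<exists>j\<in>J. \<bar>\<integral>x. indicator g x * w j (\<phi> s x) \<partial>M\<bar> \<ge> e" if "s \<in> carrier G" for s
    using that by force
  define pr where "pr = (\<lambda>H. \<Sum>j\<in>J. \<integral>x. kernel_op H (w j) x * w j x \<partial>M)"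
  have iop: "integrable M (\<lambda>x. kernel_op H (w j) x * w j x)" if "kernel c H" "j \<in> J" for H c j
  proof (rule integrable_bdd)
    show "\<bar>kernel_op H (w j) x * w j x\<bar> \<le> c" for x
      using mult_mono[OF kernel_op_bound[OF that(1) w[OF that(2)]] w(2)[OF that(2), of x]]
        kernel_op_bound[OF that(1) w[OF that(2)]]
      by (force simp: abs_mult)
  qed (use kernel_op_measurable[OF that(1) w(1)[OF that(2)]] w(1)[OF that(2)] in auto)
  have pr_ge: "pr H \<ge> e^2" if "H \<in> kernel_hull \<G>" for H
    using that
  proof induction
    case (base s)
    define c where "c = (\<lambda>j g. \<integral>x. indicator g (\<phi> s x) * w j x \<partial>M)"
    have "(\<integral>x. kernel_op (orbit_kernel \<G> s) (w j) x * w j x \<partial>M) = (\<Sum>g\<in>\<G>. (c j g)^2)" if "j \<in> J" for j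
    proof -
      have ig: "integrable M (\<lambda>z. indicator g (\<phi> s z) * w j z)" if "g \<in> \<G>" for g
        using that \<open>j \<in> J\<close> Gs by (intro integrable_indicator_act_mult base w) auto
      have "(\<integral>x. kernel_op (orbit_kernel \<G> s) (w j) x * w j x \<partial>M)
        = (\<integral>x. (\<Sum>g\<in>\<G>. c j g * (indicator g (\<phi> s x) * w j x)) \<partial>M)"
        unfolding kernel_op_orbit_kernel[OF Gs(2) base w[OF that]] c_def
        by (simp add: sum_distrib_right sum_distrib_left mult_ac)
      also have "\<dots> = (\<Sum>g\<in>\<G>. \<integral>x. c j g * (indicator g (\<phi> s x) * w j x) \<partial>M)"
        using ig by (intro Bochner_Integration.integral_sum integrable_mult_right) auto
      finally show ?thesis by (simp add: c_def power2_eq_square)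
    qed
    then have pr_eq: "pr (orbit_kernel \<G> s) = (\<Sum>j\<in>J. \<Sum>g\<in>\<G>. (c j g)^2)" by (simp add: pr_def)
    have si: "inv s \<in> carrier G" using base grp by simp
    obtain g j where gj: "g \<in> \<G>" "j \<in> J" "\<bar>\<integral>x. indicator g x * w j (\<phi> (inv s) x) \<partial>M\<bar> \<ge> e"
      using neg[OF si] by blast
    have "c j g = (\<integral>x. indicator g x * w j (\<phi> (inv s) x) \<partial>M)"
    proof -
      have gm: "(indicator g :: 'x \<Rightarrow> real) \<in> borel_measurable M" using gj Gs by auto
      have "(\<lambda>x. indicator g (\<phi> s x) * w j x) \<in> borel_measurable M"
        using measurable_act[OF gm base] w(1)[OF gj(2)] by simp
      from integral_act[OF si this] show ?thesis unfolding c_def using act_inv[OF base] by simp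
    qed
    then have "e^2 \<le> (c j g)^2" using gj(3) e by (metis abs_le_square_iff abs_of_pos)
    also have "\<dots> \<le> (\<Sum>g\<in>\<G>. (c j g)^2)" using Gs gj by (intro member_le_sum) auto
    also have "\<dots> \<le> (\<Sum>j\<in>J. \<Sum>g\<in>\<G>. (c j g)^2)"
      using gj J by (intro member_le_sum[of j J "\<lambda>j. \<Sum>g\<in>\<G>. (c j g)^2"]) (auto intro: sum_nonneg)
    finally show ?case unfolding pr_eq .
  next
    case (midpoint H H')
    note k = kernel_hull_kernel[OF midpoint.hyps(1) Gs(2)] kernel_hull_kernel[OF midpoint.hyps(2) Gs(2)]
    have "(\<integral>x. kernel_op (\<lambda>p. (H p + H' p) / 2) (w j) x * w j x \<partial>M)
      = ((\<integral>x. kernel_op H (w j) x * w j x \<partial>M) + (\<integral>x. kernel_op H' (w j) x * w j x \<partial>M)) / 2" if j: "j \<in> J" for j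
    proof -
      show ?thesis unfolding kernel_op_midpoint[OF k w[OF j]] using iop[OF k(1) j] iop[OF k(2) j]
        by (simp add: distrib_right add_divide_distrib)
    qed
    then have "pr (\<lambda>p. (H p + H' p) / 2) = (pr H + pr H') / 2"
      by (simp add: pr_def sum.distrib sum_divide_distrib add_divide_distrib)
    then show ?case using midpoint.IH by simp
  qed
  obtain \<H> :: "nat \<Rightarrow> 'x \<times> 'x \<Rightarrow> real" where \<H>: "\<And>n. \<H> n \<in> kernel_hull \<G>"
    "\<And>e. e > 0 \<Longrightarrow> \<exists>N. \<forall>n\<ge>N. \<forall>m\<ge>N. (\<integral>p. \<bar>\<H> n p - \<H> m p\<bar> \<partial>(M \<Otimes>\<^sub>M M)) < e"
    "\<And>e. e > 0 \<Longrightarrow> \<exists>N. \<forall>n\<ge>N. \<forall>s\<in>carrier G. (\<integral>p. \<bar>kernel_act s (\<H> n) p - \<H> n p\<bar> \<partial>(M \<Otimes>\<^sub>M M)) < e"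
    by (rule kernel_hull_minimizing[OF Gs(2)]) blast
  have ker: "kernel (card \<G>) (\<H> n)" for n using kernel_hull_kernel[OF \<H>(1) Gs(2)] .
  have lim0: "(\<lambda>n. \<integral>x. kernel_op (\<H> n) (w j) x * w j x \<partial>M) \<longlonglongrightarrow> 0" if j: "j \<in> J" for j
  proof -
    obtain f :: "'x \<Rightarrow> real" where f: "f \<in> borel_measurable M" "\<And>x. \<bar>f x\<bar> \<le> card \<G>" "almost_periodic f"
      "(\<lambda>n. \<integral>x. \<bar>kernel_op (\<H> n) (w j) x - f x\<bar> \<partial>M) \<longlonglongrightarrow> 0"
      by (rule minimizing_kernels_almost_periodic_limit[where \<H> = \<H> and w = "w j",
          OF ker kernel_hull_totally_bdd[OF \<H>(1) Gs(2,1) w[OF j]] \<H>(2,3) w[OF j]]) blast+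
    have fi: "integrable M f" using f(1,2) by (rule integrable_bdd)
    have "f \<in> borel_measurable ap_algebra" using ap_measurable[OF f(1) fi f(3)] .
    then have zero: "(\<integral>x. f x * w j x \<partial>M) = 0" by (rule orth[OF j _ f(2)])
    have ifw: "integrable M (\<lambda>x. f x * w j x)"
    proof (rule integrable_bdd)
      show "\<bar>f x * w j x\<bar> \<le> card \<G>" for x
        using mult_mono[OF f(2)[of x] w(2)[OF j, of x]] by (simp add: abs_mult)
    qed (use f(1) w(1)[OF j] in auto)
    show ?thesis
    proof (rule Lim_null_comparison[OF _ f(4)], rule always_eventually, rule allI)
      fix n
      have "\<bar>\<integral>x. kernel_op (\<H> n) (w j) x * w j x \<partial>M\<bar> = \<bar>\<integral>x. kernel_op (\<H> n) (w j) x * w j x - f x * w j x \<partial>M\<bar>"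
        using iop[OF ker j] ifw zero by simp
      also have "\<dots> \<le> (\<integral>x. \<bar>kernel_op (\<H> n) (w j) x * w j x - f x * w j x\<bar> \<partial>M)" by (rule integral_abs_bound)
      also have "\<dots> \<le> (\<integral>x. \<bar>kernel_op (\<H> n) (w j) x - f x\<bar> \<partial>M)"
      proof (rule integral_mono)
        show "integrable M (\<lambda>x. \<bar>kernel_op (\<H> n) (w j) x - f x\<bar>)"
          using integrable_bdd[OF kernel_op_measurable[OF ker w(1)[OF j]] kernel_op_bound[OF ker w[OF j]]] fi by auto
        show "integrable M (\<lambda>x. \<bar>kernel_op (\<H> n) (w j) x * w j x - f x * w j x\<bar>)"
          using iop[OF ker j] ifw by auto
        fix x
        have "\<bar>kernel_op (\<H> n) (w j) x * w j x - f x * w j x\<bar> = \<bar>kernel_op (\<H> n) (w j) x - f x\<bar> * \<bar>w j x\<bar>"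
          by (simp add: left_diff_distrib[symmetric] abs_mult)
        also have "\<dots> \<le> \<bar>kernel_op (\<H> n) (w j) x - f x\<bar> * 1" by (intro mult_left_mono w(2)[OF j]) auto
        finally show "\<bar>kernel_op (\<H> n) (w j) x * w j x - f x * w j x\<bar> \<le> \<bar>kernel_op (\<H> n) (w j) x - f x\<bar>" by simp
      qed
      finally show "norm (\<integral>x. kernel_op (\<H> n) (w j) x * w j x \<partial>M) \<le> (\<integral>x. \<bar>kernel_op (\<H> n) (w j) x - f x\<bar> \<partial>M)"
        by simp
    qed
  qed
  have "(\<lambda>n. pr (\<H> n)) \<longlonglongrightarrow> (\<Sum>j\<in>J. 0)" unfolding pr_def using lim0 by (intro tendsto_sum) auto
  then have "e^2 \<le> 0" using LIMSEQ_le_const[of "\<lambda>n. pr (\<H> n)" 0 "e^2"] pr_ge[OF \<H>(1)] by simp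
  then show False using e by simp
qed

end

section \<open>Independent translates\<close>

text \<open>
  Every set described by the memberships of its points in finitely many measurable sets is a finite
  union of intersections of these sets and their complements.
\<close>

lemma sets_finite_pattern:
  assumes "finite Y" "\<And>y. y \<in> Y \<Longrightarrow> W y \<in> sets M" "space M = UNIV"
  shows "{x. P {y\<in>Y. x \<in> W y}} \<in> sets M"
proof -
  have "{x. {y\<in>Y. x \<in> W y} = S} \<in> sets M" if "S \<subseteq> Y" for S
  proof -
    have eq: "{x. {y\<in>Y. x \<in> W y} = S} = UNIV - (\<Union>y\<in>Y. if y \<in> S then UNIV - W y else W y)"
      using that by (auto split: if_splits)
    have "(if y \<in> S then UNIV - W y else W y) \<in> sets M" if "y \<in> Y" for y
      using assms(2)[OF that] assms(3) sets.compl_sets[of "W y" M] by auto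
    then have "(\<Union>y\<in>Y. if y \<in> S then UNIV - W y else W y) \<in> sets M"
      using assms(1) by (intro sets.finite_UN) auto
    then show ?thesis unfolding eq using assms(3) sets.compl_sets by metis
  qed
  then have "(\<Union>S\<in>{S\<in>Pow Y. P S}. {x. {y\<in>Y. x \<in> W y} = S}) \<in> sets M"
    using assms(1) by (intro sets.finite_UN) auto
  moreover have "(\<Union>S\<in>{S\<in>Pow Y. P S}. {x. {y\<in>Y. x \<in> W y} = S}) = {x. P {y\<in>Y. x \<in> W y}}" by auto
  ultimately show ?thesis by simp
qed

context pmp_action
begin

lemma abs_indicator_le_1: "\<bar>indicator A x :: real\<bar> \<le> 1"
  by (simp add: indicator_def)

lemma integrable_indicator_set: "A \<in> sets M \<Longrightarrow> integrable M (indicator A :: 'x \<Rightarrow> real)"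
  by (intro integrable_real_indicator) (auto simp: emeasure_eq_measure)

lemma integrable_indicator_mult:
  assumes "A \<in> sets M" "h \<in> borel_measurable M" "\<And>x. \<bar>h x\<bar> \<le> 1"
  shows "integrable M (\<lambda>x. indicator A x * h x :: real)"
proof (rule integrable_bdd)
  show "(\<lambda>x. indicator A x * h x) \<in> borel_measurable M" using assms by simp
  show "\<bar>indicator A x * h x\<bar> \<le> 1" for x using assms(3)[of x] by (simp add: indicator_def)
qed

lemma ap_indicator_measurable: "A \<in> ap_sets \<Longrightarrow> (indicator A :: 'x \<Rightarrow> real) \<in> borel_measurable ap_algebra"
  by (rule borel_measurable_indicator) (simp add: sets_ap_algebra)

text \<open>
  The conditional probability of \<open>A\<close> given the almost periodic sets. It is clipped so that its bounds hold
  at every point and not only almost surely.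
\<close>

lemma ap_conditional_probability:
  assumes A: "A \<in> sets M"
  obtains b :: "'x \<Rightarrow> real" where "b \<in> borel_measurable ap_algebra" "\<And>x. 0 \<le> b x" "\<And>x. b x \<le> 1"
    "\<And>f c. f \<in> borel_measurable ap_algebra \<Longrightarrow> (\<And>x. \<bar>f x\<bar> \<le> c) \<Longrightarrow>
      (\<integral>x. f x * b x \<partial>M) = (\<integral>x. f x * indicator A x \<partial>M)"
proof -
  interpret S: finite_measure_subalgebra M ap_algebra
    by unfold_locales (rule subalgebra_ap)
  let ?i = "indicator A :: 'x \<Rightarrow> real"
  define e where "e = real_cond_exp M ap_algebra ?i"
  define b where "b = (\<lambda>x. max 0 (min 1 (e x)))"
  have im: "?i \<in> borel_measurable M" "integrable M ?i"
    using A by (auto intro!: integrable_bdd[of _ 1] simp: indicator_def)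
  have em: "e \<in> borel_measurable ap_algebra" by (simp add: e_def)
  then have bm: "b \<in> borel_measurable ap_algebra" unfolding b_def by measurable
  have "AE x in M. e x \<ge> 0" unfolding e_def using im by (intro S.real_cond_exp_ge_c) auto
  moreover have "AE x in M. e x \<le> 1" unfolding e_def using im by (intro S.real_cond_exp_le_c) (auto simp: indicator_def)
  ultimately have be: "AE x in M. b x = e x" by eventually_elim (auto simp: b_def)
  show ?thesis
  proof (rule that[OF bm])
    fix f :: "'x \<Rightarrow> real" and c assume f: "f \<in> borel_measurable ap_algebra" "\<And>x. \<bar>f x\<bar> \<le> c"
    have fM: "f \<in> borel_measurable M" using measurable_from_subalg[OF subalgebra_ap f(1)] .
    have "integrable M (\<lambda>x. f x * ?i x)"
    proof (rule integrable_bdd)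
      show "(\<lambda>x. f x * ?i x) \<in> borel_measurable M" using fM im(1) by simp
      show "\<bar>f x * ?i x\<bar> \<le> c" for x
        using f(2)[of x] order_trans[OF abs_ge_zero f(2)] by (auto simp: indicator_def)
    qed
    then have "(\<integral>x. f x * e x \<partial>M) = (\<integral>x. f x * ?i x \<partial>M)"
      unfolding e_def using f(1) im(1) by (intro S.real_cond_exp_intg(2))
    moreover have "(\<integral>x. f x * b x \<partial>M) = (\<integral>x. f x * e x \<partial>M)"
      using be fM measurable_from_subalg[OF subalgebra_ap bm] measurable_from_subalg[OF subalgebra_ap em]
      by (intro integral_cong_AE) auto
    ultimately show "(\<integral>x. f x * b x \<partial>M) = (\<integral>x. f x * ?i x \<partial>M)" by simp
  qed (auto simp: b_def)
qed

lemma ap_sets_finite_pattern: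
  assumes "finite Y" "\<And>y. y \<in> Y \<Longrightarrow> W y \<in> ap_sets"
  shows "{x. P {y\<in>Y. x \<in> W y}} \<in> ap_sets"
  using sets_finite_pattern[of Y W ap_algebra P] assms by (simp add: sets_ap_algebra space_ap_algebra)

text \<open>
  Off a null set, choose for each point one of the sets \<open>Z y\<close> containing it; this choice only depends on
  almost periodic sets. The points where it conflicts with the sets \<open>V y\<close> form a null set and are
  reassigned: there are at least two disjoint sets \<open>V y\<close>, so every point is missed by one of them. Null
  changes do not affect almost periodicity.
\<close>

lemma ap_partition_from_null_cover:
  fixes V Z :: "'y \<Rightarrow> 'x set"
  assumes Y: "finite Y" "card Y \<ge> 2" and V: "\<And>y. y \<in> Y \<Longrightarrow> V y \<in> sets M"
    and disj: "\<And>y y'. y \<in> Y \<Longrightarrow> y' \<in> Y \<Longrightarrow> y \<noteq> y' \<Longrightarrow> V y \<inter> V y' = {}"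
    and Z: "\<And>y. y \<in> Y \<Longrightarrow> Z y \<in> ap_sets" "measure M (UNIV - (\<Union>y\<in>Y. Z y)) = 0"
      "\<And>y. y \<in> Y \<Longrightarrow> measure M (Z y \<inter> V y) = 0"
  obtains cell where "\<And>x. cell x \<in> Y" "\<And>x. x \<notin> V (cell x)" "\<And>y. {x. cell x = y} \<in> ap_sets"
proof -
  define sel :: "'y set \<Rightarrow> 'y" where "sel = (\<lambda>S. SOME y. y \<in> S)"
  have sel: "sel S \<in> S" if "S \<noteq> {}" for S using that unfolding sel_def by (simp add: some_in_eq)
  define S where "S = (\<lambda>x. {y\<in>Y. x \<in> Z y})"
  define cell where "cell = (\<lambda>x. if S x \<noteq> {} \<and> x \<notin> V (sel (S x)) then sel (S x) else sel {y\<in>Y. x \<notin> V y})"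
  have ne: "{y\<in>Y. x \<notin> V y} \<noteq> {}" for x
  proof
    assume e: "{y\<in>Y. x \<notin> V y} = {}"
    obtain y y' where y: "y \<in> Y" "y' \<in> Y" "y \<noteq> y'" using Y card_le_Suc0_iff_eq[OF Y(1)] by force
    then show False using disj[OF y] e by blast
  qed
  have cY: "cell x \<in> Y" "x \<notin> V (cell x)" for x
    using sel[OF ne[of x]] sel[of "S x"] by (auto simp: cell_def S_def)
  define N where "N = (UNIV - (\<Union>y\<in>Y. Z y)) \<union> (\<Union>y\<in>Y. Z y \<inter> V y)"
  have Zs: "Z y \<in> sets M" if "y \<in> Y" for y using Z(1)[OF that] ap_sets_sub by blast
  have N: "N \<in> null_sets M"
  proof -
    have "UNIV - (\<Union>y\<in>Y. Z y) \<in> null_sets M"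
    proof -
      have "(\<Union>y\<in>Y. Z y) \<in> sets M" using Zs Y by (intro sets.finite_UN) auto
      then have "UNIV - (\<Union>y\<in>Y. Z y) \<in> sets M" using sets.compl_sets space_M by metis
      then show ?thesis using Z(2) by (simp add: null_sets_def emeasure_eq_measure)
    qed
    moreover have "Z y \<inter> V y \<in> null_sets M" if "y \<in> Y" for y
      using Zs V Z(3) that by (auto simp: null_sets_def emeasure_eq_measure)
    ultimately show ?thesis unfolding N_def using Y by (intro null_sets.Un null_sets.finite_UN) auto
  qed
  have cell_off: "cell x = sel (S x) \<and> S x \<noteq> {}" if "x \<notin> N" for x
  proof -
    have "S x \<noteq> {}" using that by (auto simp: N_def S_def)
    moreover from sel[OF this] have "x \<notin> V (sel (S x))" using that by (auto simp: N_def S_def)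
    ultimately show ?thesis by (simp add: cell_def)
  qed
  have "{x. cell x = y} \<in> ap_sets" for y
  proof (rule ap_sets_approx)
    \<comment> \<open>\<open>cell x\<close> is a function of the pattern of memberships of \<open>x\<close> in all the sets \<open>Z y\<close> and \<open>V y\<close>\<close>
    let ?W = "\<lambda>p. if snd p then Z (fst p) else V (fst p)"
    let ?P = "\<lambda>T. let S = {y\<in>Y. (y, True) \<in> T}; R = {y\<in>Y. (y, False) \<notin> T} in
       (if S \<noteq> {} \<and> sel S \<in> R then sel S else sel R) = y"
    have "{x. ?P {p\<in>Y \<times> UNIV. x \<in> ?W p}} \<in> sets M"
      using Y Zs V space_M by (intro sets_finite_pattern) auto
    moreover have "{x. ?P {p\<in>Y \<times> UNIV. x \<in> ?W p}} = {x. cell x = y}"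
    proof (rule Collect_cong)
      fix x
      have 1: "{y\<in>Y. (y, True) \<in> {p\<in>Y \<times> UNIV. x \<in> ?W p}} = S x" by (auto simp: S_def)
      have 2: "{y\<in>Y. (y, False) \<notin> {p\<in>Y \<times> UNIV. x \<in> ?W p}} = {y\<in>Y. x \<notin> V y}" by auto
      have 3: "S x \<noteq> {} \<Longrightarrow> sel (S x) \<in> Y" using sel[of "S x"] by (auto simp: S_def)
      show "?P {p\<in>Y \<times> UNIV. x \<in> ?W p} \<longleftrightarrow> cell x = y"
        unfolding 1 2 Let_def cell_def using 3 by auto
    qed
    ultimately show m: "{x. cell x = y} \<in> sets M" by simp
    let ?B = "{x. sel (S x) = y \<and> S x \<noteq> {}}"
    have B: "?B \<in> ap_sets" unfolding S_def using Y Z(1) by (intro ap_sets_finite_pattern) auto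
    have sub: "({x. cell x = y} - ?B) \<union> (?B - {x. cell x = y}) \<subseteq> N" using cell_off by auto
    have "({x. cell x = y} - ?B) \<union> (?B - {x. cell x = y}) \<in> null_sets M"
      using m B ap_sets_sub by (intro null_sets_subset[OF N _ sub]) auto
    then have "measure M (({x. cell x = y} - ?B) \<union> (?B - {x. cell x = y})) = 0"
      by (simp add: measure_def null_setsD1)
    then show "\<exists>B\<in>ap_sets. measure M (({x. cell x = y} - B) \<union> (B - {x. cell x = y})) \<le> \<epsilon>" if "\<epsilon> > 0" for \<epsilon>
      using B that by (intro bexI[of _ ?B]) auto
  qed
  then show ?thesis using that cY by blast
qed

text \<open>
  Weak mixing produces a group element \<open>s\<close>, but not one under which \<open>E\<close> returns. As \<open>E\<close> is almost
  periodic, its translate by \<open>s\<close> is close to its translate by some \<open>r\<close> from a finite set, so \<open>s r\<^sup>-\<^sup>1\<close> nearly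
  fixes \<open>E\<close>. Weak mixing is applied to all translates of the test sets by such \<open>r\<close> in advance.
\<close>

lemma recurrent_weak_mixing:
  fixes w :: "'j \<Rightarrow> 'x \<Rightarrow> real"
  assumes E: "E \<in> ap_sets" and Gs: "finite \<G>" "\<G> \<subseteq> sets M" and J: "finite J"
    and w: "\<And>j. j \<in> J \<Longrightarrow> w j \<in> borel_measurable M" "\<And>j x. j \<in> J \<Longrightarrow> \<bar>w j x\<bar> \<le> 1"
    and orth: "\<And>j f c. j \<in> J \<Longrightarrow> f \<in> borel_measurable ap_algebra \<Longrightarrow> (\<And>x. \<bar>f x\<bar> \<le> c) \<Longrightarrow> (\<integral>x. f x * w j x \<partial>M) = 0"
    and e: "e > 0"
  shows "\<exists>s\<in>carrier G. measure M (E - \<phi> s -` E) < e \<and>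
    (\<forall>g\<in>\<G>. \<forall>j\<in>J. \<bar>\<integral>x. indicator g x * w j (\<phi> s x) \<partial>M\<bar> < e)"
proof -
  have Em: "E \<in> sets M" using E ap_sets_sub by blast
  obtain \<rho> where \<rho>: "finite (\<rho> ` carrier G)" "\<rho> ` carrier G \<subseteq> carrier G"
    "\<And>s. s \<in> carrier G \<Longrightarrow> orbit_dist (indicator E) s (\<rho> s) < e"
    using totally_bdd_net[of "carrier G" "orbit_dist (indicator E)" e] E e
    unfolding ap_sets_def almost_periodic_def by auto
  let ?G' = "(\<lambda>(r, g). \<phi> r -` g) ` (\<rho> ` carrier G \<times> \<G>)"
  have G': "finite ?G'" "?G' \<subseteq> sets M" using \<rho>(1,2) Gs sets_act by auto
  have "\<exists>s\<in>carrier G. \<forall>g\<in>?G'. \<forall>j\<in>J. \<bar>\<integral>x. indicator g x * w j (\<phi> s x) \<partial>M\<bar> < e"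
    by (rule weak_mixing_over_ap_algebra) (fact G' J w e orth)+
  then obtain s where s: "s \<in> carrier G"
    "\<And>g j. g \<in> ?G' \<Longrightarrow> j \<in> J \<Longrightarrow> \<bar>\<integral>x. indicator g x * w j (\<phi> s x) \<partial>M\<bar> < e" by blast
  define r where "r = \<rho> s"
  have r: "r \<in> carrier G" "r \<in> \<rho> ` carrier G" using \<rho>(2) s(1) by (auto simp: r_def)
  define t where "t = s \<otimes> inv r"
  have ir: "inv r \<in> carrier G" using grp r by simp
  have t: "t \<in> carrier G" using grp s(1) ir unfolding t_def by (simp add: group.is_monoid monoid.m_closed)
  have tx: "\<phi> t (\<phi> r x) = \<phi> s x" for x
    unfolding t_def using act_mult[OF s(1) ir] act_inv[OF r(1)] by simp
  have "measure M (E - \<phi> t -` E) = (\<integral>x. indicator (E - \<phi> t -` E) x \<partial>M)" by (simp add: space_M)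
  also have "\<dots> = (\<integral>x. indicator (E - \<phi> t -` E) (\<phi> r x) \<partial>M)"
    using Em sets_act[OF t Em] r by (intro integral_act[symmetric]) auto
  also have "\<dots> \<le> orbit_dist (indicator E) s r"
    unfolding orbit_dist_def
  proof (rule integral_mono)
    show "integrable M (\<lambda>x. indicator (E - \<phi> t -` E) (\<phi> r x) :: real)"
      using Em sets_act[OF t Em] r by (intro integrable_indicator_act) auto
    show "indicator (E - \<phi> t -` E) (\<phi> r x) \<le> \<bar>indicator E (\<phi> s x) - indicator E (\<phi> r x) :: real\<bar>" for x
      using tx[of x] by (auto simp: indicator_def)
  qed (intro integrable_indicator_diff Em s(1) r(1))
  also have "\<dots> < e" using \<rho>(3)[OF s(1)] by (simp add: r_def)
  finally have 1: "measure M (E - \<phi> t -` E) < e" .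
  have 2: "\<bar>\<integral>x. indicator g x * w j (\<phi> t x) \<partial>M\<bar> < e" if gj: "g \<in> \<G>" "j \<in> J" for g j
  proof -
    have "(\<integral>x. indicator g x * w j (\<phi> t x) \<partial>M) = (\<integral>x. indicator g (\<phi> r x) * w j (\<phi> t (\<phi> r x)) \<partial>M)"
      using integral_act[OF r(1), of "\<lambda>x. indicator g x * w j (\<phi> t x)"] measurable_act[OF w(1)[OF gj(2)] t] gj(1) Gs
      by (simp add: subset_eq)
    also have "\<dots> = (\<integral>x. indicator (\<phi> r -` g) x * w j (\<phi> s x) \<partial>M)"
      unfolding tx by (simp add: indicator_def)
    also have "\<bar>\<dots>\<bar> < e" using gj r by (intro s(2)) auto
    finally show ?thesis .
  qed
  show ?thesis using t 1 2 by blast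
qed

text \<open>
  Choose the elements successively. With \<open>g\<close> the part of \<open>E\<close> missed so far and \<open>V\<close> the set to be used next,
  the measure of \<open>g \<inter> s\<^sup>-\<^sup>1 V\<close> is, by weak mixing, up to an error the integral over \<open>g\<close> of the translated
  conditional probability of \<open>V\<close>. The latter is at least \<open>\<eta>\<close> on \<open>s\<^sup>-\<^sup>1 E\<close>, which contains almost all of
  \<open>E\<close>. The missed part thus shrinks by a factor close to \<open>1 - \<eta>\<close>; stating \<open>1 - \<eta> / 2\<close> leaves room
  for the errors.
\<close>

lemma finite_independent_translates:
  fixes V :: "'y \<Rightarrow> 'x set" and b :: "'y \<Rightarrow> 'x \<Rightarrow> real"
  assumes Y: "finite Y" "card Y \<ge> 2" and V: "\<And>y. y \<in> Y \<Longrightarrow> V y \<in> sets M"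
    and disj: "\<And>y y'. y \<in> Y \<Longrightarrow> y' \<in> Y \<Longrightarrow> y \<noteq> y' \<Longrightarrow> V y \<inter> V y' = {}"
    and b: "\<And>y. y \<in> Y \<Longrightarrow> b y \<in> borel_measurable ap_algebra" "\<And>y x. y \<in> Y \<Longrightarrow> 0 \<le> b y x"
      "\<And>y x. y \<in> Y \<Longrightarrow> b y x \<le> 1"
      "\<And>y f c. y \<in> Y \<Longrightarrow> f \<in> borel_measurable ap_algebra \<Longrightarrow> (\<And>x. \<bar>f x\<bar> \<le> c) \<Longrightarrow>
        (\<integral>x. f x * b y x \<partial>M) = (\<integral>x. f x * indicator (V y) x \<partial>M)"
    and E: "E \<in> ap_sets" "measure M E > 0" "\<And>x y. x \<in> E \<Longrightarrow> y \<in> Y \<Longrightarrow> \<eta> \<le> b y x" and \<eta>: "\<eta> > 0" "\<eta> \<le> 1"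
  shows "\<exists>F. finite F \<and> F \<subseteq> carrier G \<and> card F = n \<and> (\<forall>T\<subseteq>F. \<forall>\<tau>\<in>T \<rightarrow> Y.
      measure M (E - (\<Union>s\<in>T. \<phi> s -` V (\<tau> s))) \<le> (1 - \<eta> / 2) ^ card T)"
proof (induction n)
  case 0
  then show ?case by (intro exI[of _ "{}"]) (auto simp: card_eq_0_iff)
next
  case (Suc n)
  then obtain F where F: "finite F" "F \<subseteq> carrier G" "card F = n"
    "\<And>T \<tau>. T \<subseteq> F \<Longrightarrow> \<tau> \<in> T \<rightarrow> Y \<Longrightarrow> measure M (E - (\<Union>s\<in>T. \<phi> s -` V (\<tau> s))) \<le> (1 - \<eta> / 2) ^ card T"
    by metis
  have Em: "E \<in> sets M" using E(1) ap_sets_sub by blast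
  have bM: "b y \<in> borel_measurable M" if "y \<in> Y" for y using measurable_from_subalg[OF subalgebra_ap b(1)[OF that]] .
  have bb: "\<bar>b y x\<bar> \<le> 1" if "y \<in> Y" for y x using b(2,3)[OF that, of x] by simp
  define w where "w = (\<lambda>y x. indicator (V y) x - b y x)"
  have wm: "w y \<in> borel_measurable M" if "y \<in> Y" for y using bM[OF that] V[OF that] by (simp add: w_def)
  have wb: "\<bar>w y x\<bar> \<le> 1" if "y \<in> Y" for y x using b(2,3)[OF that, of x] by (auto simp: w_def indicator_def)
  have int_prod: "integrable M (\<lambda>x. f x * h x)"
    if "f \<in> borel_measurable M" "\<And>x. \<bar>f x\<bar> \<le> c" "h \<in> borel_measurable M" "\<And>x. \<bar>h x\<bar> \<le> 1" for f h :: "'x \<Rightarrow> real" and c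
  proof (rule integrable_bdd)
    show "\<bar>f x * h x\<bar> \<le> c" for x
      using mult_mono[OF that(2)[of x] that(4)[of x]] that(2)[of x] by (simp add: abs_mult)
  qed (use that in auto)
  have orth: "(\<integral>x. f x * w y x \<partial>M) = 0"
    if y: "y \<in> Y" and f: "f \<in> borel_measurable ap_algebra" "\<And>x. \<bar>f x\<bar> \<le> c" for y f c
  proof -
    have fM: "f \<in> borel_measurable M" using measurable_from_subalg[OF subalgebra_ap f(1)] .
    have "integrable M (\<lambda>x. f x * b y x)" using fM f(2) bM[OF y] b(2,3)[OF y] by (intro int_prod) auto
    moreover have "integrable M (\<lambda>x. f x * indicator (V y) x)"
      using fM f(2) V[OF y] by (intro int_prod) (auto simp: abs_indicator_le_1)
    ultimately show ?thesis using b(4)[OF y f] by (simp add: w_def right_diff_distrib)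
  qed
  obtain y0 y1 where y01: "y0 \<in> Y" "y1 \<in> Y" "y0 \<noteq> y1" using Y card_le_Suc0_iff_eq[OF Y(1)] by force
  define mis where "mis = (\<lambda>(T, \<tau>). E - (\<Union>s\<in>T. \<phi> s -` V (\<tau> s)))"
  \<comment> \<open>the second kind of test sets serves to make the new element distinct from the earlier ones\<close>
  define \<G> where "\<G> = mis ` (Sigma (Pow F) (\<lambda>T. T \<rightarrow>\<^sub>E Y)) \<union> (\<lambda>r. \<phi> r -` (E \<inter> V y1)) ` F"
  have mis_m: "mis (T, \<tau>) \<in> sets M" if "T \<subseteq> F" "\<tau> \<in> T \<rightarrow> Y" for T \<tau>
  proof -
    have "(\<Union>s\<in>T. \<phi> s -` V (\<tau> s)) \<in> sets M"
    proof (intro sets.finite_UN)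
      show "finite T" using that(1) F(1) by (rule finite_subset)
      fix s assume "s \<in> T"
      then show "\<phi> s -` V (\<tau> s) \<in> sets M" using that F(2) by (intro sets_act V) auto
    qed
    then show ?thesis unfolding mis_def using Em by auto
  qed
  have "finite (Sigma (Pow F) (\<lambda>T. T \<rightarrow>\<^sub>E Y))"
  proof (intro finite_SigmaI finite_PiE)
    fix T assume "T \<in> Pow F"
    then show "finite T" using F(1) finite_subset by blast
  qed (use F(1) Y(1) in auto)
  then have Gf: "finite \<G>" unfolding \<G>_def using F(1) by blast
  have Gm: "\<G> \<subseteq> sets M"
  proof -
    have "\<phi> r -` (E \<inter> V y1) \<in> sets M" if "r \<in> F" for r
      using that F(2) Em V y01 by (intro sets_act) auto
    moreover have "mis p \<in> sets M" if "p \<in> Sigma (Pow F) (\<lambda>T. T \<rightarrow>\<^sub>E Y)" for p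
      using that mis_m by (auto simp: PiE_def)
    ultimately show ?thesis unfolding \<G>_def by blast
  qed
  define e where "e = min (\<eta> / 4 * (1 - \<eta> / 2) ^ n) (\<eta>^2 * measure M E / 2)"
  have e: "e > 0" "2 * e \<le> \<eta> / 2 * (1 - \<eta> / 2) ^ n" "e < \<eta>^2 * measure M E"
  proof -
    have "0 < \<eta>^2 * measure M E" using \<eta> E(2) by simp
    moreover have "e \<le> \<eta>^2 * measure M E / 2" unfolding e_def by simp
    ultimately show "e < \<eta>^2 * measure M E" by linarith
    show "e > 0" unfolding e_def using \<eta> E(2) by simp
    have "e \<le> \<eta> / 4 * (1 - \<eta> / 2) ^ n" unfolding e_def by simp
    then show "2 * e \<le> \<eta> / 2 * (1 - \<eta> / 2) ^ n" by simp
  qed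
  have "\<exists>s\<in>carrier G. measure M (E - \<phi> s -` E) < e \<and>
      (\<forall>g\<in>\<G>. \<forall>y\<in>Y. \<bar>\<integral>x. indicator g x * w y (\<phi> s x) \<partial>M\<bar> < e)"
    by (rule recurrent_weak_mixing) (fact E Gf Gm Y wm wb e orth)+
  then obtain s where s: "s \<in> carrier G" "measure M (E - \<phi> s -` E) < e"
    "\<And>g y. g \<in> \<G> \<Longrightarrow> y \<in> Y \<Longrightarrow> \<bar>\<integral>x. indicator g x * w y (\<phi> s x) \<partial>M\<bar> < e"
    by blast
  \<comment> \<open>for \<open>s \<in> F\<close> the test set \<open>s\<^sup>-\<^sup>1 (E \<inter> V y1)\<close> correlates with \<open>w y0\<close>, which equals \<open>- b y0 \<le> - \<eta>\<close> on \<open>E \<inter> V y1\<close>\<close>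
  have "s \<notin> F"
  proof
    assume sF: "s \<in> F"
    let ?g = "\<phi> s -` (E \<inter> V y1)"
    let ?f = "\<lambda>x. indicator (E \<inter> V y1) x * w y0 x :: real"
    have EV: "E \<inter> V y1 \<in> sets M" using Em V y01 by auto
    have "(\<integral>x. indicator ?g x * w y0 (\<phi> s x) \<partial>M) = (\<integral>x. ?f (\<phi> s x) \<partial>M)" by (simp add: indicator_def)
    also have "\<dots> = (\<integral>x. ?f x \<partial>M)"
      using EV wm[OF y01(1)] by (intro integral_act[OF s(1)]) auto
    also have "\<dots> \<le> (\<integral>x. - \<eta> * indicator (E \<inter> V y1) x \<partial>M)"
    proof (rule integral_mono)
      show "integrable M ?f"
        by (rule integrable_indicator_mult[OF EV wm[OF y01(1)] wb[OF y01(1)]])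
      show "integrable M (\<lambda>x. - \<eta> * indicator (E \<inter> V y1) x)"
        using EV by (intro integrable_mult_right integrable_indicator_set) auto
      show "?f x \<le> - \<eta> * indicator (E \<inter> V y1) x" for x
        using disj[OF y01] E(3)[of x y0] y01 by (auto simp: w_def indicator_def)
    qed
    also have "\<dots> = - \<eta> * measure M (E \<inter> V y1)" using space_M by simp
    also have "measure M (E \<inter> V y1) = (\<integral>x. indicator E x * indicator (V y1) x \<partial>M)"
      using space_M by (simp add: indicator_inter_arith[symmetric])
    also have "\<dots> = (\<integral>x. indicator E x * b y1 x \<partial>M)"
      by (rule b(4)[OF y01(2) ap_indicator_measurable[OF E(1)] abs_indicator_le_1, symmetric])
    also have "- \<eta> * \<dots> \<le> - \<eta> * (\<eta> * measure M E)"
    proof -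
      have "\<eta> * measure M E = (\<integral>x. \<eta> * indicator E x \<partial>M)" using space_M by simp
      also have "\<dots> \<le> (\<integral>x. indicator E x * b y1 x \<partial>M)"
      proof (rule integral_mono)
        show "integrable M (\<lambda>x. \<eta> * indicator E x)"
          using Em by (intro integrable_mult_right integrable_indicator_set) auto
        show "integrable M (\<lambda>x. indicator E x * b y1 x)"
          by (rule integrable_indicator_mult[OF Em bM[OF y01(2)] bb[OF y01(2)]])
        show "\<eta> * indicator E x \<le> indicator E x * b y1 x" for x
          using E(3)[of x y1] y01 by (auto simp: indicator_def)
      qed
      finally show ?thesis using \<eta> by simp
    qed
    finally have "(\<integral>x. indicator ?g x * w y0 (\<phi> s x) \<partial>M) \<le> - (\<eta>^2 * measure M E)"
      by (simp add: power2_eq_square)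
    moreover have "?g \<in> \<G>" using sF by (auto simp: \<G>_def)
    ultimately show False using s(3)[of ?g y0] y01 e(3) by linarith
  qed
  have step: "measure M (E - (\<Union>r\<in>T. \<phi> r -` V (\<tau> r))) \<le> (1 - \<eta> / 2) ^ card T"
    if T: "T \<subseteq> insert s F" "\<tau> \<in> T \<rightarrow> Y" for T \<tau>
  proof (cases "s \<in> T")
    case False
    then show ?thesis using T by (intro F(4)) auto
  next
    case True
    define T0 where "T0 = T - {s}"
    have T0: "T0 \<subseteq> F" "\<tau> \<in> T0 \<rightarrow> Y" "T = insert s T0" "s \<notin> T0" "finite T0" "\<tau> s \<in> Y"
      using T True finite_subset[of T0 F] F(1) by (auto simp: T0_def)
    define g where "g = mis (T0, restrict \<tau> T0)"
    have g_eq: "g = E - (\<Union>r\<in>T0. \<phi> r -` V (\<tau> r))" by (simp add: g_def mis_def)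
    have gG: "g \<in> \<G>" unfolding \<G>_def g_def using T0 by (intro UnI1 imageI) auto
    have gm: "g \<in> sets M" using Gm gG by blast
    have card_le: "card T0 \<le> n" using T0 F card_mono by metis
    let ?V = "\<phi> s -` V (\<tau> s)"
    have Vm: "?V \<in> sets M" using V T0 s by (intro sets_act) auto
    have ws: "(\<lambda>x. w (\<tau> s) (\<phi> s x)) \<in> borel_measurable M" using measurable_act[OF wm[OF T0(6)] s(1)] .
    have bs: "(\<lambda>x. b (\<tau> s) (\<phi> s x)) \<in> borel_measurable M" using measurable_act[OF bM[OF T0(6)] s(1)] .
    have i1: "integrable M (\<lambda>x. indicator g x * w (\<tau> s) (\<phi> s x))"
      by (rule integrable_indicator_mult[OF gm ws wb[OF T0(6)]])
    have i2: "integrable M (\<lambda>x. indicator g x * b (\<tau> s) (\<phi> s x))"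
      by (rule integrable_indicator_mult[OF gm bs bb[OF T0(6)]])
    have "measure M (g \<inter> ?V) = (\<integral>x. indicator g x * w (\<tau> s) (\<phi> s x) + indicator g x * b (\<tau> s) (\<phi> s x) \<partial>M)"
    proof -
      have "measure M (g \<inter> ?V) = (\<integral>x. indicator (g \<inter> ?V) x \<partial>M)" using space_M by simp
      also have "\<dots> = (\<integral>x. indicator g x * w (\<tau> s) (\<phi> s x) + indicator g x * b (\<tau> s) (\<phi> s x) \<partial>M)"
        by (intro Bochner_Integration.integral_cong) (auto simp: w_def indicator_def)
      finally show ?thesis .
    qed
    also have "\<dots> = (\<integral>x. indicator g x * w (\<tau> s) (\<phi> s x) \<partial>M) + (\<integral>x. indicator g x * b (\<tau> s) (\<phi> s x) \<partial>M)"
      using i1 i2 by simp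
    finally have 1: "measure M (g \<inter> ?V) \<ge> (\<integral>x. indicator g x * b (\<tau> s) (\<phi> s x) \<partial>M) - e"
      using s(3)[OF gG T0(6)] by linarith
    have Es: "\<phi> s -` E \<in> sets M" using sets_act[OF s(1) Em] .
    have "\<eta> * measure M (g \<inter> \<phi> s -` E) = (\<integral>x. \<eta> * indicator (g \<inter> \<phi> s -` E) x \<partial>M)" using space_M by simp
    also have "\<dots> \<le> (\<integral>x. indicator g x * b (\<tau> s) (\<phi> s x) \<partial>M)"
    proof (rule integral_mono[OF _ i2])
      show "integrable M (\<lambda>x. \<eta> * indicator (g \<inter> \<phi> s -` E) x)"
        using gm Es by (intro integrable_mult_right integrable_indicator_set) auto
      show "\<eta> * indicator (g \<inter> \<phi> s -` E) x \<le> indicator g x * b (\<tau> s) (\<phi> s x)" for x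
        using E(3)[of "\<phi> s x" "\<tau> s"] b(2)[OF T0(6)] T0(6) by (auto simp: indicator_def)
    qed
    finally have 2: "\<eta> * measure M (g \<inter> \<phi> s -` E) \<le> (\<integral>x. indicator g x * b (\<tau> s) (\<phi> s x) \<partial>M)" .
    have "measure M g = measure M (g \<inter> \<phi> s -` E) + measure M (g - \<phi> s -` E)"
      using finite_measure_Diff'[OF gm Es] by simp
    moreover have "measure M (g - \<phi> s -` E) \<le> measure M (E - \<phi> s -` E)"
      using Em Es g_eq by (intro finite_measure_mono) auto
    ultimately have 3: "measure M (g \<inter> \<phi> s -` E) \<ge> measure M g - e" using s(2) by linarith
    have "E - (\<Union>r\<in>T. \<phi> r -` V (\<tau> r)) = g - ?V" unfolding g_eq T0(3) by auto
    then have "measure M (E - (\<Union>r\<in>T. \<phi> r -` V (\<tau> r))) = measure M g - measure M (g \<inter> ?V)"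
      using finite_measure_Diff'[OF gm Vm] by simp
    also have "\<dots> \<le> measure M g - \<eta> * (measure M g - e) + e"
      using 1 2 mult_left_mono[OF 3, of \<eta>] \<eta> by linarith
    also have "\<dots> = (1 - \<eta>) * measure M g + \<eta> * e + e" by (simp add: algebra_simps)
    also have "\<dots> \<le> (1 - \<eta>) * measure M g + 2 * e"
      using \<eta> e(1) mult_right_mono[of \<eta> 1 e] by simp
    also have "\<dots> \<le> (1 - \<eta>) * (1 - \<eta> / 2) ^ card T0 + \<eta> / 2 * (1 - \<eta> / 2) ^ card T0"
    proof (rule add_mono)
      show "(1 - \<eta>) * measure M g \<le> (1 - \<eta>) * (1 - \<eta> / 2) ^ card T0"
        unfolding g_eq using \<eta> T0 by (intro mult_left_mono F(4)) auto
      have "(1 - \<eta> / 2) ^ n \<le> (1 - \<eta> / 2) ^ card T0" using card_le \<eta> by (intro power_decreasing) auto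
      then show "2 * e \<le> \<eta> / 2 * (1 - \<eta> / 2) ^ card T0"
        using e(2) \<eta> mult_left_mono[of "(1 - \<eta> / 2) ^ n" "(1 - \<eta> / 2) ^ card T0" "\<eta> / 2"] by linarith
    qed
    also have "\<dots> = (1 - \<eta> / 2) ^ card T"
      unfolding T0(3) using T0(4,5) by (simp add: algebra_simps)
    finally show ?thesis .
  qed
  show ?case
    using F \<open>s \<notin> F\<close> s(1) step by (intro exI[of _ "insert s F"]) auto
qed


text \<open>
  If the conditional probabilities \<open>b y\<close> had product zero almost everywhere, their zero sets would give an
  almost periodic partition. So they are simultaneously at least \<open>\<eta>\<close> on a set \<open>E0\<close> of positive measure, to
  which the previous lemma applies. Given sets \<open>D s\<close> of large measure, most points of \<open>E0\<close> lie in all but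
  a small proportion of them. For these points, a box for the sets \<open>D s \<inter> s\<^sup>-\<^sup>1 V y\<close> is covered by the
  parts of \<open>E0\<close> missed along large subsets of \<open>F\<close>; as there are not too many such subsets, boxes
  are exponentially small and a set of linear size is shattered.
\<close>

theorem independence_unless_ap_partition:
  fixes V :: "'y \<Rightarrow> 'x set"
  assumes Y: "finite Y" "card Y \<ge> 2" and V: "\<And>y. y \<in> Y \<Longrightarrow> V y \<in> sets M"
    and disj: "\<And>y y'. y \<in> Y \<Longrightarrow> y' \<in> Y \<Longrightarrow> y \<noteq> y' \<Longrightarrow> V y \<inter> V y' = {}"
    and no_partition: "\<And>cell. (\<And>x. cell x \<in> Y) \<Longrightarrow> (\<And>x. x \<notin> V (cell x)) \<Longrightarrow>
      (\<And>y. {x. cell x = y} \<in> ap_sets) \<Longrightarrow> False"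
  shows "\<exists>\<delta>>0. \<exists>c>0. \<forall>n0. \<exists>F. finite F \<and> F \<subseteq> carrier G \<and> card F \<ge> n0 \<and>
    (\<forall>D. (\<forall>s\<in>F. D s \<in> sets M \<and> measure M (D s) \<ge> 1 - \<delta>) \<longrightarrow>
      (\<exists>I\<subseteq>F. (\<forall>\<sigma>\<in>I \<rightarrow> Y. (\<Inter>s\<in>I. D s \<inter> \<phi> s -` V (\<sigma> s)) \<noteq> {}) \<and> real (card I) \<ge> c * real (card F)))"
proof -
  have "\<forall>y\<in>Y. \<exists>b :: 'x \<Rightarrow> real. b \<in> borel_measurable ap_algebra \<and> (\<forall>x. 0 \<le> b x) \<and> (\<forall>x. b x \<le> 1) \<and>
    (\<forall>f c. f \<in> borel_measurable ap_algebra \<longrightarrow> (\<forall>x. \<bar>f x\<bar> \<le> c) \<longrightarrow>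
      (\<integral>x. f x * b x \<partial>M) = (\<integral>x. f x * indicator (V y) x \<partial>M))"
  proof
    fix y assume "y \<in> Y"
    show "\<exists>b :: 'x \<Rightarrow> real. b \<in> borel_measurable ap_algebra \<and> (\<forall>x. 0 \<le> b x) \<and> (\<forall>x. b x \<le> 1) \<and>
      (\<forall>f c. f \<in> borel_measurable ap_algebra \<longrightarrow> (\<forall>x. \<bar>f x\<bar> \<le> c) \<longrightarrow>
        (\<integral>x. f x * b x \<partial>M) = (\<integral>x. f x * indicator (V y) x \<partial>M))"
    proof (rule ap_conditional_probability[OF V[OF \<open>y \<in> Y\<close>]])
      fix b :: "'x \<Rightarrow> real"
      assume b: "b \<in> borel_measurable ap_algebra" "\<And>x. 0 \<le> b x" "\<And>x. b x \<le> 1" and b_int: "\<And>f c. f \<in> borel_measurable ap_algebra \<Longrightarrow> (\<And>x. \<bar>f x\<bar> \<le> c) \<Longrightarrow>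
        (\<integral>x. f x * b x \<partial>M) = (\<integral>x. f x * indicator (V y) x \<partial>M)"
      show ?thesis
        by (intro exI[of _ b] conjI allI impI) (fact b | (rule b_int, assumption, erule spec))+
    qed
  qed
  from bchoice[OF this] obtain b :: "'y \<Rightarrow> 'x \<Rightarrow> real" where
    b: "\<And>y. y \<in> Y \<Longrightarrow> b y \<in> borel_measurable ap_algebra" "\<And>y x. y \<in> Y \<Longrightarrow> 0 \<le> b y x"
      "\<And>y x. y \<in> Y \<Longrightarrow> b y x \<le> 1" and
    b_int: "\<And>y f c. y \<in> Y \<Longrightarrow> f \<in> borel_measurable ap_algebra \<Longrightarrow> (\<And>x. \<bar>f x\<bar> \<le> c) \<Longrightarrow>
        (\<integral>x. f x * b y x \<partial>M) = (\<integral>x. f x * indicator (V y) x \<partial>M)"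
    by blast
  have Yne: "Y \<noteq> {}" using Y by auto
  define E where "E = (\<lambda>\<eta>. {x. \<forall>y\<in>Y. \<eta> \<le> b y x})"
  have lev: "{x. b y x \<in> S} \<in> ap_sets" if "y \<in> Y" "S \<in> sets borel" for y S
    using measurable_sets[OF b(1)[OF that(1)] that(2)] by (simp add: vimage_def sets_ap_algebra space_ap_algebra)
  have E_ap: "E \<eta> \<in> ap_sets" for \<eta>
  proof -
    have "{x. {y\<in>Y. x \<in> {x. \<eta> \<le> b y x}} = Y} \<in> ap_sets"
      using Y lev[of _ "{\<eta>..}"] by (intro ap_sets_finite_pattern[where P = "\<lambda>S. S = Y"]) auto
    moreover have "{x. {y\<in>Y. x \<in> {x. \<eta> \<le> b y x}} = Y} = E \<eta>" by (auto simp: E_def)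
    ultimately show ?thesis by simp
  qed
  have "\<exists>n. measure M (E (1 / Suc n)) > 0"
  proof (rule ccontr)
    assume "\<not> ?thesis"
    then have z: "measure M (E (1 / Suc n)) = 0" for n by (simp add: not_less measure_le_0_iff)
    have En: "E (1 / Suc n) \<in> null_sets M" for n
      using z[of n] E_ap[of "1 / Suc n"] ap_sets_sub by (auto simp: null_sets_def emeasure_eq_measure)
    have cov: "UNIV - (\<Union>y\<in>Y. {x. b y x = 0}) \<subseteq> (\<Union>n. E (1 / Suc n))"
    proof
      fix x assume "x \<in> UNIV - (\<Union>y\<in>Y. {x. b y x = 0})"
      then have pos: "\<forall>y\<in>Y. 0 < b y x" using b(2) by (auto simp: less_le)
      define m where "m = Min ((\<lambda>y. b y x) ` Y)"
      have "m > 0" unfolding m_def using Y Yne pos by (subst Min_gr_iff) auto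
      then obtain n where n: "inverse (real (Suc n)) < m" using reals_Archimedean by blast
      have "m \<le> b y x" if "y \<in> Y" for y unfolding m_def using Y that by (intro Min_le) auto
      then have "x \<in> E (1 / Suc n)" using n by (force simp: E_def inverse_eq_divide)
      then show "x \<in> (\<Union>n. E (1 / Suc n))" by blast
    qed
    have Zap: "{x. b y x = 0} \<in> ap_sets" if "y \<in> Y" for y using lev[OF that, of "{0}"] by simp
    have "(\<Union>n. E (1 / Suc n)) \<in> null_sets M" using En by (intro null_sets_UN) auto
    moreover have "UNIV - (\<Union>y\<in>Y. {x. b y x = 0}) \<in> sets M"
    proof -
      have "(\<Union>y\<in>Y. {x. b y x = 0}) \<in> sets M" using Zap ap_sets_sub Y by (intro sets.finite_UN) auto
      then show ?thesis using sets.compl_sets space_M by metis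
    qed
    ultimately have "UNIV - (\<Union>y\<in>Y. {x. b y x = 0}) \<in> null_sets M" using null_sets_subset cov by blast
    then have Z2: "measure M (UNIV - (\<Union>y\<in>Y. {x. b y x = 0})) = 0" by (simp add: measure_def null_setsD1)
    have Z3: "measure M ({x. b y x = 0} \<inter> V y) = 0" if y: "y \<in> Y" for y
    proof -
      have "measure M ({x. b y x = 0} \<inter> V y) = (\<integral>x. indicator {x. b y x = 0} x * indicator (V y) x \<partial>M)"
        using space_M by (simp add: indicator_inter_arith[symmetric])
      also have "\<dots> = (\<integral>x. indicator {x. b y x = 0} x * b y x \<partial>M)"
        by (rule b_int[OF y ap_indicator_measurable[OF Zap[OF y]] abs_indicator_le_1, symmetric])
      also have "\<dots> = (\<integral>x. 0 \<partial>M)" by (intro Bochner_Integration.integral_cong) (auto simp: indicator_def)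
      finally show ?thesis by simp
    qed
    show False
      by (rule ap_partition_from_null_cover[where Y = Y and V = V and Z = "\<lambda>y. {x. b y x = 0}"])
        (fact Y V disj Zap Z2 Z3 | (erule no_partition; assumption))+
  qed
  then obtain n1 where n1: "measure M (E (1 / Suc n1)) > 0" by blast
  define \<eta> where "\<eta> = 1 / real (Suc n1)"
  have \<eta>: "\<eta> > 0" "\<eta> \<le> 1" by (auto simp: \<eta>_def)
  define E0 where "E0 = E \<eta>"
  have E0: "E0 \<in> ap_sets" "measure M E0 > 0" "\<And>x y. x \<in> E0 \<Longrightarrow> y \<in> Y \<Longrightarrow> \<eta> \<le> b y x"
    using n1 E_ap by (auto simp: E0_def \<eta>_def E_def)
  have E0m: "E0 \<in> sets M" using E0(1) ap_sets_sub by blast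
  \<comment> \<open>the sum of \<open>(1 - \<eta> / 2)\<^bsup>|T|\<^esup> \<theta>\<^bsup>|F - T|\<^esup>\<close> over all \<open>T \<subseteq> F\<close> is \<open>(1 - \<eta> / 4)\<^bsup>|F|\<^esup> = \<rho>\<^bsup>2|F|\<^esup>\<close>\<close>
  define \<theta> where "\<theta> = \<eta> / 4"
  define \<rho> where "\<rho> = sqrt (1 - \<eta> / 4)"
  have \<theta>: "0 < \<theta>" "\<theta> < 1" using \<eta> by (auto simp: \<theta>_def)
  have \<rho>: "0 < \<rho>" "\<rho> < 1" "\<rho> * \<rho> = 1 - \<eta> / 4" using \<eta> by (auto simp: \<rho>_def)
  \<comment> \<open>the tolerated proportion of exceptions, chosen so that restricting to \<open>|F - T| \<le> \<alpha> |F|\<close> costs at most \<open>\<rho>\<^bsup>-|F|\<^esup>\<close>\<close>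
  define \<alpha> where "\<alpha> = ln \<rho> / ln \<theta>"
  have \<alpha>: "\<alpha> > 0" "\<theta> powr (- \<alpha>) = 1 / \<rho>"
  proof -
    have l: "ln \<rho> < 0" "ln \<theta> < 0" using \<rho> \<theta> by auto
    then show "\<alpha> > 0" unfolding \<alpha>_def by (rule divide_neg_neg)
    have "\<theta> powr (- \<alpha>) = exp (- ln \<rho>)" using l \<theta> by (simp add: powr_def \<alpha>_def)
    then show "\<theta> powr (- \<alpha>) = 1 / \<rho>" using \<rho> by (simp add: exp_minus inverse_eq_divide)
  qed
  define \<delta> where "\<delta> = \<alpha> * measure M E0 / 2"
  have \<delta>: "\<delta> > 0" using \<alpha> E0 by (simp add: \<delta>_def)
  have m0: "measure M E0 / 2 > 0" using E0 by simp
  obtain c N where cN: "c > 0" "\<forall>(A :: 'g \<Rightarrow> 'y \<Rightarrow> 'x set) Y' Z Q.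
     finite Z \<and> card Z \<ge> N \<and> finite Y' \<and> card Y' = card Y \<and> (\<forall>i\<in>Z. \<forall>y\<in>Y'. A i y \<in> sets M) \<and>
     (\<forall>i\<in>Z. \<forall>y\<in>Y'. \<forall>y'\<in>Y'. y \<noteq> y' \<longrightarrow> A i y \<inter> A i y' = {}) \<and> Q \<in> sets M \<and> measure M Q \<ge> measure M E0 / 2 \<and>
     (\<forall>\<tau>\<in>Z \<rightarrow> Y'. measure M (Q - (\<Union>i\<in>Z. A i (\<tau> i))) \<le> \<rho> ^ card Z) \<longrightarrow>
     (\<exists>I\<subseteq>Z. shatters A Y' Q I \<and> real (card I) \<ge> c * real (card Z))"
    using linear_size_shattered_set[OF Y(2) \<rho>(1,2) m0] by (elim exE conjE) (rule that)
  have main: "\<exists>I\<subseteq>F. (\<forall>\<sigma>\<in>I \<rightarrow> Y. (\<Inter>s\<in>I. D s \<inter> \<phi> s -` V (\<sigma> s)) \<noteq> {}) \<and> real (card I) \<ge> c * real (card F)"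
    if F: "finite F" "F \<subseteq> carrier G" "card F = max n0 (max N 1)"
      "\<And>T \<tau>. T \<subseteq> F \<Longrightarrow> \<tau> \<in> T \<rightarrow> Y \<Longrightarrow> measure M (E0 - (\<Union>s\<in>T. \<phi> s -` V (\<tau> s))) \<le> (1 - \<eta> / 2) ^ card T"
      and D: "\<And>s. s \<in> F \<Longrightarrow> D s \<in> sets M" "\<And>s. s \<in> F \<Longrightarrow> measure M (D s) \<ge> 1 - \<delta>" for F D n0
  proof -
    define n where "n = real (card F)"
    have n: "n > 0" "card F \<ge> N" using F(3) by (auto simp: n_def)
    define good where "good = (\<lambda>x. {s\<in>F. x \<in> D s})"
    define Bad where "Bad = {x. real (card (F - good x)) > \<alpha> * n}"
    have Bm: "Bad \<in> sets M" unfolding Bad_def good_def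
      using F(1) D(1) space_M by (intro sets_finite_pattern[where P = "\<lambda>S. real (card (F - S)) > \<alpha> * n"])
    have cD: "UNIV - D s \<in> sets M" if "s \<in> F" for s using D(1)[OF that] sets.compl_sets space_M by metis
    \<comment> \<open>Markov's inequality for the number of translates whose set \<open>D\<close> misses the point\<close>
    have "\<alpha> * n * measure M Bad = (\<integral>x. \<alpha> * n * indicator Bad x \<partial>M)" using space_M by simp
    also have "\<dots> \<le> (\<integral>x. (\<Sum>s\<in>F. indicator (UNIV - D s) x) \<partial>M)"
    proof (rule integral_mono)
      show "integrable M (\<lambda>x. \<alpha> * n * indicator Bad x)"
        using Bm by (intro integrable_mult_right integrable_indicator_set) auto
      show "integrable M (\<lambda>x. \<Sum>s\<in>F. indicator (UNIV - D s) x :: real)"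
        using cD by (intro Bochner_Integration.integrable_sum integrable_indicator_set) auto
      fix x
      have "(\<Sum>s\<in>F. indicator (UNIV - D s) x :: real) = (\<Sum>s\<in>F. if s \<in> F - good x then 1 else 0)"
        by (intro sum.cong) (auto simp: good_def indicator_def)
      also have "\<dots> = real (card (F - good x))"
        using F(1) by (simp add: sum.If_cases Int_Diff[symmetric] Int_absorb2 Diff_subset del: Diff_iff)
      finally show "\<alpha> * n * indicator Bad x \<le> (\<Sum>s\<in>F. indicator (UNIV - D s) x)"
        by (auto simp: Bad_def indicator_def)
    qed
    also have "\<dots> = (\<Sum>s\<in>F. measure M (UNIV - D s))"
      using cD space_M by (subst Bochner_Integration.integral_sum) (auto intro!: integrable_indicator_set)
    also have "\<dots> \<le> (\<Sum>s\<in>F. \<delta>)"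
    proof (rule sum_mono)
      fix s assume "s \<in> F"
      then show "measure M (UNIV - D s) \<le> \<delta>" using prob_compl[OF D(1)[of s]] D(2)[of s] space_M by simp
    qed
    also have "\<dots> = n * (\<alpha> * (measure M E0 / 2))" by (simp add: n_def \<delta>_def)
    finally have "(\<alpha> * n) * measure M Bad \<le> (\<alpha> * n) * (measure M E0 / 2)" by (simp add: mult_ac)
    then have bad: "measure M Bad \<le> measure M E0 / 2"
      using \<alpha> n mult_le_cancel_left_pos[of "\<alpha> * n"] by simp
    define Q where "Q = E0 - Bad"
    have Qm: "Q \<in> sets M" using E0m Bm by (auto simp: Q_def)
    have "measure M E0 - measure M Bad \<le> measure M Q" unfolding Q_def
      using finite_measure_Diff'[OF E0m Bm] finite_measure_mono[of "E0 \<inter> Bad" Bad] Bm by auto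
    then have Qb: "measure M Q \<ge> measure M E0 / 2" using bad by linarith
    define A where "A = (\<lambda>s y. D s \<inter> \<phi> s -` V y)"
    have Am: "A s y \<in> sets M" if "s \<in> F" "y \<in> Y" for s y
      unfolding A_def using that D(1) V F(2) sets_act by (intro sets.Int) auto
    have Vm: "E0 - (\<Union>s\<in>T. \<phi> s -` V (\<tau> s)) \<in> sets M" if "T \<subseteq> F" "\<tau> \<in> F \<rightarrow> Y" for T \<tau>
    proof (intro sets.Diff E0m sets.finite_UN)
      show "finite T" using that(1) F(1) by (rule finite_subset)
      fix s assume "s \<in> T"
      then show "\<phi> s -` V (\<tau> s) \<in> sets M" using that F(2) by (intro sets_act V) auto
    qed
    have box: "measure M (Q - (\<Union>s\<in>F. A s (\<tau> s))) \<le> \<rho> ^ card F" if \<tau>: "\<tau> \<in> F \<rightarrow> Y" for \<tau>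
    proof -
      let ?P = "{T\<in>Pow F. real (card (F - T)) \<le> \<alpha> * n}"
      have fP: "finite ?P" using F(1) by simp
      have "Q - (\<Union>s\<in>F. A s (\<tau> s)) \<subseteq> (\<Union>T\<in>?P. E0 - (\<Union>s\<in>T. \<phi> s -` V (\<tau> s)))"
      proof
        fix x assume x: "x \<in> Q - (\<Union>s\<in>F. A s (\<tau> s))"
        have "good x \<in> ?P" using x by (auto simp: Q_def Bad_def good_def)
        moreover have "x \<in> E0 - (\<Union>s\<in>good x. \<phi> s -` V (\<tau> s))" using x by (auto simp: Q_def A_def good_def)
        ultimately show "x \<in> (\<Union>T\<in>?P. E0 - (\<Union>s\<in>T. \<phi> s -` V (\<tau> s)))" by blast
      qed
      then have "measure M (Q - (\<Union>s\<in>F. A s (\<tau> s))) \<le> measure M (\<Union>T\<in>?P. E0 - (\<Union>s\<in>T. \<phi> s -` V (\<tau> s)))"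
        using fP Vm \<tau> by (intro finite_measure_mono sets.finite_UN) auto
      also have "\<dots> \<le> (\<Sum>T\<in>?P. measure M (E0 - (\<Union>s\<in>T. \<phi> s -` V (\<tau> s))))"
        using fP Vm \<tau> by (intro finite_measure_subadditive_finite) auto
      also have "\<dots> \<le> (\<Sum>T\<in>?P. (1 - \<eta> / 2) ^ card T * \<theta> ^ card (F - T) * \<theta> powr (- (\<alpha> * n)))"
      proof (rule sum_mono)
        fix T assume T: "T \<in> ?P"
        have "\<theta> powr (real (card (F - T)) - \<alpha> * n) \<ge> 1"
          using T \<theta> powr_mono'[of "real (card (F - T)) - \<alpha> * n" 0 \<theta>] by simp
        then have 1: "\<theta> ^ card (F - T) * \<theta> powr (- (\<alpha> * n)) \<ge> 1"
          using \<theta> by (simp add: powr_diff powr_minus powr_realpow field_simps)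
        have "measure M (E0 - (\<Union>s\<in>T. \<phi> s -` V (\<tau> s))) \<le> (1 - \<eta> / 2) ^ card T"
          using T \<tau> by (intro F(4)) auto
        also have "\<dots> \<le> (1 - \<eta> / 2) ^ card T * (\<theta> ^ card (F - T) * \<theta> powr (- (\<alpha> * n)))"
          using mult_left_mono[OF 1, of "(1 - \<eta> / 2) ^ card T"] \<eta> by simp
        finally show "measure M (E0 - (\<Union>s\<in>T. \<phi> s -` V (\<tau> s)))
            \<le> (1 - \<eta> / 2) ^ card T * \<theta> ^ card (F - T) * \<theta> powr (- (\<alpha> * n))" by (simp add: mult.assoc)
      qed
      also have "\<dots> \<le> (\<Sum>T\<in>Pow F. (1 - \<eta> / 2) ^ card T * \<theta> ^ card (F - T) * \<theta> powr (- (\<alpha> * n)))"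
        using F(1) \<theta> \<eta> by (intro sum_mono2) auto
      also have "\<dots> = (1 - \<eta> / 2 + \<theta>) ^ card F * \<theta> powr (- (\<alpha> * n))"
        using sum_Pow_weights[OF F(1)] by (simp add: sum_distrib_right[symmetric])
      also have "1 - \<eta> / 2 + \<theta> = \<rho> * \<rho>" unfolding \<rho>(3) by (simp add: \<theta>_def)
      also have "\<theta> powr (- (\<alpha> * n)) = (\<theta> powr (- \<alpha>)) ^ card F"
        using \<theta> powr_power[of \<theta> "- \<alpha>" "card F"] by (simp add: n_def mult.commute)
      also have "(\<rho> * \<rho>) ^ card F * (\<theta> powr (- \<alpha>)) ^ card F = \<rho> ^ card F"
        unfolding \<alpha>(2) using \<rho>(1) by (simp add: power_mult_distrib[symmetric])
      finally show ?thesis .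
    qed
    have Ad: "A s y \<inter> A s y' = {}" if "y \<in> Y" "y' \<in> Y" "y \<noteq> y'" for s y y'
      using disj[OF that] by (auto simp: A_def)
    have "\<exists>I\<subseteq>F. shatters A Y Q I \<and> real (card I) \<ge> c * real (card F)"
    proof (rule cN(2)[THEN spec, THEN spec, THEN spec, THEN spec, THEN mp], intro conjI ballI impI)
    qed (fact F(1) n(2) Y(1) Qm Qb refl | (rule Am; assumption) | (rule Ad; assumption) | (rule box; assumption))+
    then obtain I where I: "I \<subseteq> F" "shatters A Y Q I" "real (card I) \<ge> c * real (card F)" by blast
    have "(\<Inter>s\<in>I. D s \<inter> \<phi> s -` V (\<sigma> s)) \<noteq> {}" if "\<sigma> \<in> I \<rightarrow> Y" for \<sigma>
      using I(2) that unfolding shatters_def A_def by blast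
    then show ?thesis using I by blast
  qed
  have ex: "\<exists>F. finite F \<and> F \<subseteq> carrier G \<and> card F = n \<and> (\<forall>T\<subseteq>F. \<forall>\<tau>\<in>T \<rightarrow> Y.
      measure M (E0 - (\<Union>s\<in>T. \<phi> s -` V (\<tau> s))) \<le> (1 - \<eta> / 2) ^ card T)" for n
    by (rule finite_independent_translates[where b = b]) (fact Y V disj b b_int E0 \<eta>)+
  show ?thesis
  proof (rule exI[of _ \<delta>], rule conjI[OF \<delta>], rule exI[of _ c], rule conjI[OF cN(1)], rule allI)
    fix n0 :: nat
    obtain F where F: "finite F" "F \<subseteq> carrier G" "card F = max n0 (max N 1)"
      "\<And>T \<tau>. T \<subseteq> F \<Longrightarrow> \<tau> \<in> T \<rightarrow> Y \<Longrightarrow> measure M (E0 - (\<Union>s\<in>T. \<phi> s -` V (\<tau> s))) \<le> (1 - \<eta> / 2) ^ card T"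
      using ex[of "max n0 (max N 1)"] by (elim exE conjE) (rule that, auto)
    show "\<exists>F. finite F \<and> F \<subseteq> carrier G \<and> card F \<ge> n0 \<and>
      (\<forall>D. (\<forall>s\<in>F. D s \<in> sets M \<and> measure M (D s) \<ge> 1 - \<delta>) \<longrightarrow>
        (\<exists>I\<subseteq>F. (\<forall>\<sigma>\<in>I \<rightarrow> Y. (\<Inter>s\<in>I. D s \<inter> \<phi> s -` V (\<sigma> s)) \<noteq> {}) \<and> real (card I) \<ge> c * real (card F)))"
    proof (rule exI[of _ F], rule conjI[OF F(1)], rule conjI[OF F(2)], rule conjI, goal_cases)
      case 1
      show ?case using F(3) by simp
    next
      case 2
      show ?case
      proof (rule allI, rule impI)
        fix D assume D: "\<forall>s\<in>F. D s \<in> sets M \<and> measure M (D s) \<ge> 1 - \<delta>"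
        show "\<exists>I\<subseteq>F. (\<forall>\<sigma>\<in>I \<rightarrow> Y. (\<Inter>s\<in>I. D s \<inter> \<phi> s -` V (\<sigma> s)) \<noteq> {}) \<and> real (card I) \<ge> c * real (card F)"
          by (rule main[OF F]) (use D in simp_all)
      qed
    qed
  qed
qed

end

section \<open>Entropy of joins\<close>

text \<open>
  The entropy is at most the expected code length of any code \<open>q\<close>; this bounds entropies from above by
  exhibiting a code instead of developing conditional entropy.
\<close>

lemma gibbs_inequality:
  fixes p q :: "'a \<Rightarrow> real"
  assumes "finite L" "\<And>a. a \<in> L \<Longrightarrow> p a \<ge> 0" "\<And>a. a \<in> L \<Longrightarrow> q a > 0"
    and "(\<Sum>a\<in>L. p a) = 1" "(\<Sum>a\<in>L. q a) \<le> 1"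
  shows "(\<Sum>a\<in>L. - p a * ln (p a)) \<le> (\<Sum>a\<in>L. p a * (- ln (q a)))"
proof -
  have "- p a * ln (p a) - p a * (- ln (q a)) \<le> q a - p a" if a: "a \<in> L" for a
  proof (cases "p a = 0")
    case True
    then show ?thesis using assms(3)[OF a] by simp
  next
    case False
    then have p: "p a > 0" using assms(2)[OF a] by simp
    have "ln (q a / p a) \<le> q a / p a - 1" using p assms(3)[OF a] by (intro ln_le_minus_one) auto
    then have "p a * ln (q a / p a) \<le> p a * (q a / p a - 1)" using p by (intro mult_left_mono) auto
    also have "\<dots> = q a - p a" using p by (simp add: field_simps)
    finally show ?thesis using p assms(3)[OF a] by (simp add: ln_div algebra_simps)
  qed
  then have "(\<Sum>a\<in>L. - p a * ln (p a) - p a * (- ln (q a))) \<le> (\<Sum>a\<in>L. q a - p a)" by (rule sum_mono)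
  then show ?thesis using assms(4,5) by (simp add: sum_subtractf sum_negf)
qed

lemma partition_cell:
  assumes "partition_on UNIV P"
  obtains cell where "\<And>x. cell x \<in> P" "\<And>x. x \<in> cell x" "\<And>x A. A \<in> P \<Longrightarrow> x \<in> A \<Longrightarrow> A = cell x"
proof -
  have P: "\<Union>P = UNIV" "disjoint P" using assms by (auto simp: partition_on_def)
  have "\<exists>A. A \<in> P \<and> x \<in> A" for x
  proof -
    have "x \<in> \<Union>P" unfolding P(1) by simp
    then show ?thesis by blast
  qed
  then obtain cell where c: "\<And>x. cell x \<in> P" "\<And>x. x \<in> cell x" by metis
  have "A = cell x" if "A \<in> P" "x \<in> A" for x A 
  proof (rule ccontr)
    assume "A \<noteq> cell x"
    then have "A \<inter> cell x = {}" by (rule disjointD[OF P(2) that(1) c(1)])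
    then show False using that(2) c(2)[of x] by blast
  qed
  with c show ?thesis by (rule that)
qed

context pmp_action
begin

lemma translate_vimage: "s \<in> carrier G \<Longrightarrow> translate G \<phi> s A = \<phi> s -` A"
proof -
  assume s: "s \<in> carrier G"
  show ?thesis
  proof (intro equalityI subsetI)
    fix x assume "x \<in> translate G \<phi> s A"
    then show "x \<in> \<phi> s -` A" using act_inv(2)[OF s] by (auto simp: translate_def)
  next
    fix x assume "x \<in> \<phi> s -` A"
    then have "\<phi> s x \<in> A" by simp
    then have "\<phi> (inv s) (\<phi> s x) \<in> translate G \<phi> s A" unfolding translate_def by (rule imageI)
    then show "x \<in> translate G \<phi> s A" by (simp only: act_inv(1)[OF s])
  qed
qed

text \<open>
  The cell of the join of the first \<open>n\<close> translates that is labelled by \<open>a\<close>; it is empty for the labels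
  that do not occur.
\<close>

definition join_cell :: "(nat \<Rightarrow> 'g) \<Rightarrow> nat \<Rightarrow> (nat \<Rightarrow> 'x set) \<Rightarrow> 'x set" where
  "join_cell s n a = (\<Inter>i\<in>{1..n}. \<phi> (s i) -` a i)"

lemma join_cell_measurable:
  assumes "range s \<subseteq> carrier G" "P \<subseteq> sets M" "a \<in> {1..n} \<rightarrow>\<^sub>E P"
  shows "join_cell s n a \<in> sets M"
proof (cases "n = 0")
  case True
  then show ?thesis using space_M sets.top[of M] by (simp add: join_cell_def)
next
  case False
  then show ?thesis unfolding join_cell_def using assms
  proof (intro sets.finite_INT)
    fix i assume "i \<in> {1..n}"
    then have "a i \<in> P" using assms(3) by (auto simp: PiE_def)
    then show "\<phi> (s i) -` a i \<in> sets M" using assms(1,2) by (intro sets_act) auto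
  qed auto
qed

lemma mem_join_cell:
  assumes c: "\<And>x. cell x \<in> P" "\<And>x. x \<in> cell x" "\<And>x A. A \<in> P \<Longrightarrow> x \<in> A \<Longrightarrow> A = cell x"
    and a: "a \<in> {1..n} \<rightarrow>\<^sub>E P"
  shows "x \<in> join_cell s n a \<longleftrightarrow> a = (\<lambda>i\<in>{1..n}. cell (\<phi> (s i) x))"
proof
  assume x: "x \<in> join_cell s n a"
  show "a = (\<lambda>i\<in>{1..n}. cell (\<phi> (s i) x))"
  proof
    fix i show "a i = (\<lambda>i\<in>{1..n}. cell (\<phi> (s i) x)) i"
      using x a c(3)[of "a i" "\<phi> (s i) x"] by (cases "i \<in> {1..n}") (auto simp: join_cell_def PiE_def Pi_iff extensional_def)
  qed
next
  assume "a = (\<lambda>i\<in>{1..n}. cell (\<phi> (s i) x))"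
  then show "x \<in> join_cell s n a" using c(2) by (auto simp: join_cell_def)
qed

lemma partition_join_eq:
  assumes s: "range s \<subseteq> carrier G"
  shows "partition_join {1..n} (\<lambda>i. translate G \<phi> (s i) ` P) = join_cell s n ` ({1..n} \<rightarrow>\<^sub>E P) - {{}}"
proof -
  have t: "translate G \<phi> (s i) = (\<lambda>A. \<phi> (s i) -` A)" for i
    using s by (intro ext translate_vimage) auto
  have "{(\<Inter>i\<in>{1..n}. A i) | A. A \<in> Pi {1..n} (\<lambda>i. translate G \<phi> (s i) ` P)} = join_cell s n ` ({1..n} \<rightarrow>\<^sub>E P)"
  proof (intro equalityI subsetI)
    fix B assume "B \<in> {(\<Inter>i\<in>{1..n}. A i) | A. A \<in> Pi {1..n} (\<lambda>i. translate G \<phi> (s i) ` P)}"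
    then obtain A where A: "B = (\<Inter>i\<in>{1..n}. A i)" "A \<in> Pi {1..n} (\<lambda>i. translate G \<phi> (s i) ` P)" by blast
    have "\<exists>C. C \<in> P \<and> A i = \<phi> (s i) -` C" if "i \<in> {1..n}" for i
      using Pi_mem[OF A(2) that] unfolding t by blast
    then have "\<forall>i\<in>{1..n}. \<exists>C. C \<in> P \<and> A i = \<phi> (s i) -` C" by (rule ballI)
    from bchoice[OF this] obtain C where C: "\<forall>i\<in>{1..n}. C i \<in> P \<and> A i = \<phi> (s i) -` C i" by blast
    have "B = join_cell s n (restrict C {1..n})" unfolding A(1) join_cell_def using C by (intro INF_cong) auto
    then show "B \<in> join_cell s n ` ({1..n} \<rightarrow>\<^sub>E P)" using C by (intro image_eqI[of _ _ "restrict C {1..n}"]) auto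
  next
    fix B assume "B \<in> join_cell s n ` ({1..n} \<rightarrow>\<^sub>E P)"
    then obtain a where a: "a \<in> {1..n} \<rightarrow>\<^sub>E P" "B = join_cell s n a" by blast
    have "B = (\<Inter>i\<in>{1..n}. \<phi> (s i) -` a i)" "(\<lambda>i. \<phi> (s i) -` a i) \<in> Pi {1..n} (\<lambda>i. translate G \<phi> (s i) ` P)"
      using a unfolding t by (auto simp: join_cell_def PiE_def)
    then show "B \<in> {(\<Inter>i\<in>{1..n}. A i) | A. A \<in> Pi {1..n} (\<lambda>i. translate G \<phi> (s i) ` P)}" by blast
  qed
  then show ?thesis by (simp add: partition_join_def)
qed

lemma partition_entropy_join:
  assumes s: "range s \<subseteq> carrier G" and P: "finite P" "partition_on UNIV P"
  shows "partition_entropy M (partition_join {1..n} (\<lambda>i. translate G \<phi> (s i) ` P)) =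
    (\<Sum>a\<in>{1..n} \<rightarrow>\<^sub>E P. - measure M (join_cell s n a) * ln (measure M (join_cell s n a)))"
proof -
  obtain cell where c: "\<And>x. cell x \<in> P" "\<And>x. x \<in> cell x" "\<And>x A. A \<in> P \<Longrightarrow> x \<in> A \<Longrightarrow> A = cell x"
    by (rule partition_cell[OF P(2)]) (rule that)
  let ?L = "{1..n} \<rightarrow>\<^sub>E P" and ?h = "\<lambda>B. - measure M B * ln (measure M B)"
  let ?L' = "{a\<in>?L. join_cell s n a \<noteq> {}}"
  have fin: "finite ?L" using P(1) by (intro finite_PiE) auto
  have inj: "inj_on (join_cell s n) ?L'"
  proof (rule inj_onI)
    fix a a' assume a: "a \<in> ?L'" "a' \<in> ?L'" "join_cell s n a = join_cell s n a'"
    then obtain x where x: "x \<in> join_cell s n a" by blast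
    have "a \<in> ?L" "a' \<in> ?L" "x \<in> join_cell s n a'" using a x by auto
    then show "a = a'" using mem_join_cell[OF c, of a n x s] mem_join_cell[OF c, of a' n x s] x by metis
  qed
  have im: "join_cell s n ` ?L - {{}} = join_cell s n ` ?L'" by blast
  have "(\<Sum>B\<in>join_cell s n ` ?L'. ?h B) = (\<Sum>a\<in>?L'. ?h (join_cell s n a))"
    using sum.reindex[OF inj, of ?h] by simp
  also have "\<dots> = (\<Sum>a\<in>?L. ?h (join_cell s n a))"
    using fin by (intro sum.mono_neutral_left) auto
  finally show ?thesis unfolding partition_entropy_def partition_join_eq[OF s] im .
qed

lemma sum_join_cell_indicator:
  assumes P: "finite P" "partition_on UNIV P"
    and c: "\<And>x. cell x \<in> P" "\<And>x. x \<in> cell x" "\<And>x A. A \<in> P \<Longrightarrow> x \<in> A \<Longrightarrow> A = cell x"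
  shows "(\<Sum>a\<in>{1..n} \<rightarrow>\<^sub>E P. indicator (join_cell s n a) x * f a) = (f (\<lambda>i\<in>{1..n}. cell (\<phi> (s i) x)) :: real)"
proof -
  let ?b = "\<lambda>i\<in>{1..n}. cell (\<phi> (s i) x)"
  have b: "?b \<in> {1..n} \<rightarrow>\<^sub>E P" using c(1) by auto
  have fin: "finite ({1..n} \<rightarrow>\<^sub>E P)" using P(1) by (intro finite_PiE) auto
  have "(\<Sum>a\<in>{1..n} \<rightarrow>\<^sub>E P. indicator (join_cell s n a) x * f a) = (\<Sum>a\<in>{1..n} \<rightarrow>\<^sub>E P. if a = ?b then f a else 0)"
    by (rule sum.cong[OF refl]) (simp add: indicator_def mem_join_cell[OF c])
  also have "\<dots> = f ?b" using b fin by simp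
  finally show ?thesis .
qed

lemma sum_measure_join_cell:
  assumes s: "range s \<subseteq> carrier G" and P: "finite P" "partition_on UNIV P" "P \<subseteq> sets M"
  shows "(\<integral>x. (\<Sum>a\<in>{1..n} \<rightarrow>\<^sub>E P. indicator (join_cell s n a) x * f a) \<partial>M)
    = (\<Sum>a\<in>{1..n} \<rightarrow>\<^sub>E P. measure M (join_cell s n a) * (f a :: real))"
    "integrable M (\<lambda>x. \<Sum>a\<in>{1..n} \<rightarrow>\<^sub>E P. indicator (join_cell s n a) x * (f a :: real))"
    "(\<Sum>a\<in>{1..n} \<rightarrow>\<^sub>E P. measure M (join_cell s n a)) = 1"
proof -
  have i: "integrable M (\<lambda>x. indicator (join_cell s n a) x * g a)" if "a \<in> {1..n} \<rightarrow>\<^sub>E P" for a and g :: "_ \<Rightarrow> real"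
    using integrable_indicator_set[OF join_cell_measurable[OF s P(3) that]] by (rule integrable_mult_left)
  have e: "(\<integral>x. (\<Sum>a\<in>{1..n} \<rightarrow>\<^sub>E P. indicator (join_cell s n a) x * g a) \<partial>M)
    = (\<Sum>a\<in>{1..n} \<rightarrow>\<^sub>E P. measure M (join_cell s n a) * (g a :: real))" for g
    using i space_M by (subst Bochner_Integration.integral_sum) auto
  show "(\<integral>x. (\<Sum>a\<in>{1..n} \<rightarrow>\<^sub>E P. indicator (join_cell s n a) x * f a) \<partial>M)
    = (\<Sum>a\<in>{1..n} \<rightarrow>\<^sub>E P. measure M (join_cell s n a) * (f a :: real))" by (rule e)
  show "integrable M (\<lambda>x. \<Sum>a\<in>{1..n} \<rightarrow>\<^sub>E P. indicator (join_cell s n a) x * (f a :: real))"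
    using i by (intro Bochner_Integration.integrable_sum) auto
  obtain cell where c: "\<And>x. cell x \<in> P" "\<And>x. x \<in> cell x" "\<And>x A. A \<in> P \<Longrightarrow> x \<in> A \<Longrightarrow> A = cell x"
    by (rule partition_cell[OF P(2)]) (rule that)
  show "(\<Sum>a\<in>{1..n} \<rightarrow>\<^sub>E P. measure M (join_cell s n a)) = 1"
    using e[of "\<lambda>_. 1"] sum_join_cell_indicator[OF P(1,2) c, where f = "\<lambda>_. 1" and s = s and n = n]
    by (simp add: prob_space)
qed

text \<open>
  The code: describe the cells of a point in the finitely many partitions \<open>r\<^sup>-\<^sup>1 P\<close> with \<open>r\<close> in the range of
  \<open>\<rho>\<close>, at uniform cost; then, for each \<open>i\<close>, say whether the cell in \<open>s\<^sub>i\<^sup>-\<^sup>1 P\<close> agrees with the one predicted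
  from \<open>\<rho> s\<^sub>i\<close> (probability \<open>1 - \<epsilon>\<close>), and name it at uniform cost if not (each \<open>\<epsilon> / |P|\<close>). Disagreement
  has probability at most \<open>\<epsilon>\<close>.
\<close>

lemma join_entropy_bound:
  fixes n :: nat
  assumes s: "range s \<subseteq> carrier G" and P: "finite P" "partition_on UNIV P" "P \<subseteq> sets M"
    and \<rho>: "finite (\<rho> ` carrier G)" "\<rho> ` carrier G \<subseteq> carrier G"
      "\<And>s. s \<in> carrier G \<Longrightarrow> (\<Sum>A\<in>P. orbit_dist (indicator A) s (\<rho> s)) < \<epsilon>"
    and \<epsilon>: "0 < \<epsilon>" "\<epsilon> < 1"
  shows "partition_entropy M (partition_join {1..n} (\<lambda>i. translate G \<phi> (s i) ` P)) \<le>
    card (\<rho> ` carrier G) * ln (card P) + n * (- ln (1 - \<epsilon>) + \<epsilon> * ln (card P / \<epsilon>))"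
proof -
  define R where "R = \<rho> ` carrier G"
  define k where "k = real (card P)"
  obtain cell where c: "\<And>x. cell x \<in> P" "\<And>x. x \<in> cell x" "\<And>x A. A \<in> P \<Longrightarrow> x \<in> A \<Longrightarrow> A = cell x"
    by (rule partition_cell[OF P(2)]) (rule that)
  have Pne: "P \<noteq> {}" using c(1) by blast
  have k: "k \<ge> 1" using P(1) Pne by (simp add: k_def Suc_le_eq card_gt_0_iff)
  have sc: "s i \<in> carrier G" for i using s by blast
  let ?L = "{1..n} \<rightarrow>\<^sub>E P" and ?U = "R \<rightarrow>\<^sub>E P"
  have finL: "finite ?L" using P(1) by (intro finite_PiE finite_atLeastAtMost) auto
  have finU: "finite ?U" using P(1) \<rho>(1) by (intro finite_PiE) (auto simp: R_def)
  define f where "f = (\<lambda>(u :: 'g \<Rightarrow> 'x set) i B. if B = u (\<rho> (s i)) then 1 - \<epsilon> else \<epsilon> / k)"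
  have f_pos: "f u i B > 0" for u i B using \<epsilon> k by (simp add: f_def)
  define q where "q = (\<lambda>a. \<Sum>u\<in>?U. (1 / k) ^ card R * (\<Prod>i\<in>{1..n}. f u i (a i)))"
  have term_pos: "(1 / k) ^ card R * (\<Prod>i\<in>{1..n}. f u i (a i)) > 0" for u a
    using k f_pos by (intro mult_pos_pos prod_pos) auto
  have Une: "?U \<noteq> {}" using Pne by (simp add: PiE_eq_empty_iff)
  have q_pos: "q a > 0" for a unfolding q_def using finU Une term_pos by (intro sum_pos) auto
  have q_sum: "(\<Sum>a\<in>?L. q a) \<le> 1"
  proof -
    have inner: "(\<Sum>a\<in>?L. \<Prod>i\<in>{1..n}. f u i (a i)) \<le> 1" for u
    proof -
      have "(\<Sum>B\<in>P. f u i B) \<le> 1" for i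
      proof -
        have "(\<Sum>B\<in>P. f u i B) \<le> (\<Sum>B\<in>P. (if B = u (\<rho> (s i)) then 1 - \<epsilon> else 0) + \<epsilon> / k)"
          using \<epsilon> k by (intro sum_mono) (auto simp: f_def)
        also have "\<dots> \<le> (1 - \<epsilon>) + k * (\<epsilon> / k)"
          using P(1) \<epsilon> by (simp add: sum.distrib k_def)
        finally show ?thesis using k by simp
      qed
      then have "(\<Prod>i\<in>{1..n}. \<Sum>B\<in>P. f u i B) \<le> (\<Prod>i\<in>{1..n}. 1)"
        by (intro prod_mono conjI sum_nonneg less_imp_le[OF f_pos])
      then show ?thesis using prod_sum_PiE[of "{1..n}" "\<lambda>_. P" "\<lambda>i B. f u i B"] P(1) by simp
    qed
    have "(\<Sum>a\<in>?L. q a) = (\<Sum>u\<in>?U. (1 / k) ^ card R * (\<Sum>a\<in>?L. \<Prod>i\<in>{1..n}. f u i (a i)))"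
      unfolding q_def by (subst sum.swap) (simp add: sum_distrib_left)
    also have "\<dots> \<le> (\<Sum>u\<in>?U. (1 / k) ^ card R * 1)"
      using inner k by (intro sum_mono mult_left_mono) auto
    also have "\<dots> = 1" using k \<rho>(1) by (simp add: card_PiE R_def k_def power_divide)
    finally show ?thesis .
  qed
  define bad where "bad = (\<lambda>i x. \<Sum>A\<in>P. \<bar>indicator A (\<phi> (s i) x) - indicator A (\<phi> (\<rho> (s i)) x) :: real\<bar>)"
  have rc: "\<rho> (s i) \<in> carrier G" "\<rho> (s i) \<in> R" for i using \<rho>(2) sc[of i] by (auto simp: R_def)
  have ib: "integrable M (bad i)" for i unfolding bad_def using P(3) sc rc
    by (intro Bochner_Integration.integrable_sum integrable_indicator_diff) auto
  have int_bad: "(\<integral>x. bad i x \<partial>M) \<le> \<epsilon>" for i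
  proof -
    have "(\<integral>x. bad i x \<partial>M) = (\<Sum>A\<in>P. orbit_dist (indicator A) (s i) (\<rho> (s i)))"
      unfolding bad_def orbit_dist_def using P(3) sc rc
      by (intro Bochner_Integration.integral_sum integrable_indicator_diff) auto
    then show ?thesis using \<rho>(3)[OF sc[of i]] by simp
  qed
  have lnk: "ln (k / \<epsilon>) \<ge> 0" using k \<epsilon> by (intro ln_ge_zero) (simp add: field_simps)
  have point: "- ln (q (\<lambda>i\<in>{1..n}. cell (\<phi> (s i) x)))
     \<le> card R * ln k + (\<Sum>i\<in>{1..n}. - ln (1 - \<epsilon>) + bad i x * ln (k / \<epsilon>))" for x
  proof -
    let ?a = "\<lambda>i\<in>{1..n}. cell (\<phi> (s i) x)" and ?u = "\<lambda>r\<in>R. cell (\<phi> r x)"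
    have u: "?u \<in> ?U" using c(1) by auto
    have "(1 / k) ^ card R * (\<Prod>i\<in>{1..n}. f ?u i (?a i)) \<le> q ?a"
      unfolding q_def using u finU less_imp_le[OF term_pos]
      by (intro member_le_sum[of ?u ?U "\<lambda>u. (1 / k) ^ card R * (\<Prod>i\<in>{1..n}. f u i (?a i))"]) auto
    then have "ln ((1 / k) ^ card R * (\<Prod>i\<in>{1..n}. f ?u i (?a i))) \<le> ln (q ?a)"
      using term_pos q_pos by (subst ln_le_cancel_iff) auto
    moreover have "ln ((1 / k) ^ card R * (\<Prod>i\<in>{1..n}. f ?u i (?a i)))
        = - (card R * ln k) + (\<Sum>i\<in>{1..n}. ln (f ?u i (?a i)))"
    proof -
      have "(\<Prod>i\<in>{1..n}. f ?u i (?a i)) > 0" using f_pos by (intro prod_pos) auto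
      then have "ln ((1 / k) ^ card R * (\<Prod>i\<in>{1..n}. f ?u i (?a i)))
          = ln ((1 / k) ^ card R) + ln (\<Prod>i\<in>{1..n}. f ?u i (?a i))"
        using k by (intro ln_mult_pos) auto
      moreover have "ln (\<Prod>i\<in>{1..n}. f ?u i (?a i)) = (\<Sum>i\<in>{1..n}. ln (f ?u i (?a i)))"
        using f_pos by (intro ln_prod) (auto simp: less_imp_neq[symmetric])
      moreover have "ln ((1 / k) ^ card R) = - (card R * ln k)"
        using k by (simp add: ln_realpow ln_div)
      ultimately show ?thesis by simp
    qed
    moreover have "- ln (f ?u i (?a i)) \<le> - ln (1 - \<epsilon>) + bad i x * ln (k / \<epsilon>)" if i: "i \<in> {1..n}" for i
    proof (cases "cell (\<phi> (s i) x) = cell (\<phi> (\<rho> (s i)) x)")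
      case True
      have "bad i x \<ge> 0" unfolding bad_def by (intro sum_nonneg) auto
      then show ?thesis using True i rc lnk by (simp add: f_def)
    next
      case False
      let ?A = "cell (\<phi> (s i) x)"
      have "\<phi> (\<rho> (s i)) x \<notin> ?A" using False c(1,3) by blast
      then have "1 \<le> \<bar>indicator ?A (\<phi> (s i) x) - indicator ?A (\<phi> (\<rho> (s i)) x) :: real\<bar>" using c(2) by simp
      also have "\<dots> \<le> bad i x" unfolding bad_def using P(1) c(1) by (intro member_le_sum) auto
      finally have "ln (k / \<epsilon>) \<le> bad i x * ln (k / \<epsilon>)" using lnk mult_right_mono[of 1 "bad i x"] by simp
      moreover have "- ln (f ?u i (?a i)) = ln (k / \<epsilon>)" using False i rc k \<epsilon> by (simp add: f_def ln_div)
      moreover have "- ln (1 - \<epsilon>) \<ge> 0" using \<epsilon> by simp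
      ultimately show ?thesis by linarith
    qed
    then have "(\<Sum>i\<in>{1..n}. - ln (f ?u i (?a i))) \<le> (\<Sum>i\<in>{1..n}. - ln (1 - \<epsilon>) + bad i x * ln (k / \<epsilon>))"
      by (intro sum_mono) auto
    ultimately show ?thesis by (simp add: sum_negf)
  qed
  have "partition_entropy M (partition_join {1..n} (\<lambda>i. translate G \<phi> (s i) ` P))
    = (\<Sum>a\<in>?L. - measure M (join_cell s n a) * ln (measure M (join_cell s n a)))"
    by (rule partition_entropy_join[OF s P(1,2)])
  also have "\<dots> \<le> (\<Sum>a\<in>?L. measure M (join_cell s n a) * (- ln (q a)))"
    using finL q_pos q_sum sum_measure_join_cell(3)[OF s P] by (intro gibbs_inequality) auto
  also have "\<dots> = (\<integral>x. (\<Sum>a\<in>?L. indicator (join_cell s n a) x * (- ln (q a))) \<partial>M)"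
    by (rule sum_measure_join_cell(1)[OF s P, symmetric])
  also have "\<dots> \<le> (\<integral>x. card R * ln k + (\<Sum>i\<in>{1..n}. - ln (1 - \<epsilon>) + bad i x * ln (k / \<epsilon>)) \<partial>M)"
  proof (rule integral_mono)
    show "integrable M (\<lambda>x. \<Sum>a\<in>?L. indicator (join_cell s n a) x * (- ln (q a)))"
      by (rule sum_measure_join_cell(2)[OF s P])
    show "integrable M (\<lambda>x. card R * ln k + (\<Sum>i\<in>{1..n}. - ln (1 - \<epsilon>) + bad i x * ln (k / \<epsilon>)))"
      using ib by auto
    show "(\<Sum>a\<in>?L. indicator (join_cell s n a) x * (- ln (q a)))
        \<le> card R * ln k + (\<Sum>i\<in>{1..n}. - ln (1 - \<epsilon>) + bad i x * ln (k / \<epsilon>))" for x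
      using point[of x] sum_join_cell_indicator[OF P(1,2) c, where f = "\<lambda>a. - ln (q a)" and s = s and n = n and x = x]
      by (simp only:)
  qed
  also have "\<dots> = card R * ln k + (\<Sum>i\<in>{1..n}. - ln (1 - \<epsilon>) + (\<integral>x. bad i x \<partial>M) * ln (k / \<epsilon>))"
    using ib by (simp add: prob_space)
  also have "\<dots> \<le> card R * ln k + (\<Sum>i\<in>{1..n}. - ln (1 - \<epsilon>) + \<epsilon> * ln (k / \<epsilon>))"
    using int_bad lnk by (intro add_left_mono sum_mono mult_right_mono) auto
  finally show ?thesis by (simp add: R_def k_def)
qed


text \<open>
  The bound above is a constant plus \<open>n\<close> times a quantity that tends to zero with \<open>\<epsilon>\<close>.
\<close>

theorem ap_partition_zero_entropy:
  assumes s: "range s \<subseteq> carrier G" and P: "finite_borel_partition M P" "P \<subseteq> ap_sets"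
  shows "seq_entropy G \<phi> M P s \<le> 0"
proof -
  have fP: "finite P" "partition_on UNIV P" "P \<subseteq> sets M" using P by (auto simp: finite_borel_partition_def)
  define k where "k = real (card P)"
  have "P \<noteq> {}" using fP(2) by (auto simp: partition_on_def)
  then have k: "k \<ge> 1" using fP(1) by (simp add: k_def Suc_le_eq card_gt_0_iff)
  have tb: "totally_bdd (carrier G) (\<lambda>s r. \<Sum>A\<in>P. orbit_dist (indicator A) s r)"
    using P(2) by (intro totally_bdd_sum[OF fP(1)]) (auto simp: ap_sets_def almost_periodic_def)
  define h where "h = (\<lambda>n. partition_entropy M (partition_join {1..n} (\<lambda>i. translate G \<phi> (s i) ` P)))"
  have small: "seq_entropy G \<phi> M P s \<le> ereal \<kappa>" if \<kappa>: "\<kappa> > 0" for \<kappa>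
  proof -
    have k0: "k > 0" using k by simp
    have "((\<lambda>\<epsilon>. - ln (1 - \<epsilon>) + \<epsilon> * ln (k / \<epsilon>)) \<longlongrightarrow> 0) (at_right 0)"
      using k0 by real_asymp
    then have "\<forall>\<^sub>F \<epsilon> in at_right 0. - ln (1 - \<epsilon>) + \<epsilon> * ln (k / \<epsilon>) < \<kappa> / 2"
      using \<kappa> by (intro order_tendstoD(2)) auto
    then obtain b where b: "b > 0" "\<And>\<epsilon>. 0 < \<epsilon> \<Longrightarrow> \<epsilon> < b \<Longrightarrow> - ln (1 - \<epsilon>) + \<epsilon> * ln (k / \<epsilon>) < \<kappa> / 2"
      by (auto simp: eventually_at_right_field)
    define \<epsilon> where "\<epsilon> = min (b / 2) (1 / 2)"
    have \<epsilon>: "0 < \<epsilon>" "\<epsilon> < 1" "\<epsilon> < b" using b(1) by (auto simp: \<epsilon>_def)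
    have \<epsilon>_small: "- ln (1 - \<epsilon>) + \<epsilon> * ln (k / \<epsilon>) < \<kappa> / 2" by (rule b(2)[OF \<epsilon>(1,3)])
    obtain \<rho> where \<rho>: "finite (\<rho> ` carrier G)" "\<rho> ` carrier G \<subseteq> carrier G"
      "\<And>s. s \<in> carrier G \<Longrightarrow> (\<Sum>A\<in>P. orbit_dist (indicator A) s (\<rho> s)) < \<epsilon>"
      by (rule totally_bdd_net[OF tb \<epsilon>(1)]) blast
    let ?C = "card (\<rho> ` carrier G) * ln k"
    have "(\<lambda>n. ?C / real n) \<longlonglongrightarrow> 0" by (rule lim_const_over_n)
    then have ev: "\<forall>\<^sub>F n in sequentially. ?C / real n < \<kappa> / 2"
      using \<kappa> by (intro order_tendstoD(2)) auto
    have "\<forall>\<^sub>F n in sequentially. ereal (1 / real n * h n) \<le> ereal \<kappa>"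
      using ev eventually_gt_at_top[of 0]
    proof eventually_elim
      case (elim n)
      let ?e = "- ln (1 - \<epsilon>) + \<epsilon> * ln (k / \<epsilon>)"
      have "h n \<le> ?C + n * ?e"
        unfolding h_def k_def by (rule join_entropy_bound[OF s fP \<rho> \<epsilon>(1,2)])
      then have "1 / real n * h n \<le> 1 / real n * (?C + n * ?e)" by (intro mult_left_mono) auto
      also have "\<dots> = ?C / n + ?e" using elim(2) by (simp add: field_simps)
      finally have "1 / real n * h n \<le> \<kappa>" using elim(1) \<epsilon>_small by linarith
      then show ?case by simp
    qed
    then show ?thesis unfolding seq_entropy_def h_def by (rule Limsup_bounded)
  qed
  show ?thesis
  proof (rule ereal_le_epsilon2)
    fix e :: real assume "0 < e"
    then show "seq_entropy G \<phi> M P s \<le> 0 + ereal e" using small by simp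
  qed
qed

end

section \<open>From independence to entropy\<close>

context pmp_action
begin

text \<open>
  Small entropy would leave few cells of measure above \<open>exp (- \<beta> n)\<close> and total measure at least \<open>1 - \<delta>\<close>,
  by Markov's inequality for the information function. Apply independence relative to the constant map
  with value the union of these cells, and count patterns as explained at the beginning.
\<close>

lemma independence_entropy_bound:
  fixes s :: "nat \<Rightarrow> 'g" and A :: "nat \<Rightarrow> 'x set" and n k :: nat
  assumes s: "range s \<subseteq> carrier G" and P: "finite P" "partition_on UNIV P" "P \<subseteq> sets M"
    and miss: "\<And>B. B \<in> P \<Longrightarrow> \<exists>i\<in>{1..k}. B \<inter> A i = {}" and k: "k \<ge> 2"
    and F: "F \<subseteq> s ` {1..n}" and n: "n > 0" and c: "c > 0" and \<delta>: "\<delta> > 0"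
    and indep: "\<And>D. D \<in> sets M \<Longrightarrow> measure M D \<ge> 1 - \<delta> \<Longrightarrow> \<exists>I\<subseteq>F.
      (\<forall>\<sigma>\<in>I \<rightarrow> {1..k}. (\<Inter>r\<in>I. D \<inter> \<phi> r -` A (\<sigma> r)) \<noteq> {}) \<and> real (card I) \<ge> c * real n"
  shows "partition_entropy M (partition_join {1..n} (\<lambda>i. translate G \<phi> (s i) ` P))
     \<ge> \<delta> * (c * ln (k / (k - 1)) / 2) * n"
proof (rule ccontr)
  define \<beta> where "\<beta> = c * ln (k / (k - 1)) / 2"
  have lnk: "ln (k / (k - 1)) > 0" using k by (intro ln_gt_zero) (simp add: field_simps)
  have \<beta>: "\<beta> > 0" using c lnk by (simp add: \<beta>_def)
  obtain cell where cell: "\<And>x. cell x \<in> P" "\<And>x. x \<in> cell x" "\<And>x A. A \<in> P \<Longrightarrow> x \<in> A \<Longrightarrow> A = cell x"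
    by (rule partition_cell[OF P(2)]) (rule that)
  let ?L = "{1..n} \<rightarrow>\<^sub>E P"
  define p where "p = (\<lambda>a. measure M (join_cell s n a))"
  have finL: "finite ?L" using P(1) by (intro finite_PiE finite_atLeastAtMost) auto
  assume "\<not> ?thesis"
  then have H: "(\<Sum>a\<in>?L. - p a * ln (p a)) < \<delta> * \<beta> * n"
    unfolding partition_entropy_join[OF s P(1,2)] by (simp add: p_def \<beta>_def)
  have p01: "0 \<le> p a" "p a \<le> 1" for a by (auto simp: p_def)
  have h_nonneg: "0 \<le> - p a * ln (p a)" for a
  proof (cases "p a = 0")
    case False
    then have "ln (p a) \<le> 0" using p01[of a] by simp
    then have "p a * ln (p a) \<le> 0" using p01(1)[of a] by (rule mult_nonneg_nonpos[rotated])
    then show ?thesis by simp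
  qed simp
  define Lb where "Lb = {a\<in>?L. p a > exp (- (\<beta> * n))}"
  have Lb: "Lb \<subseteq> ?L" "finite Lb" using finL by (auto simp: Lb_def)
  define D where "D = (\<Union>a\<in>Lb. join_cell s n a)"
  have D: "D \<in> sets M" unfolding D_def using Lb join_cell_measurable[OF s P(3)] by (intro sets.finite_UN) auto
  have "\<beta> * n * (\<Sum>a\<in>?L - Lb. p a) = (\<Sum>a\<in>?L - Lb. \<beta> * n * p a)" by (rule sum_distrib_left)
  also have "\<dots> \<le> (\<Sum>a\<in>?L - Lb. - p a * ln (p a))"
  proof (rule sum_mono)
    fix a assume a: "a \<in> ?L - Lb"
    show "\<beta> * n * p a \<le> - p a * ln (p a)"
    proof (cases "p a = 0")
      case False
      then have pa: "p a > 0" using p01[of a] by simp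
      have "p a \<le> exp (- (\<beta> * n))" using a by (auto simp: Lb_def)
      then have "ln (p a) \<le> - (\<beta> * n)" using pa ln_le_cancel_iff[of "p a" "exp (- (\<beta> * n))"] by simp
      then have "p a * ln (p a) \<le> p a * (- (\<beta> * n))" using pa by (intro mult_left_mono) auto
      then show ?thesis by (simp add: mult_ac)
    qed simp
  qed
  also have "\<dots> \<le> (\<Sum>a\<in>?L. - p a * ln (p a))" using finL h_nonneg by (intro sum_mono2) auto
  also have "\<dots> < \<beta> * n * \<delta>" using H by (simp add: mult_ac)
  finally have rest: "(\<Sum>a\<in>?L - Lb. p a) < \<delta>"
    using \<beta> n mult_less_cancel_left_pos[of "\<beta> * n"] by simp
  have total: "(\<Sum>a\<in>?L. p a) = 1" unfolding p_def by (rule sum_measure_join_cell(3)[OF s P])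
  have split: "(\<Sum>a\<in>?L. p a) = (\<Sum>a\<in>?L - Lb. p a) + (\<Sum>a\<in>Lb. p a)"
    by (rule sum.subset_diff[OF Lb(1) finL])
  have "measure M D = (\<Sum>a\<in>Lb. p a)"
    unfolding D_def p_def
  proof (rule finite_measure_finite_Union[OF Lb(2)])
    show "join_cell s n ` Lb \<subseteq> sets M" using Lb join_cell_measurable[OF s P(3)] by auto
    show "disjoint_family_on (join_cell s n) Lb"
      unfolding disjoint_family_on_def
    proof (intro ballI impI)
      fix a a' assume a: "a \<in> Lb" "a' \<in> Lb" "a \<noteq> a'"
      have aL: "a \<in> ?L" "a' \<in> ?L" using a Lb by auto
      show "join_cell s n a \<inter> join_cell s n a' = {}"
      proof (rule ccontr)
        assume "join_cell s n a \<inter> join_cell s n a' \<noteq> {}"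
        then obtain x where x: "x \<in> join_cell s n a" "x \<in> join_cell s n a'" by auto
        then show False
          using iffD1[OF mem_join_cell[OF cell aL(1)] x(1)] iffD1[OF mem_join_cell[OF cell aL(2)] x(2)] a(3)
          by (simp only:)
      qed
    qed
  qed
  then have "measure M D \<ge> 1 - \<delta>" using rest total split by linarith
  from indep[OF D this] obtain I where I': "I \<subseteq> F \<and>
      (\<forall>\<sigma>\<in>I \<rightarrow> {1..k}. (\<Inter>r\<in>I. D \<inter> \<phi> r -` A (\<sigma> r)) \<noteq> {}) \<and> real (card I) \<ge> c * real n" ..
  note I = I'[THEN conjunct1] I'[THEN conjunct2, THEN conjunct1] I'[THEN conjunct2, THEN conjunct2]
  have finI: "finite I" using finite_subset[OF subset_trans[OF I(1) F]] by simp
  have "real (card Lb) * exp (- (\<beta> * n)) = (\<Sum>a\<in>Lb. exp (- (\<beta> * n)))" by simp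
  also have "\<dots> \<le> (\<Sum>a\<in>Lb. p a)" by (intro sum_mono) (auto simp: Lb_def)
  also have "\<dots> \<le> 1"
  proof -
    have "0 \<le> (\<Sum>a\<in>?L - Lb. p a)" by (intro sum_nonneg p01(1))
    then show ?thesis using total split by linarith
  qed
  finally have card_Lb: "real (card Lb) \<le> exp (\<beta> * n)" by (simp add: exp_minus field_simps)
  have Ine: "I \<noteq> {}"
  proof
    assume "I = {}"
    then have "c * real n \<le> 0" using I(3) by simp
    moreover have "c * real n > 0" using c n by simp
    ultimately show False by linarith
  qed
  have "\<forall>B\<in>P. \<exists>i. i \<in> {1..k} \<and> B \<inter> A i = {}" using miss by blast
  from bchoice[OF this] obtain m where m: "\<And>B. B \<in> P \<Longrightarrow> m B \<in> {1..k}" "\<And>B. B \<in> P \<Longrightarrow> B \<inter> A (m B) = {}" by blast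
  have "\<forall>r\<in>I. \<exists>i. i \<in> {1..n} \<and> s i = r" using I(1) F by blast
  from bchoice[OF this] obtain j where j: "\<And>r. r \<in> I \<Longrightarrow> j r \<in> {1..n}" "\<And>r. r \<in> I \<Longrightarrow> s (j r) = r" by blast
  \<comment> \<open>a cell of the join meets at most \<open>(k - 1)\<^bsup>|I|\<^esup>\<close> of the \<open>k\<^bsup>|I|\<^esup>\<close> intersections\<close>
  have cover: "I \<rightarrow>\<^sub>E {1..k} \<subseteq> (\<Union>a\<in>Lb. PiE I (\<lambda>r. {1..k} - {m (a (j r))}))"
  proof
    fix \<sigma> assume \<sigma>: "\<sigma> \<in> I \<rightarrow>\<^sub>E {1..k}"
    then have "(\<Inter>r\<in>I. D \<inter> \<phi> r -` A (\<sigma> r)) \<noteq> {}" by (intro I(2)[rule_format]) (auto simp: PiE_def)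
    then obtain x where x0: "x \<in> (\<Inter>r\<in>I. D \<inter> \<phi> r -` A (\<sigma> r))" unfolding ex_in_conv[symmetric] ..
    have x: "x \<in> D \<and> \<phi> r x \<in> A (\<sigma> r)" if "r \<in> I" for r using INT_D[OF x0 that] by simp
    then have "x \<in> D" using Ine by blast
    then obtain a where a: "a \<in> Lb" "x \<in> join_cell s n a" by (auto simp: D_def)
    have "\<sigma> r \<noteq> m (a (j r))" if r: "r \<in> I" for r
    proof
      assume e: "\<sigma> r = m (a (j r))"
      have "a (j r) \<in> P" using a(1) Lb(1) j(1)[OF r] by (auto simp: PiE_def Pi_iff)
      moreover have "\<phi> (s (j r)) x \<in> a (j r)"
        using INT_D[OF a(2)[unfolded join_cell_def] j(1)[OF r]] by simp
      ultimately show False using m(2)[of "a (j r)"] x[OF r] e j(2)[OF r] by auto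
    qed
    then have "\<sigma> \<in> PiE I (\<lambda>r. {1..k} - {m (a (j r))})" using \<sigma> by (auto simp: PiE_def Pi_iff)
    then show "\<sigma> \<in> (\<Union>a\<in>Lb. PiE I (\<lambda>r. {1..k} - {m (a (j r))}))" using a(1) by blast
  qed
  have card1: "card (PiE I (\<lambda>r. {1..k} - {m (a (j r))})) = (k - 1) ^ card I" if a: "a \<in> Lb" for a
  proof -
    have "card ({1..k} - {m (a (j r))}) = k - 1" if r: "r \<in> I" for r
    proof -
      have "a (j r) \<in> P" using a Lb(1) j(1)[OF r] by (auto simp: PiE_def Pi_iff)
      then show ?thesis using m(1) by simp
    qed
    then show ?thesis using finI by (simp add: card_PiE)
  qed
  have "k ^ card I = card (I \<rightarrow>\<^sub>E {1..k})" using finI by (simp add: card_PiE)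
  also have "\<dots> \<le> card (\<Union>a\<in>Lb. PiE I (\<lambda>r. {1..k} - {m (a (j r))}))"
    using cover Lb(2) finI by (intro card_mono finite_UN_I finite_PiE) auto
  also have "\<dots> \<le> (\<Sum>a\<in>Lb. card (PiE I (\<lambda>r. {1..k} - {m (a (j r))})))" by (rule card_UN_le[OF Lb(2)])
  also have "\<dots> = card Lb * (k - 1) ^ card I" using card1 by simp
  finally have "real (k ^ card I) \<le> real (card Lb * (k - 1) ^ card I)" by (rule of_nat_mono)
  then have "real k ^ card I \<le> real (card Lb) * real (k - 1) ^ card I" by simp
  then have "(real k / real (k - 1)) ^ card I \<le> real (card Lb)"
    using k by (simp add: power_divide field_simps)
  also have "\<dots> \<le> exp (\<beta> * n)" by (rule card_Lb)
  finally have le: "(real k / real (k - 1)) ^ card I \<le> exp (\<beta> * n)" .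
  have "ln ((real k / real (k - 1)) ^ card I) \<le> ln (exp (\<beta> * n))"
    using le k by (intro ln_mono) auto
  then have "real (card I) * ln (real k / real (k - 1)) \<le> \<beta> * n" using k by (simp add: ln_realpow)
  moreover have "real (card I) * ln (real k / real (k - 1)) \<ge> (c * real n) * ln (real k / real (k - 1))"
    using I(3) lnk by (intro mult_right_mono) auto
  ultimately have "2 * (\<beta> * n) \<le> \<beta> * n" by (simp add: \<beta>_def mult_ac)
  moreover have "\<beta> * n > 0" using \<beta> n by simp
  ultimately show False by linarith
qed

text \<open>
  Every block is longer than the whole list before it, so that it makes up at least half of the initial
  segment that it ends.
\<close>

lemma concatenated_block_sequence:
  fixes good :: "'g set \<Rightarrow> bool"
  assumes ex: "\<And>N. \<exists>F. finite F \<and> F \<subseteq> carrier G \<and> card F \<ge> N \<and> good F"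
  obtains s :: "nat \<Rightarrow> 'g" where "range s \<subseteq> carrier G"
    "\<And>N. \<exists>n\<ge>N. \<exists>F. finite F \<and> F \<subseteq> s ` {1..n} \<and> n \<le> 2 * card F \<and> good F"
proof -
  define step where "step = (\<lambda>xs zs. \<exists>ys. zs = xs @ ys \<and> length xs < length ys \<and> distinct ys \<and> good (set ys))"
  have "\<exists>f. \<forall>m. set (f m) \<subseteq> carrier G \<and> step (f m) (f (Suc m))"
  proof (rule dependent_nat_choice)
    show "\<exists>xs. set xs \<subseteq> carrier G" by (intro exI[of _ "[]"]) simp
    fix xs :: "'g list" and m :: nat assume xs: "set xs \<subseteq> carrier G"
    obtain F where F: "finite F" "F \<subseteq> carrier G" "card F \<ge> Suc (length xs)" "good F" using ex by blast
    obtain ys where ys: "set ys = F" "distinct ys" using finite_distinct_list[OF F(1)] by blast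
    have "length ys = card F" using ys distinct_card by metis
    then have "step xs (xs @ ys)" unfolding step_def using ys F by auto
    then show "\<exists>zs. set zs \<subseteq> carrier G \<and> step xs zs" using xs ys F by (intro exI[of _ "xs @ ys"]) auto
  qed
  then obtain f where f: "\<And>m. set (f m) \<subseteq> carrier G" "\<And>m. step (f m) (f (Suc m))" by blast
  have len: "m \<le> length (f m)" for m
  proof (induction m)
    case (Suc m)
    then show ?case using f(2)[of m] by (auto simp: step_def)
  qed simp
  have ext: "\<exists>zs. f m' = f m @ zs" if "m \<le> m'" for m m'
    using that
  proof (induction m' rule: dec_induct)
    case (step m')
    then show ?case using f(2)[of m'] by (auto simp: step_def)
  qed simp
  define s where "s = (\<lambda>i. if i = 0 then \<one> else f i ! (i - 1))"
  have s_eq: "s i = f m ! (i - 1)" if i: "1 \<le> i" "i \<le> length (f m)" for i m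
  proof -
    obtain zs zs' where z: "f (max i m) = f m @ zs" "f (max i m) = f i @ zs'"
      using ext[of m "max i m"] ext[of i "max i m"] by auto
    have l: "i - 1 < length (f m)" "i - 1 < length (f i)" using i len[of i] by linarith+
    have "f (max i m) ! (i - 1) = f m ! (i - 1)" unfolding z(1) using l(1) by (simp only: nth_append if_True)
    moreover have "f (max i m) ! (i - 1) = f i ! (i - 1)" unfolding z(2) using l(2) by (simp only: nth_append if_True)
    ultimately show ?thesis using i by (simp add: s_def)
  qed
  show ?thesis
  proof (rule that[of s])
    have "s i \<in> carrier G" for i
    proof (cases "i = 0")
      case True
      then show ?thesis using grp by (simp add: s_def group.is_monoid monoid.one_closed)
    next
      case False
      then have "f i ! (i - 1) \<in> set (f i)" using len[of i] by (intro nth_mem) auto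
      then show ?thesis using False f(1)[of i] by (auto simp: s_def)
    qed
    then show "range s \<subseteq> carrier G" by blast
    fix N
    obtain ys where ys: "f (Suc N) = f N @ ys" "length (f N) < length ys" "distinct ys" "good (set ys)"
      using f(2)[of N] by (auto simp: step_def)
    let ?n = "length (f (Suc N))"
    have "set ys \<subseteq> s ` {1..?n}"
    proof
      fix y assume "y \<in> set ys"
      then have "y \<in> set (f (Suc N))" using ys by simp
      then obtain i where i: "i < ?n" "f (Suc N) ! i = y" by (auto simp: in_set_conv_nth)
      then have "y = s (Suc i)" using s_eq[of "Suc i" "Suc N"] by simp
      then show "y \<in> s ` {1..?n}" using i by auto
    qed
    moreover have "?n \<le> 2 * card (set ys)" using ys distinct_card[OF ys(3)] by simp
    moreover have "N \<le> ?n" using len[of "Suc N"] by simp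
    ultimately show "\<exists>n\<ge>N. \<exists>F. finite F \<and> F \<subseteq> s ` {1..n} \<and> n \<le> 2 * card F \<and> good F"
      using ys(4) by (intro exI[of _ ?n] conjI exI[of _ "set ys"]) auto
  qed
qed

text \<open>
  At the ends of the blocks the entropy of the join is at least a fixed multiple of \<open>n\<close>; hence so is
  the limit superior after division by \<open>n\<close>.
\<close>

lemma positive_entropy_of_independence:
  fixes A :: "nat \<Rightarrow> 'x set" and k :: nat
  assumes P: "finite_borel_partition M P"
    and miss: "\<And>B. B \<in> P \<Longrightarrow> \<exists>i\<in>{1..k}. B \<inter> A i = {}" and k: "k \<ge> 2"
    and dens: "pos_seq_independence_density G \<phi> M k A"
  shows "\<exists>s. range s \<subseteq> carrier G \<and> seq_entropy G \<phi> M P s > 0"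
proof -
  have fP: "finite P" "partition_on UNIV P" "P \<subseteq> sets M" using P by (auto simp: finite_borel_partition_def)
  obtain \<delta> c where dc: "\<delta> > 0" "c > (0::real)" "\<And>N. N > (0::real) \<Longrightarrow> \<exists>F.
        finite F \<and> F \<subseteq> carrier G \<and> real (card F) \<ge> N \<and>
        (\<forall>D\<in>B_prime G M \<delta>. \<exists>I\<subseteq>F.
           independence_set G \<phi> k A D I \<and> real (card I) \<ge> c * real (card F))"
    using dens unfolding pos_seq_independence_density_def by blast
  define good where "good = (\<lambda>F. \<forall>D\<in>B_prime G M \<delta>. \<exists>I\<subseteq>F.
           independence_set G \<phi> k A D I \<and> real (card I) \<ge> c * real (card F))"
  have "\<exists>F. finite F \<and> F \<subseteq> carrier G \<and> card F \<ge> N \<and> good F" for N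
  proof -
    obtain F where "finite F" "F \<subseteq> carrier G" "real (card F) \<ge> real (Suc N)" "good F"
      using dc(3)[of "real (Suc N)"] unfolding good_def by auto
    then show ?thesis by (intro exI[of _ F]) auto
  qed
  then obtain s :: "nat \<Rightarrow> 'g" where s: "range s \<subseteq> carrier G"
    "\<And>N. \<exists>n\<ge>N. \<exists>F. finite F \<and> F \<subseteq> s ` {1..n} \<and> n \<le> 2 * card F \<and> good F"
    by (rule concatenated_block_sequence) (rule that)
  define b where "b = \<delta> * (c / 2 * ln (k / (k - 1)) / 2)"
  have "ln (k / (k - 1)) > 0" using k by (intro ln_gt_zero) (simp add: field_simps)
  then have b: "b > 0" using dc by (simp add: b_def)
  define H where "H = (\<lambda>n. partition_entropy M (partition_join {1..n} (\<lambda>i. translate G \<phi> (s i) ` P)))"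
  have large: "\<exists>n\<ge>N. b \<le> 1 / real n * H n" for N
  proof -
    obtain n F where n: "n \<ge> Suc N" and F: "finite F" "F \<subseteq> s ` {1..n}" "n \<le> 2 * card F" "good F"
      using s(2)[of "Suc N"] by blast
    have n0: "n > 0" using n by simp
    have "H n \<ge> \<delta> * (c / 2 * ln (k / (k - 1)) / 2) * n"
      unfolding H_def
    proof (rule independence_entropy_bound[OF s(1) fP miss k F(2) n0 _ dc(1)])
      fix D assume D: "D \<in> sets M" "measure M D \<ge> 1 - \<delta>"
      have "carrier G \<noteq> {}" using grp by (metis empty_iff group.is_monoid monoid.one_closed)
      then have "(\<lambda>_. D) \<in> B_prime G M \<delta>" using D by (auto simp: B_prime_def)
      then obtain I where I: "I \<subseteq> F" "independence_set G \<phi> k A (\<lambda>_. D) I" "real (card I) \<ge> c * real (card F)"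
        using F(4) unfolding good_def by blast
      have finI: "finite I" using I(1) F(1) finite_subset by blast
      have Ic: "I \<subseteq> carrier G" using I(2) by (simp add: independence_set_def)
      have "(\<Inter>r\<in>I. D \<inter> \<phi> r -` A (\<sigma> r)) \<noteq> {}" if \<sigma>: "\<sigma> \<in> I \<rightarrow> {1..k}" for \<sigma>
      proof (cases "I = {}")
        case False
        have "(\<Inter>r\<in>I. D \<inter> translate G \<phi> r (A (\<sigma> r))) \<noteq> {}"
          using I(2) False finI \<sigma> unfolding independence_set_def by blast
        moreover have "(\<Inter>r\<in>I. D \<inter> translate G \<phi> r (A (\<sigma> r))) = (\<Inter>r\<in>I. D \<inter> \<phi> r -` A (\<sigma> r))"
          using Ic translate_vimage by (intro INF_cong refl) auto
        ultimately show ?thesis by simp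
      qed simp
      moreover have "c / 2 * real n \<le> c * real (card F)"
      proof -
        have "real n \<le> 2 * real (card F)" using F(3) by linarith
        then have "c / 2 * real n \<le> c / 2 * (2 * real (card F))" using dc(2) by (intro mult_left_mono) auto
        then show ?thesis by simp
      qed
      ultimately show "\<exists>I\<subseteq>F. (\<forall>\<sigma>\<in>I \<rightarrow> {1..k}. (\<Inter>r\<in>I. D \<inter> \<phi> r -` A (\<sigma> r)) \<noteq> {}) \<and> real (card I) \<ge> c / 2 * real n"
        using I(1,3) by (intro exI[of _ I] conjI ballI) auto
    qed (use dc(2) in auto)
    then have "b * n \<le> H n" by (simp add: b_def)
    then have "b \<le> 1 / real n * H n" using n0 by (simp add: field_simps)
    then show ?thesis using n by (intro exI[of _ n]) auto
  qed
  have "seq_entropy G \<phi> M P s > 0"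
  proof (rule ccontr)
    assume "\<not> ?thesis"
    then have "limsup (\<lambda>n. ereal (1 / real n * H n)) \<le> 0"
      unfolding seq_entropy_def H_def by (rule leI)
    also have "0 < ereal b" using b by simp
    finally have "\<forall>\<^sub>F n in sequentially. ereal (1 / real n * H n) < ereal b" by (rule Limsup_lessD)
    then obtain N where "\<And>n. n \<ge> N \<Longrightarrow> 1 / real n * H n < b" by (auto simp: eventually_sequentially)
    then show False using large[of N] by (meson not_less)
  qed
  then show ?thesis using s(1) by blast
qed

section \<open>The characterization\<close>

text \<open>
  Repeated entries of the tuple share one set \<open>V\<close>, so independence for the family indexed by the distinct
  points yields independence for the tuple. A partition into almost periodic sets refining the cover is
  excluded because it has zero entropy along every sequence.
\<close>

lemma independence_density_of_seq_entropy:
  fixes U :: "nat \<Rightarrow> 'x set" and V :: "'x \<Rightarrow> 'x set" and x :: "nat \<Rightarrow> 'x"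
  assumes Y: "card (x ` {1..k}) \<ge> 2" and V: "\<And>y. y \<in> x ` {1..k} \<Longrightarrow> V y \<in> sets M"
    and disj: "disjoint_family_on V (x ` {1..k})"
    and VU: "\<And>i. i \<in> {1..k} \<Longrightarrow> V (x i) \<subseteq> U i"
    and ent: "\<And>P. finite_borel_partition M P \<Longrightarrow> refines_cover P ((\<lambda>y. UNIV - V y) ` x ` {1..k}) \<Longrightarrow>
      \<exists>s. range s \<subseteq> carrier G \<and> seq_entropy G \<phi> M P s > 0"
  shows "pos_seq_independence_density G \<phi> M k U"
proof -
  let ?Y = "x ` {1..k}"
  have disj': "\<And>y y'. y \<in> ?Y \<Longrightarrow> y' \<in> ?Y \<Longrightarrow> y \<noteq> y' \<Longrightarrow> V y \<inter> V y' = {}"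
    using disj unfolding disjoint_family_on_def by blast
  have no_partition: False
    if cell: "\<And>z. cell z \<in> ?Y" "\<And>z. z \<notin> V (cell z)" "\<And>y. {z. cell z = y} \<in> ap_sets" for cell
  proof -
    define P where "P = (\<lambda>y. {z. cell z = y}) ` ?Y - {{}}"
    have "z \<in> \<Union>P" for z
    proof -
      have "{z'. cell z' = cell z} \<in> P" unfolding P_def using cell(1)[of z] by blast
      then show ?thesis by blast
    qed
    then have "partition_on UNIV P" by (auto simp: partition_on_def disjoint_def P_def)
    moreover have PK: "P \<subseteq> ap_sets" using cell(3) by (auto simp: P_def)
    ultimately have fbp: "finite_borel_partition M P"
      using ap_sets_sub by (auto simp: finite_borel_partition_def P_def)
    have "refines_cover P ((\<lambda>y. UNIV - V y) ` ?Y)"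
      unfolding refines_cover_def
    proof
      fix B assume "B \<in> P"
      then obtain y where y: "y \<in> ?Y" "B = {z. cell z = y}" unfolding P_def by blast
      have "B \<subseteq> UNIV - V y" unfolding y(2) using cell(2) by auto
      then show "\<exists>C\<in>(\<lambda>y. UNIV - V y) ` ?Y. B \<subseteq> C" using y(1) by blast
    qed
    from ent[OF fbp this] obtain s where s: "range s \<subseteq> carrier G" "seq_entropy G \<phi> M P s > 0" by blast
    then show False using ap_partition_zero_entropy[OF s(1) fbp PK] by (meson not_less)
  qed
  have "\<exists>\<delta>>0. \<exists>c>0. \<forall>n0. \<exists>F. finite F \<and> F \<subseteq> carrier G \<and> card F \<ge> n0 \<and>
    (\<forall>D. (\<forall>s\<in>F. D s \<in> sets M \<and> measure M (D s) \<ge> 1 - \<delta>) \<longrightarrow>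
      (\<exists>I\<subseteq>F. (\<forall>\<sigma>\<in>I \<rightarrow> ?Y. (\<Inter>s\<in>I. D s \<inter> \<phi> s -` V (\<sigma> s)) \<noteq> {}) \<and> real (card I) \<ge> c * real (card F)))"
    by (rule independence_unless_ap_partition[OF _ Y V disj' no_partition]) (simp | assumption)+
  then obtain \<delta> c where dc: "\<delta> > 0" "c > 0" and ex: "\<And>n0. \<exists>F. finite F \<and> F \<subseteq> carrier G \<and> card F \<ge> n0 \<and>
    (\<forall>D. (\<forall>s\<in>F. D s \<in> sets M \<and> measure M (D s) \<ge> 1 - \<delta>) \<longrightarrow>
      (\<exists>I\<subseteq>F. (\<forall>\<sigma>\<in>I \<rightarrow> ?Y. (\<Inter>s\<in>I. D s \<inter> \<phi> s -` V (\<sigma> s)) \<noteq> {}) \<and> real (card I) \<ge> c * real (card F)))"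
    by (elim exE conjE) (rule that, assumption, assumption, erule spec)
  show ?thesis
    unfolding pos_seq_independence_density_def
  proof (rule exI[of _ \<delta>], rule conjI[OF dc(1)], rule exI[of _ c], rule conjI[OF dc(2)], intro allI impI)
    fix N :: real assume "N > 0"
    obtain F where F: "finite F" "F \<subseteq> carrier G" "card F \<ge> nat \<lceil>N\<rceil>" and
      FD: "\<And>D. (\<forall>s\<in>F. D s \<in> sets M \<and> measure M (D s) \<ge> 1 - \<delta>) \<Longrightarrow>
        \<exists>I\<subseteq>F. (\<forall>\<sigma>\<in>I \<rightarrow> ?Y. (\<Inter>s\<in>I. D s \<inter> \<phi> s -` V (\<sigma> s)) \<noteq> {}) \<and> real (card I) \<ge> c * real (card F)"
      using ex[of "nat \<lceil>N\<rceil>"] by (elim exE conjE) (rule that, assumption, assumption, assumption, erule allE, erule mp, assumption)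
    have FN: "real (card F) \<ge> N" using F(3) by linarith
    have "\<forall>D\<in>B_prime G M \<delta>. \<exists>I\<subseteq>F. independence_set G \<phi> k U D I \<and> real (card I) \<ge> c * real (card F)"
    proof
      fix D assume D: "D \<in> B_prime G M \<delta>"
      have "D s \<in> sets M" "measure M (D s) \<ge> 1 - \<delta>" if s: "s \<in> carrier G" for s
      proof -
        show "D s \<in> sets M" using D s by (auto simp: B_prime_def)
        have "(INF s\<in>carrier G. measure M (D s)) \<le> measure M (D s)"
          using s by (intro cINF_lower bdd_belowI2[of _ 0]) auto
        then show "measure M (D s) \<ge> 1 - \<delta>" using D by (auto simp: B_prime_def)
      qed
      then have "\<forall>s\<in>F. D s \<in> sets M \<and> measure M (D s) \<ge> 1 - \<delta>" using F(2) by blast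
      from FD[OF this] obtain I where I': "I \<subseteq> F \<and>
          (\<forall>\<sigma>\<in>I \<rightarrow> ?Y. (\<Inter>s\<in>I. D s \<inter> \<phi> s -` V (\<sigma> s)) \<noteq> {}) \<and> real (card I) \<ge> c * real (card F)" ..
      note I = I'[THEN conjunct1] I'[THEN conjunct2, THEN conjunct1] I'[THEN conjunct2, THEN conjunct2]
      have "(\<Inter>s\<in>J. D s \<inter> translate G \<phi> s (U (\<sigma> s))) \<noteq> {}"
        if J: "J \<subseteq> I" "\<sigma> \<in> J \<rightarrow> {1..k}" for J \<sigma>
      proof -
        obtain y0 where y0: "y0 \<in> ?Y" using Y by (metis all_not_in_conv card.empty not_numeral_le_zero)
        define \<tau> where "\<tau> = (\<lambda>s. if s \<in> J then x (\<sigma> s) else y0)"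
        have "\<tau> \<in> I \<rightarrow> ?Y"
        proof (rule Pi_I)
          fix s
          show "\<tau> s \<in> ?Y"
          proof (cases "s \<in> J")
            case True
            then have "x (\<sigma> s) \<in> ?Y" by (intro imageI funcset_mem[OF J(2)])
            then show ?thesis using True by (simp only: \<tau>_def if_True)
          qed (use y0 in \<open>simp only: \<tau>_def if_False\<close>)
        qed
        from bspec[OF I(2) this] obtain z where z0: "z \<in> (\<Inter>s\<in>I. D s \<inter> \<phi> s -` V (\<tau> s))" unfolding ex_in_conv[symmetric] ..
        have z: "z \<in> D s \<and> \<phi> s z \<in> V (\<tau> s)" if "s \<in> I" for s using INT_D[OF z0 that] by simp
        have "z \<in> D s \<inter> translate G \<phi> s (U (\<sigma> s))" if s: "s \<in> J" for s
        proof -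
          have sI: "s \<in> I" "s \<in> carrier G" using s J(1) I(1) F(2) by auto
          have "\<sigma> s \<in> {1..k}" using J(2) s by auto
          then have "V (\<tau> s) \<subseteq> U (\<sigma> s)" using VU s by (simp add: \<tau>_def)
          then show ?thesis using z[OF sI(1)] translate_vimage[OF sI(2)] by auto
        qed
        then show ?thesis by blast
      qed
      then have "independence_set G \<phi> k U D I"
        unfolding independence_set_def using I(1) F(2) by blast
      then show "\<exists>I\<subseteq>F. independence_set G \<phi> k U D I \<and> real (card I) \<ge> c * real (card F)"
        using I(1,3) by (intro exI[of _ I] conjI)
    qed
    then show "\<exists>F. finite F \<and> F \<subseteq> carrier G \<and> real (card F) \<ge> N \<and>
        (\<forall>D\<in>B_prime G M \<delta>. \<exists>I\<subseteq>F. independence_set G \<phi> k U D I \<and> real (card I) \<ge> c * real (card F))"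
      using F(1,2) FN by (intro exI[of _ F] conjI)
  qed
qed

end

lemma disjoint_open_neighbourhoods:
  fixes Y :: "'x::t2_space set"
  assumes "finite Y" "\<And>y. y \<in> Y \<Longrightarrow> open (W y)" "\<And>y. y \<in> Y \<Longrightarrow> y \<in> W y"
  obtains V where "\<And>y. y \<in> Y \<Longrightarrow> open (V y)" "\<And>y. y \<in> Y \<Longrightarrow> y \<in> V y" "\<And>y. y \<in> Y \<Longrightarrow> V y \<subseteq> W y"
    "disjoint_family_on V Y"
proof -
  define S where "S = (\<lambda>y z. SOME p :: 'x set \<times> 'x set. open (fst p) \<and> open (snd p) \<and> y \<in> fst p \<and> z \<in> snd p
      \<and> fst p \<inter> snd p = {})"
  have S: "open (fst (S y z)) \<and> open (snd (S y z)) \<and> y \<in> fst (S y z) \<and> z \<in> snd (S y z)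
      \<and> fst (S y z) \<inter> snd (S y z) = {}" if "y \<noteq> z" for y z
  proof -
    obtain A B where "open A" "open B" "y \<in> A" "z \<in> B" "A \<inter> B = {}" using hausdorff[OF \<open>y \<noteq> z\<close>] by blast
    then have "\<exists>p. open (fst p) \<and> open (snd p) \<and> y \<in> fst p \<and> z \<in> snd p \<and> fst p \<inter> snd p = {}"
      by (intro exI[of _ "(A, B)"]) simp
    then show ?thesis unfolding S_def by (rule someI_ex)
  qed
  define V where "V = (\<lambda>y. W y \<inter> (\<Inter>z\<in>Y - {y}. fst (S y z) \<inter> snd (S z y)))"
  show ?thesis
  proof (rule that[of V])
    fix y assume y: "y \<in> Y"
    show "open (V y)" unfolding V_def
    proof (intro open_Int open_INT ballI assms(2)[OF y])
      show "finite (Y - {y})" using assms(1) by simp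
      fix z assume "z \<in> Y - {y}"
      then show "open (fst (S y z))" "open (snd (S z y))" using S[of y z] S[of z y] by auto
    qed
    show "y \<in> V y" unfolding V_def
    proof (intro IntI INT_I assms(3)[OF y])
      fix z assume "z \<in> Y - {y}"
      then show "y \<in> fst (S y z)" "y \<in> snd (S z y)" using S[of y z] S[of z y] by auto
    qed
    show "V y \<subseteq> W y" unfolding V_def by blast
  next
    show "disjoint_family_on V Y"
      unfolding disjoint_family_on_def
    proof (intro ballI impI)
      fix y z assume yz: "y \<in> Y" "z \<in> Y" "y \<noteq> z"
      then have "V y \<subseteq> fst (S y z)" "V z \<subseteq> snd (S y z)" unfolding V_def by auto
      then show "V y \<inter> V z = {}" using S[OF yz(3)] by blast
    qed
  qed
qed

lemma pmp_action_of_homeomorphisms: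
  fixes G :: "('g, 'm) monoid_scheme" and \<phi> :: "'g \<Rightarrow> 'x::topological_space \<Rightarrow> 'x"
  assumes act: "group_action G UNIV \<phi>"
    and homeo: "\<And>s. s \<in> carrier G \<Longrightarrow> homeomorphic_map euclidean euclidean (\<phi> s)"
    and prob: "prob_space \<mu>" and borel: "sets \<mu> = sets borel" and inv: "invariant_measure G \<phi> \<mu>"
  shows "pmp_action G \<phi> \<mu>"
proof -
  interpret group_action G UNIV \<phi> by (rule act)
  interpret prob_space \<mu> by (rule prob)
  have sp: "space \<mu> = UNIV" using sets_eq_imp_space_eq[OF borel] by simp
  have meas: "\<phi> s \<in> measurable \<mu> \<mu>" if "s \<in> carrier G" for s
  proof -
    have "continuous_on UNIV (\<phi> s)"
      using homeomorphic_imp_continuous_map[OF homeo[OF that]] by simp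
    then have "\<phi> s \<in> borel_measurable borel" by (rule borel_measurable_continuous_onI)
    then show ?thesis using measurable_cong_sets[OF borel borel] by blast
  qed
  have "distr \<mu> \<mu> (\<phi> s) = \<mu>" if s: "s \<in> carrier G" for s
  proof (rule measure_eqI)
    fix A assume "A \<in> sets (distr \<mu> \<mu> (\<phi> s))"
    then have A: "A \<in> sets \<mu>" by simp
    have "\<phi> s ` (\<phi> s -` A) = A" using surj_prop[OF s] by auto
    moreover have "\<phi> s -` A \<in> sets \<mu>" using measurable_sets[OF meas[OF s] A] sp by simp
    ultimately have "emeasure \<mu> (\<phi> s -` A) = emeasure \<mu> A"
      using inv s unfolding invariant_measure_def by metis
    then show "emeasure (distr \<mu> \<mu> (\<phi> s)) A = emeasure \<mu> A"
      using emeasure_distr[OF meas[OF s] A] sp by simp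
  qed simp
  then show ?thesis using sp meas by unfold_locales auto
qed

text \<open>
  For the implication from right to left, the given neighbourhoods are first shrunk to disjoint open ones,
  one for each distinct point, which is the situation of the definition of a sequence entropy tuple.
\<close>

theorem theorem4p9:
  fixes G :: "('g, 'm) monoid_scheme"
    and \<phi> :: "'g \<Rightarrow> 'x::t2_space \<Rightarrow> 'x"
    and \<mu> :: "'x measure"
    and k :: nat
    and x :: "nat \<Rightarrow> 'x"
  assumes "compact (UNIV :: 'x set)"
    and "group_action G UNIV \<phi>"
    and "\<And>s. s \<in> carrier G \<Longrightarrow> homeomorphic_map euclidean euclidean (\<phi> s)"
    and "prob_space \<mu>"
    and "regular_borel_measure \<mu>"
    and "invariant_measure G \<phi> \<mu>"
    and "k \<ge> 2"
    and "nondiagonal k x"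
  shows "IN_tuple G \<phi> \<mu> k x \<longleftrightarrow> seq_entropy_tuple G \<phi> \<mu> k x"
proof -
  have borel: "sets \<mu> = sets borel" using assms(5) by (simp add: regular_borel_measure_def)
  interpret pmp_action G \<phi> \<mu>
    by (rule pmp_action_of_homeomorphisms[OF assms(2,3,4) borel assms(6)])
  let ?Y = "x ` {1..k}"
  obtain i j where ij: "i \<in> {1..k}" "j \<in> {1..k}" "x i \<noteq> x j" using assms(8) unfolding nondiagonal_def by blast
  have "card {x i, x j} \<le> card ?Y" using ij by (intro card_mono) auto
  then have Y2: "card ?Y \<ge> 2" using ij(3) by simp
  show ?thesis
  proof
    assume IN: "IN_tuple G \<phi> \<mu> k x"
    show "seq_entropy_tuple G \<phi> \<mu> k x"
      unfolding seq_entropy_tuple_def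
    proof (intro conjI allI impI assms(7,8); elim conjE)
      fix U P
      assume U: "\<forall>y\<in>?Y. U y \<in> sets \<mu> \<and> y \<in> interior (U y)"
        and P: "finite_borel_partition \<mu> P" "refines_cover P ((\<lambda>y. UNIV - U y) ` ?Y)"
      show "\<exists>s. range s \<subseteq> carrier G \<and> seq_entropy G \<phi> \<mu> P s > 0"
      proof (rule positive_entropy_of_independence[OF P(1) _ assms(7)])
        show "pos_seq_independence_density G \<phi> \<mu> k (\<lambda>i. U (x i))"
          using IN U unfolding IN_tuple_def by auto
        fix B assume "B \<in> P"
        then obtain i where "i \<in> {1..k}" "B \<subseteq> UNIV - U (x i)"
          using P(2) unfolding refines_cover_def by blast
        then show "\<exists>i\<in>{1..k}. B \<inter> U (x i) = {}" by blast
      qed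
    qed
  next
    assume SE: "seq_entropy_tuple G \<phi> \<mu> k x"
    show "IN_tuple G \<phi> \<mu> k x"
      unfolding IN_tuple_def
    proof (intro allI impI)
      fix U :: "nat \<Rightarrow> 'x set" assume U: "\<forall>i\<in>{1..k}. x i \<in> interior (U i)"
      define W where "W = (\<lambda>y. \<Inter>i\<in>{i\<in>{1..k}. x i = y}. interior (U i))"
      have W: "open (W y)" "y \<in> W y" for y unfolding W_def using U by (auto intro!: open_INT)
      have fin: "finite ?Y" by simp
      obtain V where V: "\<And>y. y \<in> ?Y \<Longrightarrow> open (V y)" "\<And>y. y \<in> ?Y \<Longrightarrow> y \<in> V y"
        "\<And>y. y \<in> ?Y \<Longrightarrow> V y \<subseteq> W y" "disjoint_family_on V ?Y"
        by (rule disjoint_open_neighbourhoods[of ?Y W, OF fin W]) (rule that)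
      have Vm: "V y \<in> sets \<mu>" if "y \<in> ?Y" for y using V(1)[OF that] borel by simp
      show "pos_seq_independence_density G \<phi> \<mu> k U"
      proof (rule independence_density_of_seq_entropy[OF Y2 Vm V(4)])
        fix i assume i: "i \<in> {1..k}"
        then have "V (x i) \<subseteq> W (x i)" using V(3) by blast
        also have "\<dots> \<subseteq> interior (U i)" unfolding W_def using i by blast
        also have "\<dots> \<subseteq> U i" by (rule interior_subset)
        finally show "V (x i) \<subseteq> U i" .
      next
        fix P assume P: "finite_borel_partition \<mu> P" "refines_cover P ((\<lambda>y. UNIV - V y) ` ?Y)"
        have "\<forall>y\<in>?Y. V y \<in> sets \<mu> \<and> y \<in> interior (V y)" using Vm V(1,2) by (simp add: interior_open)
        then show "\<exists>s. range s \<subseteq> carrier G \<and> seq_entropy G \<phi> \<mu> P s > 0"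
          using SE V(4) P unfolding seq_entropy_tuple_def by blast
      qed
    qed
  qed
qed

end
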